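(* Let $Y(\alpha,0)$ be a smooth toric hyperkähler manifold with nonempty core, and let $\epsilon\in\Theta$. If $X(\mathcal{A}_\epsilon)$ is not empty, then its cotangent bundle $T^*X(\mathcal{A}_\epsilon)\cong U_\epsilon$ is contained in $Y(\alpha,0)$ as an open dense subset.
   Context: Let $T^d$ be the real $d$-torus with Lie algebra $\mathfrak{t}\cong\mathbb{R}^d$, standard basis $e_1,\dots,e_d$ and dual basis $e_1^*,\dots,e_d^*$. Let $M\subset T^d$ be a connected $m$-dimensional subtorus with Lie algebra $\mathfrak{m}$ and complexification $M_{\mathbb{C}}$, and $N=T^d/M$ with Lie algebra $\mathfrak{n}=\mathfrak{t}/\mathfrak{m}$ of dimension $n=d-m$. There are exact sequences $0\to\mathfrak{m}\xrightarrow{\iota}\mathfrak{t}\xrightarrow{\pi}\mathfrak{n}\to0$ and $0\to\mathfrak{n}^*\xrightarrow{\pi^*}\mathfrak{t}^*\xrightarrow{\iota^*}\mathfrak{m}^*\to0$. Put $u_i=\pi(e_i)$, assumed to be primitive vectors of the lattice $\mathfrak{n}_{\mathbb{Z}}=\pi(\mathbb{Z}^d)$. $T^d$ acts on $\mathbb{H}^d\cong\mathbb{C}^d\times\mathbb{C}^d$ by $(z,w)\zeta=(z\zeta,w\zeta^{-1})$; $M$ has hyperkähler moment map $\mu=(\mu_{\mathbb{R}},\mu_{\mathbb{C}}):\mathbb{H}^d\to\mathfrak{m}^*\times\mathfrak{m}^*_{\mathbb{C}}$, $\mu_{\mathbb{R}}(z,w)=\frac12\sum_i(|z_i|^2-|w_i|^2)\iota^*e_i^*$,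 $\mu_{\mathbb{C}}(z,w)=\sum_iz_iw_i\,\iota^*e_i^*$. For $\alpha\in\mathfrak{m}^*$, $Y(\alpha,0)=\mu^{-1}(\alpha,0)/M$. "Smooth" means: $\{u_i\}$ is regular (every $n$ linearly independent vectors among the $u_i$ form a $\mathbb{Z}$-basis of $\mathfrak{n}_{\mathbb{Z}}$) and $(\alpha,0)$ is a regular value of $\mu$. Semi-stability and GIT description: $(z,w)\in\mu_{\mathbb{C}}^{-1}(0)$ is $\alpha$-semi-stable if $\alpha\in\sum_i\mathbb{R}_{\ge0}|z_i|^2\iota^*e_i^*+\sum_i\mathbb{R}_{\ge0}|w_i|^2(-\iota^*e_i^* )$. In the smooth case $Y(\alpha,0)$ is identified with the geometric quotient $\mu_{\mathbb{C}}^{-1}(0)^{\alpha\text{-}ss}/M_{\mathbb{C}}$. Arrangements: choose a lift $\lambda\in\mathbb{R}^d$ with $\alpha=\sum_i\lambda_i\iota^*e_i^*$, and let $\mathcal{A}=\{(H_i,u_i)\}$, $H_i=\{x\in\mathfrak{n}^*\mid\langle u_i,x\rangle+\lambda_i=0\}$. Let $\Theta$ be the set of maps $\epsilon:\{1,\dots,d\}\to\{-1,1\}$. For $\epsilon\in\Theta$, $\mathcal{A}_\epsilon$ is the arrangement with the same hyperplanes and normals $\epsilon(i)u_i$, with associated polyhedron $\Delta_\epsilon=\{x\in\mathfrak{n}^*\mid\epsilon(i)(\langle u_i,x\rangle+\lambda_i)\ge0\text{ for all }i\}$. Let $J=\{i\mid\epsilon(i)=1\}$ and $\bar J$ its complement.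 Let $(\mathbb{C}^d)^{\alpha\text{-}ss}_\epsilon$ be the set of $(z_J,w_{\bar J})\in\mathbb{C}^d$ (coordinates $z_i$, $i\in J$, and $w_i$, $i\in\bar J$) with $\alpha\in\sum_{i\in J}\mathbb{R}_{\ge0}|z_i|^2\iota^*e_i^*+\sum_{i\in\bar J}\mathbb{R}_{\ge0}|w_i|^2(-\iota^*e_i^* )$. The toric variety of $\mathcal{A}_\epsilon$ is $X(\mathcal{A}_\epsilon)=(\mathbb{C}^d)^{\alpha\text{-}ss}_\epsilon/M_{\mathbb{C}}$, identified with $Z_\epsilon=\{[z,w]\in Y(\alpha,0)\mid w_i=0\text{ if }\epsilon(i)=1,\ z_i=0\text{ if }\epsilon(i)=-1\}$. The core of $Y(\alpha,0)$ is the union of the $Z_\epsilon$ over those $\epsilon$ with $\Delta_\epsilon$ bounded; it is nonempty iff some $\Delta_\epsilon$ is nonempty and bounded. The set $U_\epsilon\subset Y(\alpha,0)$ is the quotient by $M_{\mathbb{C}}$ of $\{(z,w)\in\mu_{\mathbb{C}}^{-1}(0)\mid(z_J,w_{\bar J})\in(\mathbb{C}^d)^{\alpha\text{-}ss}_\epsilon\}$ (the remaining $d$ coordinates being unrestricted apart from $\mu_{\mathbb{C}}=0$). It is a known result that, when $X(\mathcal{A}_\epsilon)\neq\emptyset$, $U_\epsilon$ is an open subset isomorphic to $T^*X(\mathcal{A}_\epsilon)$; this is the sense in which $T^*X(\mathcal{A}_\epsilon)$ is contained in $Y(\alpha,0)$. *)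

theory Defs
  imports "HOL-Analysis.Analysis"
begin

section \<open>Quotient spaces, complex spaces, cotangent bundles\<close>

definition quotient_topology :: "'a topology \<Rightarrow> ('a \<Rightarrow> 'b) \<Rightarrow> 'b topology" where
  "quotient_topology X q =
     topology (\<lambda>U. U \<subseteq> q ` topspace X \<and> openin X {x \<in> topspace X. q x \<in> U})"

lemma openin_quotient_topology:
  "openin (quotient_topology X q) U \<longleftrightarrow>
     U \<subseteq> q ` topspace X \<and> openin X {x \<in> topspace X. q x \<in> U}"
proof -
  have "istopology (\<lambda>U. U \<subseteq> q ` topspace X \<and> openin X {x \<in> topspace X. q x \<in> U})"
    unfolding istopology_def
  proof (intro conjI allI impI; (elim conjE)?)
    fix S T
    assume "openin X {x \<in> topspace X. q x \<in> S}" "openin X {x \<in> topspace X. q x \<in> T}"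
    then have "openin X ({x \<in> topspace X. q x \<in> S} \<inter> {x \<in> topspace X. q x \<in> T})" by blast
    moreover have "{x \<in> topspace X. q x \<in> S} \<inter> {x \<in> topspace X. q x \<in> T}
        = {x \<in> topspace X. q x \<in> S \<inter> T}" by blast
    ultimately show "openin X {x \<in> topspace X. q x \<in> S \<inter> T}" by simp
  next
    fix K
    assume K: "\<forall>S\<in>K. S \<subseteq> q ` topspace X \<and> openin X {x \<in> topspace X. q x \<in> S}"
    then have "openin X (\<Union>S\<in>K. {x \<in> topspace X. q x \<in> S})" by blast
    moreover have "(\<Union>S\<in>K. {x \<in> topspace X. q x \<in> S}) = {x \<in> topspace X. q x \<in> \<Union>K}" by blast
    ultimately show "openin X {x \<in> topspace X. q x \<in> \<Union>K}" by simp
  qed blast+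
  then show ?thesis
    by (simp add: quotient_topology_def)
qed

text \<open>Complex differentiability in several variables, on a real normed space carrying
  the scalar multiplication \<open>sc\<close> by complex numbers: \<^term>\<open>(*s)\<close> on
  \<open>complex ^ 'k\<close>, and \<open>csc2\<close> on pairs of such vectors.\<close>

definition csc2 :: "complex \<Rightarrow> (complex^'k) \<times> (complex^'l) \<Rightarrow> (complex^'k) \<times> (complex^'l)" where
  "csc2 c = (\<lambda>(a, b). (c *s a, c *s b))"

definition cdiff_at ::
    "(complex \<Rightarrow> 'a::real_normed_vector \<Rightarrow> 'a) \<Rightarrow> ('a \<Rightarrow> complex) \<Rightarrow> 'a \<Rightarrow> bool" where
  "cdiff_at sc F p \<longleftrightarrow>
     (\<exists>D. (F has_derivative D) (at p) \<and> (\<forall>c v. D (sc c v) = c * D v))"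

text \<open>Holomorphic functions on an arbitrary subset \<open>S\<close> (in particular on a locally
  closed complex submanifold) are the functions that locally extend to holomorphic functions
  of the ambient space.\<close>

definition holo_on ::
    "(complex \<Rightarrow> 'a::real_normed_vector \<Rightarrow> 'a) \<Rightarrow> 'a set \<Rightarrow> ('a \<Rightarrow> complex) \<Rightarrow> bool" where
  "holo_on sc S F \<longleftrightarrow>
     (\<forall>p\<in>S. \<exists>G E. open G \<and> p \<in> G \<and> (\<forall>q\<in>G. cdiff_at sc E q) \<and> (\<forall>q \<in> G \<inter> S. E q = F q))"

text \<open>A complex space is a topological space together with, for each open \<open>W\<close>,
  the predicate of being holomorphic on \<open>W\<close> (values outside \<open>W\<close> are irrelevant).\<close>

type_synonym 'a cspace = "'a topology \<times> ('a set \<Rightarrow> ('a \<Rightarrow> complex) \<Rightarrow> bool)"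

definition affine_cspace :: "(complex^'n) cspace" where
  "affine_cspace = (euclidean, holo_on (*s))"

definition open_subspace :: "'a cspace \<Rightarrow> 'a set \<Rightarrow> 'a cspace" where
  "open_subspace X W = (subtopology (fst X) W, snd X)"

definition biholomorphic_map :: "'a cspace \<Rightarrow> 'b cspace \<Rightarrow> ('a \<Rightarrow> 'b) \<Rightarrow> bool" where
  "biholomorphic_map X Y \<Phi> \<longleftrightarrow> homeomorphic_map (fst X) (fst Y) \<Phi> \<and>
     (\<forall>V f. openin (fst Y) V \<longrightarrow>
        (snd Y V f \<longleftrightarrow> snd X {x \<in> topspace (fst X). \<Phi> x \<in> V} (f \<circ> \<Phi>)))"

type_synonym ('a, 'n) chart = "'a set \<times> ('a \<Rightarrow> complex^'n)"

definition is_chart :: "'a cspace \<Rightarrow> ('a, 'n::finite) chart \<Rightarrow> bool" where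
  "is_chart X = (\<lambda>(W, \<phi>). openin (fst X) W \<and> open (\<phi> ` W) \<and>
     biholomorphic_map (open_subspace X W) (open_subspace affine_cspace (\<phi> ` W)) \<phi>)"

text \<open>A cotangent vector at \<open>x\<close> is represented by its components in every
  holomorphic chart around \<open>x\<close>; the cotangent space is the set of differentials at
  \<open>x\<close> of holomorphic functions defined near \<open>x\<close>.\<close>

type_synonym ('a, 'n) covector = "('a, 'n) chart \<Rightarrow> complex^'n \<Rightarrow> complex"

definition differential ::
    "'a cspace \<Rightarrow> 'a \<Rightarrow> ('a \<Rightarrow> complex) \<Rightarrow> ('a, 'n::finite) covector" where
  "differential X x g = (\<lambda>(W, \<phi>).
     if is_chart X (W, \<phi>) \<and> x \<in> W
     then frechet_derivative (g \<circ> inv_into W \<phi>) (at (\<phi> x)) else (\<lambda>_. 0))"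

definition cotangent_points :: "'a cspace \<Rightarrow> ('a \<times> ('a, 'n::finite) covector) set" where
  "cotangent_points X =
     {(x, \<xi>). \<exists>V g. openin (fst X) V \<and> x \<in> V \<and> snd X V g \<and> \<xi> = differential X x g}"

text \<open>The chart \<open>(W, \<phi>)\<close> identifies \<open>\<phi> ` W \<times> C\<^sup>n\<close> with the cotangent bundle
  over \<open>W\<close> by \<open>(y, c) \<mapsto> \<Sum>i. c\<^sub>i d\<phi>\<^sub>i\<close> at \<open>\<phi>\<inverse> y\<close>. These maps define the topology
  and the complex structure of the cotangent bundle.\<close>

definition triv :: "'a cspace \<Rightarrow> ('a, 'n::finite) chart \<Rightarrow>
    (complex^'n) \<times> (complex^'n) \<Rightarrow> 'a \<times> ('a, 'n) covector" where
  "triv X = (\<lambda>(W, \<phi>) (y, c).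
     (inv_into W \<phi> y, differential X (inv_into W \<phi> y) (\<lambda>x. \<Sum>i\<in>UNIV. c $ i * \<phi> x $ i)))"

definition triv_preimage :: "'a cspace \<Rightarrow> ('a, 'n::finite) chart \<Rightarrow>
    ('a \<times> ('a, 'n) covector) set \<Rightarrow> ((complex^'n) \<times> (complex^'n)) set" where
  "triv_preimage X \<kappa> G = {(y, c). y \<in> snd \<kappa> ` fst \<kappa> \<and> triv X \<kappa> (y, c) \<in> G}"

definition cotangent_topology :: "'a cspace \<Rightarrow> ('a \<times> ('a, 'n::finite) covector) topology" where
  "cotangent_topology X = topology (\<lambda>G. G \<subseteq> cotangent_points X \<and>
     (\<forall>\<kappa>. is_chart X \<kappa> \<longrightarrow> open (triv_preimage X \<kappa> G)))"

lemma openin_cotangent_topology: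
  fixes G :: "('a \<times> ('a, 'n::finite) covector) set"
  shows "openin (cotangent_topology X) G \<longleftrightarrow> G \<subseteq> cotangent_points X \<and>
     (\<forall>\<kappa>. is_chart X \<kappa> \<longrightarrow> open (triv_preimage X \<kappa> G))"
proof -
  have int: "triv_preimage X \<kappa> (S \<inter> T) = triv_preimage X \<kappa> S \<inter> triv_preimage X \<kappa> T"
    for \<kappa> S T by (auto simp: triv_preimage_def)
  have un: "triv_preimage X \<kappa> (\<Union>K) = (\<Union>S\<in>K. triv_preimage X \<kappa> S)"
    for \<kappa> K by (auto simp: triv_preimage_def)
  have "istopology (\<lambda>G :: ('a \<times> ('a, 'n) covector) set. G \<subseteq> cotangent_points X \<and>
     (\<forall>\<kappa>. is_chart X \<kappa> \<longrightarrow> open (triv_preimage X \<kappa> G)))"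
    unfolding istopology_def by (auto simp: int un)
  then show ?thesis
    unfolding cotangent_topology_def by (simp only: topology_inverse')
qed

definition cotangent_bundle :: "'a cspace \<Rightarrow> ('a \<times> ('a, 'n::finite) covector) cspace" where
  "cotangent_bundle X = (cotangent_topology X,
     \<lambda>G F. \<forall>\<kappa>. is_chart X \<kappa> \<longrightarrow> holo_on csc2 (triv_preimage X \<kappa> G) (F \<circ> triv X \<kappa>))"


section \<open>Subtori of \<open>T\<^sup>d\<close>\<close>

text \<open>\<open>T\<^sup>d\<close> is the group of \<open>t\<close> in \<open>C\<^sup>d\<close> with all \<open>\<bar>t\<^sub>i\<bar> = 1\<close>, with
  exponential map \<open>v \<mapsto> (exp (2\<pi>\<i> v\<^sub>i))\<^sub>i\<close>, whose kernel is the lattice \<open>Z\<^sup>d\<close>.\<close>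

definition subtorus :: "(complex^'d) set \<Rightarrow> bool" where
  "subtorus M \<longleftrightarrow> M \<subseteq> {t. \<forall>i. norm (t $ i) = 1} \<and> 1 \<in> M \<and>
     (\<forall>s\<in>M. \<forall>t\<in>M. s * t \<in> M) \<and> (\<forall>t\<in>M. (\<chi> i. inverse (t $ i)) \<in> M) \<and>
     closed M \<and> connected M"

definition lie :: "(complex^'d) set \<Rightarrow> (real^'d) set" where
  "lie M = {v. \<forall>s::real. (\<chi> i. cis (2 * pi * (s * v $ i))) \<in> M}"

definition complexification :: "(complex^'d) set \<Rightarrow> (complex^'d) set" where
  "complexification M =
     {(\<chi> i. exp (2 * pi * \<i> * Complex (x $ i) (y $ i))) | x y. x \<in> lie M \<and> y \<in> lie M}"

definition int_lattice :: "(real^'d) set" where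
  "int_lattice = {v. \<forall>i. v $ i \<in> \<int>}"

definition primitive_in :: "'v::real_vector set \<Rightarrow> 'v \<Rightarrow> bool" where
  "primitive_in L u \<longleftrightarrow> u \<in> L \<and> u \<noteq> 0 \<and>
     (\<forall>v\<in>L. \<forall>k::int. u = of_int k *\<^sub>R v \<longrightarrow> \<bar>k\<bar> = 1)"

text \<open>\<open>proj\<close> is the projection of \<open>R\<^sup>d\<close> onto the Lie algebra of \<open>T\<^sup>d/M\<close>, for which
  \<open>real ^ 'n\<close> serves as a model.\<close>

definition normal :: "(real^'d \<Rightarrow> real^'n) \<Rightarrow> 'd \<Rightarrow> real^'n" where
  "normal proj i = proj (axis i 1)"

definition int_span :: "'v::real_vector set \<Rightarrow> 'v set" where
  "int_span B = {\<Sum>b\<in>B. of_int (c b) *\<^sub>R b | c. True}"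

definition regular_normals :: "(real^'d \<Rightarrow> real^'n) \<Rightarrow> bool" where
  "regular_normals proj \<longleftrightarrow>
     (\<forall>B \<subseteq> range (normal proj). independent B \<and> card B = CARD('n) \<longrightarrow>
        int_span B = proj ` int_lattice)"


section \<open>Moment maps and toric hyperkaehler varieties\<close>

text \<open>The dual of a subspace \<open>m\<close> of \<open>R\<^sup>d\<close> consists of the linear functionals on \<open>m\<close>,
  encoded as functions that are \<^const>\<open>undefined\<close> outside \<open>m\<close>. The complexified dual
  is the space of real-linear maps from \<open>m\<close> to the complex numbers. The element
  \<open>\<iota>\<^sup>*e\<^sub>i\<^sup>*\<close> is \<open>v \<mapsto> v\<^sub>i\<close> on \<open>m\<close>.\<close>

definition dual_of :: "(real^'d) set \<Rightarrow> (real^'d \<Rightarrow> 'b::real_vector) set" where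
  "dual_of m = {restrict f m | f. linear f}"

definition lift_to :: "(complex^'d) set \<Rightarrow> real^'d \<Rightarrow> (real^'d \<Rightarrow> real)" where
  "lift_to M l = (\<lambda>v\<in>lie M. \<Sum>i\<in>UNIV. l $ i * v $ i)"

definition mu_R :: "(complex^'d) set \<Rightarrow> (complex^'d) \<times> (complex^'d) \<Rightarrow> (real^'d \<Rightarrow> real)" where
  "mu_R M = (\<lambda>(z, w). \<lambda>v\<in>lie M.
     1/2 * (\<Sum>i\<in>UNIV. ((norm (z $ i))\<^sup>2 - (norm (w $ i))\<^sup>2) * v $ i))"

definition mu_C :: "(complex^'d) set \<Rightarrow> (complex^'d) \<times> (complex^'d) \<Rightarrow> (real^'d \<Rightarrow> complex)" where
  "mu_C M = (\<lambda>(z, w). \<lambda>v\<in>lie M. \<Sum>i\<in>UNIV. z $ i * w $ i * of_real (v $ i))"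

definition zero_C :: "(complex^'d) set \<Rightarrow> (real^'d \<Rightarrow> complex)" where
  "zero_C M = (\<lambda>v\<in>lie M. 0)"

definition mu_fibre ::
    "(complex^'d) set \<Rightarrow> (real^'d \<Rightarrow> real) \<Rightarrow> ((complex^'d) \<times> (complex^'d)) set" where
  "mu_fibre M \<alpha> = {p. mu_R M p = \<alpha> \<and> mu_C M p = zero_C M}"

text \<open>The derivative of \<open>\<mu>\<close> at \<open>p\<close>, computed by evaluating \<open>\<mu>\<close> at each \<open>v\<close> in
  the Lie algebra of \<open>M\<close>.\<close>

definition dmu :: "(complex^'d) set \<Rightarrow> (complex^'d) \<times> (complex^'d) \<Rightarrow> (complex^'d) \<times> (complex^'d)
    \<Rightarrow> (real^'d \<Rightarrow> real) \<times> (real^'d \<Rightarrow> complex)" where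
  "dmu M p h =
     ((\<lambda>v\<in>lie M. frechet_derivative (\<lambda>q. mu_R M q v) (at p) h),
      (\<lambda>v\<in>lie M. frechet_derivative (\<lambda>q. mu_C M q v) (at p) h))"

definition regular_value :: "(complex^'d) set \<Rightarrow> (real^'d \<Rightarrow> real) \<Rightarrow> bool" where
  "regular_value M \<alpha> \<longleftrightarrow>
     (\<forall>p \<in> mu_fibre M \<alpha>. range (dmu M p) = dual_of (lie M) \<times> dual_of (lie M))"

definition smooth :: "(complex^'d) set \<Rightarrow> (real^'d \<Rightarrow> real^'n) \<Rightarrow> (real^'d \<Rightarrow> real) \<Rightarrow> bool" where
  "smooth M proj \<alpha> \<longleftrightarrow> regular_normals proj \<and> regular_value M \<alpha>"

text \<open>\<open>horbit T p\<close> is the orbit of \<open>p\<close> for the action \<open>(z, w)t = (zt, wt\<inverse>)\<close>, where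
  \<open>T\<close> is \<open>M\<close> or its complexification.\<close>

definition horbit :: "(complex^'d) set \<Rightarrow> (complex^'d) \<times> (complex^'d)
    \<Rightarrow> ((complex^'d) \<times> (complex^'d)) set" where
  "horbit T = (\<lambda>(z, w). {(\<chi> i. z $ i * t $ i, \<chi> i. w $ i * inverse (t $ i)) | t. t \<in> T})"

definition Y_top :: "(complex^'d) set \<Rightarrow> (real^'d \<Rightarrow> real)
    \<Rightarrow> ((complex^'d) \<times> (complex^'d)) set topology" where
  "Y_top M \<alpha> = quotient_topology (subtopology euclidean (mu_fibre M \<alpha>)) (horbit M)"

definition semistable ::
    "(complex^'d) set \<Rightarrow> (real^'d \<Rightarrow> real) \<Rightarrow> ((complex^'d) \<times> (complex^'d)) set" where
  "semistable M \<alpha> = {(z, w). mu_C M (z, w) = zero_C M \<and>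
     (\<exists>a b. (\<forall>i. a i \<ge> 0 \<and> b i \<ge> 0) \<and>
        \<alpha> = (\<lambda>v\<in>lie M. (\<Sum>i\<in>UNIV. a i * (norm (z $ i))\<^sup>2 * v $ i)
                       + (\<Sum>i\<in>UNIV. b i * (norm (w $ i))\<^sup>2 * (- (v $ i)))))}"

text \<open>The identification of \<open>Y(\<alpha>,0) = \<mu>\<inverse>(\<alpha>,0)/M\<close> with the geometric quotient of the
  semistable points by the complexification of \<open>M\<close> sends the \<open>M\<close>-orbit of \<open>p\<close> to
  the orbit of \<open>p\<close> under the complexification. It carries the complex structure of the
  geometric quotient over to \<open>Y(\<alpha>,0)\<close>: in \<open>Y_cspace\<close>, a function on an open
  subset is holomorphic if its pullback to the semistable points is.\<close>

definition to_git :: "(complex^'d) set \<Rightarrow> ((complex^'d) \<times> (complex^'d)) set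
    \<Rightarrow> ((complex^'d) \<times> (complex^'d)) set" where
  "to_git M y = (\<Union>p\<in>y. horbit (complexification M) p)"

definition Y_cspace :: "(complex^'d) set \<Rightarrow> (real^'d \<Rightarrow> real)
    \<Rightarrow> ((complex^'d) \<times> (complex^'d)) set cspace" where
  "Y_cspace M \<alpha> = (Y_top M \<alpha>,
     \<lambda>W f. holo_on csc2
       {p \<in> semistable M \<alpha>. horbit (complexification M) p \<in> to_git M ` W}
       (\<lambda>p. f (inv_into (topspace (Y_top M \<alpha>)) (to_git M) (horbit (complexification M) p))))"


section \<open>Toric varieties, the core, and the open sets \<open>U\<^sub>\<epsilon>\<close>\<close>

definition Theta :: "('d \<Rightarrow> real) set" where
  "Theta = {\<epsilon>. \<forall>i. \<epsilon> i = 1 \<or> \<epsilon> i = -1}"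

definition Delta ::
    "(real^'d \<Rightarrow> real^'n) \<Rightarrow> real^'d \<Rightarrow> ('d \<Rightarrow> real) \<Rightarrow> (real^'n) set" where
  "Delta proj l \<epsilon> = {x. \<forall>i. \<epsilon> i * (normal proj i \<bullet> x + l $ i) \<ge> 0}"

text \<open>A point \<open>\<zeta>\<close> of \<open>C\<^sup>d\<close> stands for \<open>(z\<^sub>J, w\<^sub>J')\<close>: its coordinate \<open>\<zeta>\<^sub>i\<close> is \<open>z\<^sub>i\<close> if
  \<open>\<epsilon>(i) = 1\<close> and \<open>w\<^sub>i\<close> if \<open>\<epsilon>(i) = -1\<close>.\<close>

definition base_part :: "('d \<Rightarrow> real) \<Rightarrow> (complex^'d) \<times> (complex^'d) \<Rightarrow> complex^'d" where
  "base_part \<epsilon> = (\<lambda>(z, w). \<chi> i. if \<epsilon> i = 1 then z $ i else w $ i)"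

definition semistable_eps ::
    "(complex^'d) set \<Rightarrow> (real^'d \<Rightarrow> real) \<Rightarrow> ('d \<Rightarrow> real) \<Rightarrow> (complex^'d) set" where
  "semistable_eps M \<alpha> \<epsilon> = {\<zeta>. \<exists>a. (\<forall>i. a i \<ge> 0) \<and>
     \<alpha> = (\<lambda>v\<in>lie M. (\<Sum>i | \<epsilon> i = 1. a i * (norm (\<zeta> $ i))\<^sup>2 * v $ i)
                    + (\<Sum>i | \<epsilon> i \<noteq> 1. a i * (norm (\<zeta> $ i))\<^sup>2 * (- (v $ i))))}"

definition eorbit ::
    "(complex^'d) set \<Rightarrow> ('d \<Rightarrow> real) \<Rightarrow> complex^'d \<Rightarrow> (complex^'d) set" where
  "eorbit T \<epsilon> \<zeta> =
     {(\<chi> i. \<zeta> $ i * (if \<epsilon> i = 1 then t $ i else inverse (t $ i))) | t. t \<in> T}"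

definition X_cspace :: "(complex^'d) set \<Rightarrow> (real^'d \<Rightarrow> real) \<Rightarrow> ('d \<Rightarrow> real)
    \<Rightarrow> (complex^'d) set cspace" where
  "X_cspace M \<alpha> \<epsilon> =
     (quotient_topology (subtopology euclidean (semistable_eps M \<alpha> \<epsilon>))
        (eorbit (complexification M) \<epsilon>),
      \<lambda>W f. holo_on (*s)
        {\<zeta> \<in> semistable_eps M \<alpha> \<epsilon>. eorbit (complexification M) \<epsilon> \<zeta> \<in> W}
        (f \<circ> eorbit (complexification M) \<epsilon>))"

definition Z_set :: "(complex^'d) set \<Rightarrow> (real^'d \<Rightarrow> real) \<Rightarrow> ('d \<Rightarrow> real)
    \<Rightarrow> ((complex^'d) \<times> (complex^'d)) set set" where
  "Z_set M \<alpha> \<epsilon> = {horbit M (z, w) | z w. (z, w) \<in> mu_fibre M \<alpha> \<and>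
     (\<forall>i. (\<epsilon> i = 1 \<longrightarrow> w $ i = 0) \<and> (\<epsilon> i = -1 \<longrightarrow> z $ i = 0))}"

definition core :: "(complex^'d) set \<Rightarrow> (real^'d \<Rightarrow> real^'n) \<Rightarrow> (real^'d \<Rightarrow> real) \<Rightarrow> real^'d
    \<Rightarrow> ((complex^'d) \<times> (complex^'d)) set set" where
  "core M proj \<alpha> l = (\<Union>\<epsilon> \<in> {\<epsilon> \<in> Theta. bounded (Delta proj l \<epsilon>)}. Z_set M \<alpha> \<epsilon>)"

definition U_git :: "(complex^'d) set \<Rightarrow> (real^'d \<Rightarrow> real) \<Rightarrow> ('d \<Rightarrow> real)
    \<Rightarrow> ((complex^'d) \<times> (complex^'d)) set set" where
  "U_git M \<alpha> \<epsilon> = horbit (complexification M) `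
     {p. mu_C M p = zero_C M \<and> base_part \<epsilon> p \<in> semistable_eps M \<alpha> \<epsilon>}"

definition U_set :: "(complex^'d) set \<Rightarrow> (real^'d \<Rightarrow> real) \<Rightarrow> ('d \<Rightarrow> real)
    \<Rightarrow> ((complex^'d) \<times> (complex^'d)) set set" where
  "U_set M \<alpha> \<epsilon> = {y \<in> topspace (Y_top M \<alpha>). to_git M y \<in> U_git M \<alpha> \<epsilon>}"

end

theory Submission
  imports Defs "HOL-Complex_Analysis.Cauchy_Integral_Formula"
begin

text \<open>Write \<open>T\<^sub>C\<close> for the complexified torus, \<open>m\<close> for the Lie algebra of \<open>M\<close>, and split a point
\<open>(z, w)\<close> according to the sign vector \<open>\<epsilon>\<close> into \<open>(\<zeta>, \<eta>)\<close>: \<open>\<zeta>\<close> consists of the coordinates that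
enter \<open>X(\<epsilon>)\<close>, and \<open>\<eta>\<close> of the remaining ones, with a sign that makes the complex moment map
vanish exactly when \<open>\<Sum>i. \<zeta>\<^sub>i \<eta>\<^sub>i v\<^sub>i = 0\<close> for all \<open>v\<close> in the Lie algebra that acts on \<open>\<zeta>\<close>.

This equation says that the linear form \<open>\<eta>\<close> kills the tangent space of the torus orbit through
\<open>\<zeta>\<close>, so \<open>\<eta>\<close> is the pullback to the total space of a covector of the quotient at the class of
\<open>\<zeta>\<close>. Hence the pairs \<open>(\<zeta>, \<eta>)\<close> of moment zero with \<open>\<zeta>\<close> semistable, modulo \<open>T\<^sub>C\<close>, are the
cotangent bundle of \<open>X(\<epsilon>)\<close>, and they are also the set \<open>U\<^sub>\<epsilon>\<close>. The common cover is compared with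
the cotangent bundle in \<open>psi_image\<close>, \<open>psi_eq_iff\<close>, \<open>openin_cotangent_iff\<close> and \<open>cotangent_holo_iff\<close>.
The charts of the quotient are given by Laurent monomials; they exist because regularity of the
normals makes the lattice relations between them integral (\<open>exists_chart_datum\<close>). The cotangent
bundle refers to all holomorphic charts, and passing to them from the monomial ones needs that
the partial derivatives of a holomorphic function of several variables are holomorphic
(\<open>holo_map_cgrad\<close>, from Cauchy's integral formula).

On the other side, \<open>Y(\<alpha>, 0)\<close> is a quotient of a level set of the moment map by the compact group.
The Kempf-Ness argument moves each semistable point along its \<open>T\<^sub>C\<close>-orbit into that level set, by
minimising a strictly convex function on \<open>m\<close>; the minimiser is unique and depends continuously
on the point, so \<open>Y(\<alpha>, 0)\<close> is the topological quotient of the semistable points by \<open>T\<^sub>C\<close>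
(\<open>continuous_kn\<close>, \<open>openin_Y_iff\<close>). Everything rests on one consequence of \<open>(\<alpha>, 0)\<close> being a regular
value: if \<open>\<alpha>\<close> is a combination of some of the restricted coordinate functionals, with all
coefficients nonzero, then these functionals separate the points of \<open>m\<close>
(\<open>regular_value_nondegenerate\<close>).

Openness of \<open>U\<^sub>\<epsilon>\<close> holds since semistability only depends on which coordinates vanish and is
preserved if fewer of them do. For density, pick a real vector \<open>c\<close> in the annihilator of \<open>m\<close> with
no zero entry, which exists as the normals are nonzero. A point with products \<open>z\<^sub>i w\<^sub>i\<close> is a limit
of points with products \<open>z\<^sub>i w\<^sub>i + s c\<^sub>i\<close>, \<open>s > 0\<close>; these still have moment zero, eventually all
their coordinates are nonzero, and a point with this property lies over \<open>U\<^sub>\<epsilon>\<close> as soon as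
\<open>X(\<epsilon>)\<close> is nonempty (\<open>dense_U\<close>).\<close>

section \<open>Holomorphic maps\<close>

text \<open>The scalar multiplications \<open>sc\<close> and \<open>sc'\<close> on source and target are parameters, so that the same
lemmas serve \<open>complex ^ 'k\<close>, pairs of such vectors, and complex-valued functions.\<close>

definition cdiff_map_at ::
  "(complex \<Rightarrow> 'a::real_normed_vector \<Rightarrow> 'a) \<Rightarrow> (complex \<Rightarrow> 'b::real_normed_vector \<Rightarrow> 'b)
    \<Rightarrow> ('a \<Rightarrow> 'b) \<Rightarrow> 'a \<Rightarrow> bool" where
  "cdiff_map_at sc sc' h p \<longleftrightarrow>
     (\<exists>D. (h has_derivative D) (at p) \<and> (\<forall>c v. D (sc c v) = sc' c (D v)))"

definition holo_map ::
  "(complex \<Rightarrow> 'a::real_normed_vector \<Rightarrow> 'a) \<Rightarrow> (complex \<Rightarrow> 'b::real_normed_vector \<Rightarrow> 'b)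
    \<Rightarrow> 'a set \<Rightarrow> ('a \<Rightarrow> 'b) \<Rightarrow> bool" where
  "holo_map sc sc' S h \<longleftrightarrow>
     (\<forall>p\<in>S. \<exists>G E. open G \<and> p \<in> G \<and> (\<forall>q\<in>G. cdiff_map_at sc sc' E q) \<and> (\<forall>q \<in> G \<inter> S. E q = h q))"

lemma cdiff_at_iff: "cdiff_at sc F p \<longleftrightarrow> cdiff_map_at sc (*) F p"
  by (simp add: cdiff_at_def cdiff_map_at_def)

lemma holo_on_iff: "holo_on sc S F \<longleftrightarrow> holo_map sc (*) S F"
  by (simp add: holo_on_def holo_map_def cdiff_at_iff)

lemma cdiff_map_at_imp_isCont: "cdiff_map_at sc sc' h p \<Longrightarrow> isCont h p"
  unfolding cdiff_map_at_def by (auto dest: has_derivative_continuous)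

lemma cdiff_map_at_compose:
  assumes "cdiff_map_at sc sc' h p" "cdiff_map_at sc' sc'' F (h p)"
  shows "cdiff_map_at sc sc'' (\<lambda>x. F (h x)) p"
proof -
  obtain D where D: "(h has_derivative D) (at p)" "\<forall>c v. D (sc c v) = sc' c (D v)"
    using assms(1) by (auto simp: cdiff_map_at_def)
  obtain D' where D': "(F has_derivative D') (at (h p))" "\<forall>c v. D' (sc' c v) = sc'' c (D' v)"
    using assms(2) by (auto simp: cdiff_map_at_def)
  have "((\<lambda>x. F (h x)) has_derivative (\<lambda>x. D' (D x))) (at p)"
    using has_derivative_compose[OF D(1) D'(1)] .
  then show ?thesis using D D' unfolding cdiff_map_at_def by (intro exI[of _ "\<lambda>x. D' (D x)"]) auto
qed

lemma cdiff_map_at_transform: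
  assumes "cdiff_map_at sc sc' h p" "open G" "p \<in> G" "\<And>q. q \<in> G \<Longrightarrow> h q = h' q"
  shows "cdiff_map_at sc sc' h' p"
  using assms unfolding cdiff_map_at_def
  by (meson has_derivative_transform_within_open)

lemma cdiff_map_at_linear:
  assumes "bounded_linear L" "\<And>c v. L (sc c v) = sc' c (L v)"
  shows "cdiff_map_at sc sc' L p"
  using assms unfolding cdiff_map_at_def
  by (intro exI[of _ L]) (auto intro: bounded_linear_imp_has_derivative)

lemma cdiff_map_at_const [intro]:
  assumes "\<And>c. sc' c 0 = 0"
  shows "cdiff_map_at sc sc' (\<lambda>_. a) p"
  unfolding cdiff_map_at_def using assms by (intro exI[of _ "\<lambda>_. 0"]) auto

lemma cdiff_map_at_add:
  assumes "cdiff_map_at sc (*) f p" "cdiff_map_at sc (*) g p"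
  shows "cdiff_map_at sc (*) (\<lambda>x. f x + g x) p"
proof -
  obtain D D' where "(f has_derivative D) (at p)" "\<forall>c v. D (sc c v) = c * (D v)"
    "(g has_derivative D') (at p)" "\<forall>c v. D' (sc c v) = c * (D' v)"
    using assms by (auto simp: cdiff_map_at_def)
  then show ?thesis unfolding cdiff_map_at_def
    by (intro exI[of _ "\<lambda>v. D v + D' v"]) (auto intro!: derivative_eq_intros simp: algebra_simps)
qed

lemma cdiff_map_at_mult:
  assumes "cdiff_map_at sc (*) f p" "cdiff_map_at sc (*) g p"
  shows "cdiff_map_at sc (*) (\<lambda>x. f x * g x) p"
proof -
  obtain D D' where "(f has_derivative D) (at p)" "\<forall>c v. D (sc c v) = c * (D v)"
    "(g has_derivative D') (at p)" "\<forall>c v. D' (sc c v) = c * (D' v)"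
    using assms by (auto simp: cdiff_map_at_def)
  then show ?thesis unfolding cdiff_map_at_def
    by (intro exI[of _ "\<lambda>v. f p * D' v + D v * g p"]) (auto intro!: derivative_eq_intros simp: algebra_simps)
qed

lemma cdiff_map_at_sum:
  assumes "\<And>i. i \<in> A \<Longrightarrow> cdiff_map_at sc (*) (f i) p"
  shows "cdiff_map_at sc (*) (\<lambda>x. \<Sum>i\<in>A. f i x) p"
  using assms by (induction A rule: infinite_finite_induct) (auto intro!: cdiff_map_at_add)

lemma cdiff_map_at_prod:
  assumes "\<And>i. i \<in> A \<Longrightarrow> cdiff_map_at sc (*) (f i) p"
  shows "cdiff_map_at sc (*) (\<lambda>x. \<Prod>i\<in>A. f i x) p"
  using assms by (induction A rule: infinite_finite_induct) (auto intro!: cdiff_map_at_mult)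

lemma cdiff_map_at_field_differentiable:
  assumes "cdiff_map_at sc (*) f p" "g field_differentiable (at (f p))"
  shows "cdiff_map_at sc (*) (\<lambda>x. g (f x)) p"
proof -
  obtain g' where "(g has_field_derivative g') (at (f p))"
    using assms(2) by (auto simp: field_differentiable_def)
  then have "cdiff_map_at (*) (*) g (f p)"
    unfolding cdiff_map_at_def has_field_derivative_def by (intro exI[of _ "(*) g'"]) auto
  then show ?thesis using cdiff_map_at_compose[OF assms(1)] by blast
qed

lemma cdiff_map_at_powi:
  assumes "cdiff_map_at sc (*) f p" "f p \<noteq> 0 \<or> n \<ge> 0"
  shows "cdiff_map_at sc (*) (\<lambda>x. f x powi n) p"
proof (rule cdiff_map_at_field_differentiable[OF assms(1)])
  show "(\<lambda>z. z powi n) field_differentiable at (f p)"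
  proof (cases "n \<ge> 0")
    case True
    then have "(\<lambda>z::complex. z powi n) = (\<lambda>z. z ^ nat n)" by (auto simp: power_int_def)
    then show ?thesis by (auto intro!: derivative_intros)
  next
    case False
    then have *: "f p \<noteq> 0" using assms by auto
    have "(\<lambda>z::complex. z powi n) = (\<lambda>z. inverse z ^ nat (-n))"
      using False by (auto simp: power_int_def)
    then show ?thesis using * by (auto intro!: derivative_intros)
  qed
qed

lemma bounded_linear_axis: "bounded_linear (axis i :: 'a::euclidean_space \<Rightarrow> 'a^'k)"
proof (rule linear_conv_bounded_linear[THEN iffD1])
  show "linear (axis i :: 'a \<Rightarrow> 'a^'k)"
    by (rule linearI) (auto simp: axis_def vec_eq_iff)
qed

lemma has_derivative_vecI:
  fixes h :: "'a::real_normed_vector \<Rightarrow> complex^'k"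
  assumes D: "\<And>i. ((\<lambda>p. h p $ i) has_derivative (\<lambda>v. D v $ i)) (at p)"
  shows "(h has_derivative D) (at p)"
proof -
  have eq: "(\<Sum>i\<in>UNIV. axis i (f $ i)) = f" for f :: "complex^'k"
    by (auto simp: vec_eq_iff axis_def sum.delta)
  have "((\<lambda>p. \<Sum>i\<in>UNIV. axis i (h p $ i)) has_derivative (\<lambda>v. \<Sum>i\<in>UNIV. axis i (D v $ i))) (at p)"
    by (intro has_derivative_sum bounded_linear.has_derivative[OF bounded_linear_axis] D)
  then show ?thesis by (simp add: eq)
qed

lemma cdiff_map_at_vec:
  fixes h :: "'a::real_normed_vector \<Rightarrow> complex^'k"
  assumes "\<And>i. cdiff_map_at sc (*) (\<lambda>p. h p $ i) p"
  shows "cdiff_map_at sc (*s) h p"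
proof -
  obtain D where D: "\<And>i. ((\<lambda>p. h p $ i) has_derivative D i) (at p)" "\<And>i c v. D i (sc c v) = c * D i v"
    using assms unfolding cdiff_map_at_def by metis
  have "(h has_derivative (\<lambda>v. \<chi> i. D i v)) (at p)" by (rule has_derivative_vecI) (simp add: D(1))
  then show ?thesis unfolding cdiff_map_at_def
    by (intro exI[of _ "\<lambda>v. \<chi> i. D i v"] conjI) (simp_all add: D vec_eq_iff)
qed

lemma cdiff_map_at_Pair:
  assumes "cdiff_map_at sc (*s) f p" "cdiff_map_at sc (*s) g p"
  shows "cdiff_map_at sc csc2 (\<lambda>x. (f x, g x)) p"
proof -
  obtain D D' where "(f has_derivative D) (at p)" "\<forall>c v. D (sc c v) = c *s (D v)"
    "(g has_derivative D') (at p)" "\<forall>c v. D' (sc c v) = c *s (D' v)"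
    using assms by (auto simp: cdiff_map_at_def)
  then show ?thesis unfolding cdiff_map_at_def
    by (intro exI[of _ "\<lambda>v. (D v, D' v)"]) (auto intro!: derivative_eq_intros simp: csc2_def)
qed

lemma cdiff_map_at_nth: "cdiff_map_at (*s) (*) (\<lambda>z::complex^'k. z $ i) p"
  by (rule cdiff_map_at_linear) (auto intro: bounded_linear_vec_nth)

lemma cdiff_map_at_fst: "cdiff_map_at csc2 (*s) fst p"
  by (rule cdiff_map_at_linear) (auto intro: bounded_linear_fst simp: csc2_def split: prod.splits)

lemma cdiff_map_at_snd: "cdiff_map_at csc2 (*s) snd p"
  by (rule cdiff_map_at_linear) (auto intro: bounded_linear_snd simp: csc2_def split: prod.splits)

lemmas cdiff_map_at_fst_nth = cdiff_map_at_compose[OF cdiff_map_at_fst cdiff_map_at_nth]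
lemmas cdiff_map_at_snd_nth = cdiff_map_at_compose[OF cdiff_map_at_snd cdiff_map_at_nth]

lemma openin_subspace_local:
  assumes "A \<subseteq> B" "\<And>p. p \<in> A \<Longrightarrow> \<exists>U. open U \<and> p \<in> U \<and> U \<inter> B \<subseteq> A"
  shows "openin (top_of_set B) A"
proof -
  have "A = B \<inter> \<Union>{U. open U \<and> U \<inter> B \<subseteq> A}"
  proof (intro equalityI subsetI)
    fix p assume p: "p \<in> A"
    from assms(2)[OF p] obtain U where "open U" "p \<in> U" "U \<inter> B \<subseteq> A" by (elim exE conjE)
    then show "p \<in> B \<inter> \<Union>{U. open U \<and> U \<inter> B \<subseteq> A}" using p assms(1) by auto
  qed auto
  moreover have "open (\<Union>{U. open U \<and> U \<inter> B \<subseteq> A})" by (rule open_Union) auto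
  ultimately show ?thesis unfolding openin_open by (intro exI conjI)
qed

lemma holo_mapE:
  assumes "holo_map sc sc' S h" "p \<in> S"
  obtains G E where "open G" "p \<in> G" "\<forall>q\<in>G. cdiff_map_at sc sc' E q" "\<forall>q \<in> G \<inter> S. E q = h q"
  using assms unfolding holo_map_def by (metis (no_types, lifting))

lemma holo_mapI:
  assumes "\<And>p. p \<in> S \<Longrightarrow> cdiff_map_at sc sc' h p" "open S"
  shows "holo_map sc sc' S h"
  using assms unfolding holo_map_def by blast

lemma holo_map_open_iff:
  assumes "open S"
  shows "holo_map sc sc' S h \<longleftrightarrow> (\<forall>p\<in>S. cdiff_map_at sc sc' h p)"
proof
  assume h: "holo_map sc sc' S h"
  show "\<forall>p\<in>S. cdiff_map_at sc sc' h p"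
  proof
    fix p assume p: "p \<in> S"
    then obtain G E where G: "open G" "p \<in> G" "\<forall>q\<in>G. cdiff_map_at sc sc' E q" "\<forall>q \<in> G \<inter> S. E q = h q"
      using h unfolding holo_map_def by blast
    show "cdiff_map_at sc sc' h p"
      by (rule cdiff_map_at_transform[of sc sc' E p "G \<inter> S"]) (use G p assms in auto)
  qed
qed (use assms in \<open>auto intro: holo_mapI\<close>)

lemma holo_map_cong_subset:
  assumes "holo_map sc sc' S h" "T \<subseteq> S" "\<And>p. p \<in> T \<Longrightarrow> h p = h' p"
  shows "holo_map sc sc' T h'"
  unfolding holo_map_def
proof
  fix p assume p: "p \<in> T"
  then have "p \<in> S" using assms by auto
  then obtain G E where "open G" "p \<in> G" "\<forall>q\<in>G. cdiff_map_at sc sc' E q" "\<forall>q \<in> G \<inter> S. E q = h q"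
    using assms(1) unfolding holo_map_def by blast
  then show "\<exists>G E. open G \<and> p \<in> G \<and> (\<forall>q\<in>G. cdiff_map_at sc sc' E q) \<and> (\<forall>q \<in> G \<inter> T. E q = h' q)"
    using assms(2,3) by (intro exI[of _ G] exI[of _ E]) auto
qed

lemma holo_map_subset: "holo_map sc sc' S h \<Longrightarrow> T \<subseteq> S \<Longrightarrow> holo_map sc sc' T h"
  by (rule holo_map_cong_subset) auto

lemma holo_map_cong:
  assumes "\<And>p. p \<in> S \<Longrightarrow> h p = h' p"
  shows "holo_map sc sc' S h \<longleftrightarrow> holo_map sc sc' S h'"
  using holo_map_cong_subset[of sc sc' S h S h'] holo_map_cong_subset[of sc sc' S h' S h] assms
  by auto

lemma holo_map_local:
  assumes "\<And>p. p \<in> S \<Longrightarrow> \<exists>U. open U \<and> p \<in> U \<and> holo_map sc sc' (S \<inter> U) h"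
  shows "holo_map sc sc' S h"
  unfolding holo_map_def
proof
  fix p assume p: "p \<in> S"
  then obtain U where U: "open U" "p \<in> U" "holo_map sc sc' (S \<inter> U) h" using assms by blast
  then obtain G E where "open G" "p \<in> G" "\<forall>q\<in>G. cdiff_map_at sc sc' E q" "\<forall>q \<in> G \<inter> (S \<inter> U). E q = h q"
    using p unfolding holo_map_def by blast
  then show "\<exists>G E. open G \<and> p \<in> G \<and> (\<forall>q\<in>G. cdiff_map_at sc sc' E q) \<and> (\<forall>q \<in> G \<inter> S. E q = h q)"
    using U by (intro exI[of _ "G \<inter> U"] exI[of _ E]) auto
qed

lemma holo_map_imp_continuous_on:
  assumes "holo_map sc sc' S h"
  shows "continuous_on S h"
proof (rule continuous_on_eq_continuous_within[THEN iffD2], rule ballI)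
  fix p assume p: "p \<in> S"
  then obtain G E where G: "open G" "p \<in> G" "\<forall>q\<in>G. cdiff_map_at sc sc' E q" "\<forall>q \<in> G \<inter> S. E q = h q"
    using assms unfolding holo_map_def by blast
  then have "continuous (at p within S) E"
    using cdiff_map_at_imp_isCont continuous_at_imp_continuous_at_within by blast
  moreover have "\<forall>\<^sub>F x in at p within S. E x = h x"
    using G eventually_at_topological by blast
  ultimately show "continuous (at p within S) h"
    using G p by (metis IntI continuous_within tendsto_cong)
qed

lemma holo_map_compose:
  assumes h: "holo_map sc sc' S h" and im: "\<And>p. p \<in> S \<Longrightarrow> h p \<in> S'" and F: "holo_map sc' sc'' S' F"
  shows "holo_map sc sc'' S (\<lambda>p. F (h p))"
  unfolding holo_map_def
proof
  fix p assume p: "p \<in> S"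
  obtain G E where G: "open G" "p \<in> G" "\<forall>q\<in>G. cdiff_map_at sc sc' E q" "\<forall>q \<in> G \<inter> S. E q = h q"
    using holo_mapE[OF h p] .
  obtain G' E' where G': "open G'" "h p \<in> G'" "\<forall>q\<in>G'. cdiff_map_at sc' sc'' E' q" "\<forall>q \<in> G' \<inter> S'. E' q = F q"
    using holo_mapE[OF F im[OF p]] .
  have "continuous_on G E"
    using G cdiff_map_at_imp_isCont by (metis continuous_at_imp_continuous_on)
  then have "open (G \<inter> E -` G')" using G G' continuous_open_preimage by blast
  then show "\<exists>G E. open G \<and> p \<in> G \<and> (\<forall>q\<in>G. cdiff_map_at sc sc'' E q) \<and> (\<forall>q \<in> G \<inter> S. E q = F (h q))"
    using G G' im p
    by (intro exI[of _ "G \<inter> E -` G'"] exI[of _ "\<lambda>q. E' (E q)"]) (auto intro: cdiff_map_at_compose)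
qed

lemma holo_map_vec:
  fixes h :: "'a::real_normed_vector \<Rightarrow> complex^'k"
  assumes "\<And>i. holo_map sc (*) S (\<lambda>p. h p $ i)"
  shows "holo_map sc (*s) S h"
  unfolding holo_map_def
proof
  fix p assume p: "p \<in> S"
  have "\<forall>i. \<exists>G E. open G \<and> p \<in> G \<and> (\<forall>q\<in>G. cdiff_map_at sc (*) E q) \<and> (\<forall>q \<in> G \<inter> S. E q = h q $ i)"
    using assms p unfolding holo_map_def by blast
  then obtain G E where G: "\<And>i. open (G i)" "\<And>i. p \<in> G i"
    "\<And>i q. q\<in>G i \<Longrightarrow> cdiff_map_at sc (*) (E i) q" "\<And>i q. q \<in> G i \<Longrightarrow> q \<in> S \<Longrightarrow> E i q = h q $ i"
    by (metis IntI)
  show "\<exists>G E. open G \<and> p \<in> G \<and> (\<forall>q\<in>G. cdiff_map_at sc (*s) E q) \<and> (\<forall>q \<in> G \<inter> S. E q = h q)"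
    using G
    by (intro exI[of _ "\<Inter>i. G i"] exI[of _ "\<lambda>q. \<chi> i. E i q"])
       (auto intro!: cdiff_map_at_vec simp: vec_eq_iff)
qed

definition cgrad :: "(complex^'k \<Rightarrow> complex) \<Rightarrow> complex^'k \<Rightarrow> complex^'k" where
  "cgrad F p = (\<chi> i. frechet_derivative F (at p) (axis i 1))"

lemma has_derivative_cgrad:
  fixes F :: "complex^'k \<Rightarrow> complex"
  assumes "cdiff_map_at (*s) (*) F p"
  shows "(F has_derivative (\<lambda>v. \<Sum>i\<in>UNIV. cgrad F p $ i * v $ i)) (at p)"
proof -
  obtain D where D: "(F has_derivative D) (at p)" "\<And>c v. D (c *s v) = c * D v"
    using assms by (auto simp: cdiff_map_at_def)
  have fr: "frechet_derivative F (at p) = D" using frechet_derivative_at[OF D(1)] by simp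
  have lin: "linear D" using D(1) has_derivative_linear by blast
  have "D v = (\<Sum>i\<in>UNIV. cgrad F p $ i * v $ i)" for v
  proof -
    have "D v = D (\<Sum>i\<in>UNIV. v $ i *s axis i 1)" by (simp only: basis_expansion)
    also have "\<dots> = (\<Sum>i\<in>UNIV. D (v $ i *s axis i 1))" by (rule linear_sum[OF lin])
    finally show ?thesis by (simp add: D(2) cgrad_def fr mult.commute)
  qed
  then show ?thesis using D(1) by presburger
qed

lemma cgrad_unique:
  fixes F :: "complex^'k \<Rightarrow> complex"
  assumes "(F has_derivative (\<lambda>v. \<Sum>i\<in>UNIV. c $ i * v $ i)) (at p)"
  shows "cgrad F p = c"
  unfolding cgrad_def frechet_derivative_at[OF assms, symmetric]
  by (simp add: vec_eq_iff axis_def if_distrib cong: if_cong)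

lemma norm_axis_complex: "norm (axis i (x::complex) :: complex^'k) = norm x"
proof -
  have "(\<Sum>j\<in>UNIV. (norm ((axis i x :: complex^'k) $ j))\<^sup>2) = (norm x)\<^sup>2"
    by (simp add: axis_def if_distrib if_distribR cong: if_cong)
  then show ?thesis by (simp add: norm_vec_def L2_set_def)
qed

lemma has_field_derivative_along_axis:
  fixes F :: "complex^'k \<Rightarrow> complex"
  assumes "cdiff_map_at (*s) (*) F (q + axis i t)"
  shows "((\<lambda>t. F (q + axis i t)) has_field_derivative (cgrad F (q + axis i t) $ i)) (at t)"
proof -
  have 1: "((\<lambda>t. q + axis i t) has_derivative (\<lambda>t. 0 + axis i t)) (at t)"
    by (intro has_derivative_add has_derivative_const bounded_linear.has_derivative[OF bounded_linear_axis]
         has_derivative_ident)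
  have "((\<lambda>t. F (q + axis i t)) has_derivative
      (\<lambda>h. \<Sum>j\<in>UNIV. cgrad F (q + axis i t) $ j * (0 + axis i h) $ j)) (at t)"
    by (rule has_derivative_compose[OF 1 has_derivative_cgrad[OF assms]])
  moreover have "(\<lambda>h. \<Sum>j\<in>UNIV. cgrad F (q + axis i t) $ j * (0 + axis i h) $ j) = (*) (cgrad F (q + axis i t) $ i)"
    by (auto simp: axis_def if_distrib cong: if_cong)
  ultimately show ?thesis by (simp add: has_field_derivative_def)
qed

section \<open>Gradients of holomorphic functions are holomorphic\<close>

text \<open>Cauchy's formula for the derivative at \<open>0\<close> of the restriction of \<open>F\<close> to the complex line through
\<open>q\<close> in the direction of the \<open>i\<close>-th axis, with the circle parametrised by the unit interval.\<close>

lemma cgrad_circle_integral: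
  fixes F :: "complex^'k \<Rightarrow> complex"
  assumes F: "\<And>q'. q' \<in> cball q r \<Longrightarrow> cdiff_map_at (*s) (*) F q'" and r: "r > 0"
  shows "cgrad F q $ i = integral {0..1::real}
     (\<lambda>x. F (q + axis i (of_real r * exp (2 * of_real pi * \<i> * x))) / (of_real r * exp (2 * of_real pi * \<i> * x)))"
proof -
  let ?f = "\<lambda>t. F (q + axis i t)"
  have inb: "q + axis i t \<in> cball q r" if "norm t \<le> r" for t
    using that by (simp add: dist_norm norm_axis_complex)
  have der: "(?f has_field_derivative (cgrad F (q + axis i t) $ i)) (at t)" if "norm t \<le> r" for t
    by (rule has_field_derivative_along_axis[OF F[OF inb[OF that]]])
  have cont: "continuous_on (cball 0 r) ?f"
    by (rule DERIV_continuous_on) (use der in \<open>auto intro: has_field_derivative_at_within\<close>)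
  have hol: "?f holomorphic_on ball 0 r"
  proof (rule holomorphic_onI)
    fix t :: complex assume "t \<in> ball 0 r"
    then have "norm t \<le> r" by simp
    from has_field_derivative_at_within[OF der[OF this]]
    show "?f field_differentiable at t within ball 0 r"
      unfolding field_differentiable_def by blast
  qed
  have "(?f has_field_derivative (1 / (2 * of_real pi * \<i>) * contour_integral (circlepath 0 r) (\<lambda>u. ?f u / (u-0)^2))) (at 0)"
    by (rule Cauchy_derivative_integral_circlepath(2)[OF cont hol]) (use r in simp)
  moreover have "(?f has_field_derivative (cgrad F q $ i)) (at 0)"
    using der[of 0] r by (simp add: axis_def zero_vec_def[symmetric])
  ultimately have "cgrad F q $ i = 1 / (2 * of_real pi * \<i>) * contour_integral (circlepath 0 r) (\<lambda>u. ?f u / (u-0)^2)"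
    using DERIV_unique by blast
  also have "\<dots> = 1 / (2 * of_real pi * \<i>) * integral {0..1} (\<lambda>x. ?f (circlepath 0 r x) / (circlepath 0 r x)^2 *
      vector_derivative (circlepath 0 r) (at x))"
    by (simp add: contour_integral_integral)
  also have "\<dots> = integral {0..1} (\<lambda>x. 1 / (2 * of_real pi * \<i>) * (?f (circlepath 0 r x) / (circlepath 0 r x)^2 *
      vector_derivative (circlepath 0 r) (at x)))"
    by (rule integral_mult_right[symmetric])
  also have "\<dots> = integral {0..1::real} (\<lambda>x. ?f (r * exp (2 * of_real pi * \<i> * x)) / (r * exp (2 * of_real pi * \<i> * x)))"
  proof (intro integral_cong)
    fix x :: real
    have *: "circlepath 0 r x = r * exp (2 * of_real pi * \<i> * x)" by (simp add: circlepath)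
    have vd: "vector_derivative (circlepath 0 r) (at x) = 2 * pi * \<i> * (r * exp (2 * of_real pi * \<i> * x))"
      by (simp only: vector_derivative_circlepath) simp
    show "1 / (2 * of_real pi * \<i>) * (?f (circlepath 0 r x) / (circlepath 0 r x)^2 *
      vector_derivative (circlepath 0 r) (at x)) =
      ?f (r * exp (2 * of_real pi * \<i> * x)) / (r * exp (2 * of_real pi * \<i> * x))"
      unfolding vd * using r by (simp add: field_simps power2_eq_square)
  qed
  finally show ?thesis .
qed

lemma continuous_on_translated_quotient:
  fixes f :: "complex^'k \<Rightarrow> complex" and e :: "real \<Rightarrow> complex"
  assumes f: "continuous_on G f" and e: "continuous_on UNIV e" "\<And>x. e x \<noteq> 0"
    and sub: "\<And>q x. q \<in> B \<Longrightarrow> q + axis i (e x) \<in> G"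
  shows "continuous_on (B \<times> I) (\<lambda>y. f (fst y + axis i (e (snd y))) / e (snd y))"
proof -
  have 1: "continuous_on (B \<times> I) (\<lambda>y. e (snd y))"
    by (rule continuous_on_compose2[OF e(1) continuous_on_snd[OF continuous_on_id]]) simp
  have 2: "continuous_on (B \<times> I) (\<lambda>y. fst y + axis i (e (snd y)))"
    by (rule continuous_on_add[OF continuous_on_fst[OF continuous_on_id]
        bounded_linear.continuous_on[OF bounded_linear_axis 1]])
  have 3: "continuous_on (B \<times> I) (\<lambda>y. f (fst y + axis i (e (snd y))))"
    by (rule continuous_on_compose2[OF f 2]) (use sub in auto)
  show ?thesis by (rule continuous_on_divide[OF 3 1]) (use e in auto)
qed

text \<open>One radius serves all \<open>q\<close> near \<open>p\<close>, so near \<open>p\<close> a partial derivative is an integral with parameter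
\<open>q\<close> over a fixed interval. The curve \<open>e\<close> is kept abstract, which is all that differentiation
under the integral sign needs.\<close>

lemma cgrad_local_integral:
  fixes F :: "complex^'k \<Rightarrow> complex"
  assumes G: "open G" "p \<in> G" and F: "\<And>q. q \<in> G \<Longrightarrow> cdiff_map_at (*s) (*) F q"
  obtains r and e :: "real \<Rightarrow> complex" where "r > 0" "continuous_on UNIV e" "\<forall>x. e x \<noteq> 0"
    "\<forall>q\<in>ball p r. \<forall>x. q + axis i (e x) \<in> G"
    "\<forall>q\<in>ball p r. cgrad F q $ i = integral (cbox 0 1) (\<lambda>x. F (q + axis i (e x)) / e x)"
proof -
  obtain d where d: "d > 0" "cball p d \<subseteq> G" using G open_contains_cball by blast
  define r where "r = d / 2"
  have r: "r > 0" using d by (simp add: r_def)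
  have sub: "q + v \<in> G" if "q \<in> ball p r" "norm v \<le> r" for q v
  proof -
    have "dist p (q + v) \<le> dist p q + dist q (q + v)" by (rule dist_triangle)
    also have "\<dots> \<le> d" using that by (simp add: dist_norm r_def)
    finally show ?thesis using d(2) by auto
  qed
  define e where "e = (\<lambda>x::real. of_real r * exp (2 * of_real pi * \<i> * x))"
  have ne: "norm (e x) = r" for x using r by (simp add: norm_mult e_def)
  show thesis
  proof
    show "r > 0" by (rule r)
    show "continuous_on UNIV e" unfolding e_def by (intro continuous_intros)
    show "\<forall>x. e x \<noteq> 0" using r by (simp add: e_def)
    show "\<forall>q\<in>ball p r. \<forall>x. q + axis i (e x) \<in> G"
      using ne by (intro ballI allI sub) (auto simp: norm_axis_complex)
    show "\<forall>q\<in>ball p r. cgrad F q $ i = integral (cbox 0 1) (\<lambda>x. F (q + axis i (e x)) / e x)"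
    proof
      fix q assume q: "q \<in> ball p r"
      have "cgrad F q $ i = integral {0..1} (\<lambda>x. F (q + axis i (e x)) / e x)"
        unfolding e_def
      proof (rule cgrad_circle_integral[OF _ r])
        fix q' assume "q' \<in> cball q r"
        then have "q + (q' - q) \<in> G" using q by (intro sub) (auto simp: dist_norm norm_minus_commute)
        then show "cdiff_map_at (*s) (*) F q'" using F by simp
      qed
      then show "cgrad F q $ i = integral (cbox 0 1) (\<lambda>x. F (q + axis i (e x)) / e x)" by simp
    qed
  qed
qed

lemma continuous_on_cgrad:
  fixes F :: "complex^'k \<Rightarrow> complex"
  assumes G: "open G" and F: "\<And>q. q \<in> G \<Longrightarrow> cdiff_map_at (*s) (*) F q"
  shows "continuous_on G (\<lambda>q. cgrad F q $ i)"
proof -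
  have contF: "continuous_on G F"
    using F cdiff_map_at_imp_isCont by (metis continuous_at_imp_continuous_on)
  have "isCont (\<lambda>q. cgrad F q $ i) p" if p: "p \<in> G" for p
  proof -
    obtain r and e :: "real \<Rightarrow> complex" where r: "r > 0" and ce: "continuous_on UNIV e" and e0: "\<forall>x. e x \<noteq> 0"
      and sub': "\<forall>q\<in>ball p r. \<forall>x. q + axis i (e x) \<in> G"
      and eq: "\<forall>q\<in>ball p r. cgrad F q $ i = integral (cbox 0 1) (\<lambda>x. F (q + axis i (e x)) / e x)"
      by (rule cgrad_local_integral[where i=i, OF G p F])
    note e0 = e0[rule_format] and sub' = sub'[rule_format] and eq = eq[rule_format]
    have "continuous_on (ball p r) (\<lambda>q. integral (cbox 0 1) (\<lambda>x. F (q + axis i (e x)) / e x))"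
    proof (rule integral_continuous_on_param)
      show "continuous_on (ball p r \<times> cbox 0 1) (\<lambda>(q, x). F (q + axis i (e x)) / e x)"
        unfolding case_prod_beta'
        by (rule continuous_on_translated_quotient[where e=e, OF contF ce e0 sub'])
    qed
    with eq have "continuous_on (ball p r) (\<lambda>q. cgrad F q $ i)"
      by (metis (no_types, lifting) continuous_on_eq)
    then show ?thesis using r by (simp add: continuous_on_eq_continuous_at)
  qed
  then show ?thesis by (simp add: continuous_at_imp_continuous_on)
qed

text \<open>Differentiation under the integral sign. The integrand is continuously differentiable because
the first derivatives of \<open>F\<close> are already known to be continuous; its derivatives are
complex-linear, and so is their integral.\<close>

lemma cdiff_map_at_cgrad_nth:
  fixes F :: "complex^'k \<Rightarrow> complex"
  assumes G: "open G" and F: "\<And>q. q \<in> G \<Longrightarrow> cdiff_map_at (*s) (*) F q" and p: "p \<in> G"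
  shows "cdiff_map_at (*s) (*) (\<lambda>q. cgrad F q $ i) p"
proof -
  have contF: "continuous_on G F"
    using F cdiff_map_at_imp_isCont by (metis continuous_at_imp_continuous_on)
  obtain r and e :: "real \<Rightarrow> complex" where r: "r > 0" and ce: "continuous_on UNIV e" and e0: "\<forall>x. e x \<noteq> 0"
    and sub': "\<forall>q\<in>ball p r. \<forall>x. q + axis i (e x) \<in> G"
    and eq: "\<forall>q\<in>ball p r. cgrad F q $ i = integral (cbox 0 1) (\<lambda>x. F (q + axis i (e x)) / e x)"
    by (rule cgrad_local_integral[where i=i, OF G p F])
  note e0 = e0[rule_format] and sub' = sub'[rule_format] and eq = eq[rule_format]
  define N :: "'k \<Rightarrow> (complex^'k) \<Rightarrow>\<^sub>L complex" where "N j = Blinfun (\<lambda>h. h $ j)" for j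
  have N: "blinfun_apply (N j) h = h $ j" for j h
    unfolding N_def by (subst bounded_linear_Blinfun_apply) (auto intro: bounded_linear_vec_nth)
  define fx where "fx q x = (\<Sum>j\<in>UNIV. blinfun_mult_right (cgrad F (q + axis i (e x)) $ j / e x) o\<^sub>L N j)"
    for q and x :: real
  have fx: "blinfun_apply (fx q x) v = (\<Sum>j\<in>UNIV. cgrad F (q + axis i (e x)) $ j / e x * v $ j)" for q x v
    unfolding fx_def by (simp add: blinfun.sum_left N)
  have contfx: "continuous_on (ball p r \<times> cbox 0 1) (\<lambda>(q, x). fx q x)"
    unfolding case_prod_beta' fx_def
    by (intro continuous_on_sum bounded_bilinear.continuous_on[OF bounded_bilinear_blinfun_compose]
            continuous_on_const bounded_linear.continuous_on[OF bounded_linear_blinfun_mult_right]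
            continuous_on_translated_quotient[where e=e, OF continuous_on_cgrad[OF G F] ce e0 sub'])
  have 1: "((\<lambda>q. integral (cbox 0 1) (\<lambda>x. F (q + axis i (e x)) / e x)) has_derivative
       blinfun_apply (integral (cbox 0 1) (fx p))) (at p within ball p r)"
  proof (rule leibniz_rule[OF _ _ contfx])
    fix q and t :: real assume q: "q \<in> ball p r"
    have tr: "((\<lambda>q. q + axis i (e t)) has_derivative (\<lambda>v. v + 0)) (at q)"
      by (intro has_derivative_add has_derivative_ident has_derivative_const)
    have "((\<lambda>q. F (q + axis i (e t))) has_derivative
        (\<lambda>v. \<Sum>j\<in>UNIV. cgrad F (q + axis i (e t)) $ j * (v + 0) $ j)) (at q)"
      by (rule has_derivative_compose[OF tr has_derivative_cgrad[OF F[OF sub'[OF q]]]])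
    note der = has_derivative_mult_left[OF this, of "1 / e t"]
    have fxq: "blinfun_apply (fx q t) =
        (\<lambda>v. (\<Sum>j\<in>UNIV. cgrad F (q + axis i (e t)) $ j * (v + 0) $ j) * (1 / e t))"
      by (intro ext) (simp add: fx sum_distrib_right sum_divide_distrib)
    from der
    have "((\<lambda>q. F (q + axis i (e t)) / e t) has_derivative blinfun_apply (fx q t)) (at q)"
      by (simp only: fxq times_divide_eq_right mult_1_right)
    then show "((\<lambda>q. F (q + axis i (e t)) / e t) has_derivative blinfun_apply (fx q t)) (at q within ball p r)"
      by (rule has_derivative_at_withinI)
  next
    fix q assume q: "q \<in> ball p r"
    show "(\<lambda>x. F (q + axis i (e x)) / e x) integrable_on cbox 0 1"
    proof (rule integrable_continuous)
      have 1: "continuous_on (ball p r \<times> UNIV) (\<lambda>y. F (fst y + axis i (e (snd y))) / e (snd y))"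
        by (rule continuous_on_translated_quotient[where e=e, OF contF ce e0 sub'])
      have 2: "continuous_on (cbox 0 1) (\<lambda>x. (q, x))" by (intro continuous_intros)
      have 3: "(\<lambda>x. (q, x)) ` cbox 0 1 \<subseteq> ball p r \<times> UNIV" using q by auto
      show "continuous_on (cbox 0 1) (\<lambda>x. F (q + axis i (e x)) / e x)"
        using continuous_on_compose2[OF 1 2 3] by (simp only: fst_conv snd_conv)
    qed
  qed (use r in auto)
  then have 2: "((\<lambda>q. integral (cbox 0 1) (\<lambda>x. F (q + axis i (e x)) / e x)) has_derivative
       blinfun_apply (integral (cbox 0 1) (fx p))) (at p)"
    by (simp only: at_within_open[OF centre_in_ball[THEN iffD2, OF r] open_ball])
  have 4: "((\<lambda>q. cgrad F q $ i) has_derivative blinfun_apply (integral (cbox 0 1) (fx p))) (at p)"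
    by (rule has_derivative_transform_within_open[OF 2, of "ball p r"]) (use r eq in auto)
  have int: "fx p integrable_on cbox 0 1"
  proof (rule integrable_continuous)
    have 1: "continuous_on (cbox 0 1) (\<lambda>x. (p, x))" by (intro continuous_intros)
    have 2: "(\<lambda>x. (p, x)) ` cbox 0 1 \<subseteq> ball p r \<times> cbox 0 1" using r by auto
    show "continuous_on (cbox 0 1) (fx p)"
      using continuous_on_compose2[OF contfx 1 2] by (simp only: prod.case)
  qed
  have "blinfun_apply (integral (cbox 0 1) (fx p)) (c *s v) = c * blinfun_apply (integral (cbox 0 1) (fx p)) v" for c v
  proof -
    have "blinfun_apply (fx p x) (c *s v) = c * blinfun_apply (fx p x) v" for x
      unfolding fx sum_distrib_left by (intro sum.cong refl) simp
    then show ?thesis by (simp only: blinfun_apply_integral[OF int] integral_mult_right)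
  qed
  then show ?thesis using 4 unfolding cdiff_map_at_def by blast
qed

lemma holo_map_cgrad:
  fixes F :: "complex^'k \<Rightarrow> complex"
  assumes "open G" "holo_map (*s) (*) G F"
  shows "holo_map (*s) (*s) G (cgrad F)"
  using assms
  by (auto simp: holo_map_open_iff intro!: cdiff_map_at_vec cdiff_map_at_cgrad_nth[where G=G])

section \<open>Complex tori and Laurent monomials\<close>

text \<open>The group \<open>exp (2\<pi>\<i> (m + \<i> m))\<close> for a subspace \<open>m\<close> of \<open>R\<^sup>d\<close>. Besides the complexified Lie algebra
of \<open>M\<close>, the subspace \<open>m\<close> will be its image under the sign changes \<open>\<epsilon>\<close>.\<close>

definition ctorus :: "(real^'d) set \<Rightarrow> (complex^'d) set" where
  "ctorus m = {(\<chi> i. exp (2 * pi * \<i> * Complex (x $ i) (y $ i))) | x y. x \<in> m \<and> y \<in> m}"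

definition corbit :: "(real^'d) set \<Rightarrow> complex^'d \<Rightarrow> (complex^'d) set" where
  "corbit m \<zeta> = {\<zeta> * t | t. t \<in> ctorus m}"

definition torus_quotient_cspace :: "(real^'d) set \<Rightarrow> (complex^'d) set \<Rightarrow> (complex^'d) set cspace" where
  "torus_quotient_cspace m S = (quotient_topology (subtopology euclidean S) (corbit m),
     \<lambda>W f. holo_on (*s) {\<zeta> \<in> S. corbit m \<zeta> \<in> W} (f \<circ> corbit m))"

text \<open>Integral equations for \<open>m\<close> in which the unknowns with index in the range of \<open>k\<close> are solved for.
Accordingly each row of exponents gives a Laurent monomial invariant under the torus, which is
linear in one coordinate \<open>k j\<close> and does not involve the other coordinates \<open>k j'\<close>.\<close>

definition chart_datum :: "(real^'d) set \<Rightarrow> ('n \<Rightarrow> 'd) \<Rightarrow> ('d \<Rightarrow> 'n \<Rightarrow> int) \<Rightarrow> bool" where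
  "chart_datum m k N \<longleftrightarrow> inj k \<and> (\<forall>j j'. N (k j) j' = (if j = j' then 1 else 0)) \<and>
     m = {v. \<forall>j. (\<Sum>i\<in>UNIV. of_int (N i j) * v $ i) = 0}"

definition monomials :: "('d \<Rightarrow> 'n \<Rightarrow> int) \<Rightarrow> complex^'d \<Rightarrow> complex^'n" where
  "monomials N \<zeta> = (\<chi> j. \<Prod>i\<in>UNIV. \<zeta> $ i powi N i j)"

definition slice :: "('n \<Rightarrow> 'd) \<Rightarrow> complex^'n \<Rightarrow> complex^'d" where
  "slice k y = (\<chi> i. if i \<in> range k then y $ inv k i else 1)"

lemma ctorusI:
  fixes c :: "complex^'d"
  assumes "(\<chi> i. Re (c $ i)) \<in> m" "(\<chi> i. Im (c $ i)) \<in> m"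
  shows "(\<chi> i. exp (2 * pi * \<i> * c $ i)) \<in> ctorus m"
  unfolding ctorus_def using assms
  by (intro CollectI exI[of _ "\<chi> i. Re (c $ i)"] exI[of _ "\<chi> i. Im (c $ i)"]) (simp add: vec_eq_iff)

lemma ctorusE:
  assumes "t \<in> ctorus m"
  obtains x y where "x \<in> m" "y \<in> m" "\<forall>i. t $ i = exp (2 * pi * \<i> * Complex (x $ i) (y $ i))"
  using assms unfolding ctorus_def by auto

lemma ctorus_nonzero: "t \<in> ctorus m \<Longrightarrow> t $ i \<noteq> 0"
  by (auto elim!: ctorusE)

lemma ctorus_one: assumes "subspace m" shows "1 \<in> ctorus m"
proof -
  have "(\<chi> i. exp (2 * pi * \<i> * (0::complex^'a) $ i)) \<in> ctorus m"
    using subspace_0[OF assms] by (intro ctorusI) (simp_all add: zero_vec_def)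
  then show ?thesis by (simp add: one_vec_def)
qed

lemma ctorus_mult:
  assumes m: "subspace m" and "s \<in> ctorus m" "t \<in> ctorus m"
  shows "s * t \<in> ctorus m"
proof -
  obtain x y where s: "x \<in> m" "y \<in> m" "\<forall>i. s $ i = exp (2 * pi * \<i> * Complex (x $ i) (y $ i))"
    using ctorusE[OF assms(2)] .
  obtain x' y' where t: "x' \<in> m" "y' \<in> m" "\<forall>i. t $ i = exp (2 * pi * \<i> * Complex (x' $ i) (y' $ i))"
    using ctorusE[OF assms(3)] .
  have "s * t = (\<chi> i. exp (2 * pi * \<i> * Complex ((x + x') $ i) ((y + y') $ i)))"
    by (simp add: vec_eq_iff s(3) t(3) exp_add[symmetric] algebra_simps flip: complex_add)
  then show ?thesis unfolding ctorus_def
    using s t subspace_add[OF m] by blast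
qed

definition vinv :: "complex^'d \<Rightarrow> complex^'d" where "vinv t = (\<chi> i. inverse (t $ i))"

lemma vinv_nth [simp]: "vinv t $ i = inverse (t $ i)"
  by (simp add: vinv_def)

lemma ctorus_vinv:
  assumes m: "subspace m" and "t \<in> ctorus m"
  shows "vinv t \<in> ctorus m"
proof -
  obtain x y where s: "x \<in> m" "y \<in> m" "\<forall>i. t $ i = exp (2 * pi * \<i> * Complex (x $ i) (y $ i))"
    using ctorusE[OF assms(2)] .
  have "vinv t = (\<chi> i. exp (2 * pi * \<i> * Complex ((- x) $ i) ((- y) $ i)))"
    by (simp add: vec_eq_iff s(3) flip: exp_minus complex_minus)
  then show ?thesis unfolding ctorus_def
    using s subspace_neg[OF m] by blast
qed

lemma vinv_cancel: "t \<in> ctorus m \<Longrightarrow> \<zeta> * t * vinv t = \<zeta>" "t \<in> ctorus m \<Longrightarrow> \<zeta> * vinv t * t = \<zeta>"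
  by (auto simp: vec_eq_iff ctorus_nonzero)

lemma corbit_eq_iff:
  assumes m: "subspace m"
  shows "corbit m \<zeta> = corbit m \<zeta>' \<longleftrightarrow> (\<exists>t\<in>ctorus m. \<zeta>' = \<zeta> * t)"
proof
  assume "corbit m \<zeta> = corbit m \<zeta>'"
  moreover have "\<zeta>' \<in> corbit m \<zeta>'" unfolding corbit_def using ctorus_one[OF m] by (auto intro!: exI[of _ 1])
  ultimately show "\<exists>t\<in>ctorus m. \<zeta>' = \<zeta> * t" unfolding corbit_def by auto
next
  assume "\<exists>t\<in>ctorus m. \<zeta>' = \<zeta> * t"
  then obtain t where t: "t \<in> ctorus m" "\<zeta>' = \<zeta> * t" by blast
  show "corbit m \<zeta> = corbit m \<zeta>'"
  proof (intro equalityI subsetI)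
    fix x assume "x \<in> corbit m \<zeta>"
    then obtain s where s: "s \<in> ctorus m" "x = \<zeta> * s" by (auto simp: corbit_def)
    have "x = \<zeta>' * (vinv t * s)" using vinv_cancel(1)[OF t(1), of \<zeta>] s t by (simp add: mult.assoc[symmetric])
    then show "x \<in> corbit m \<zeta>'" unfolding corbit_def using ctorus_mult[OF m ctorus_vinv[OF m t(1)] s(1)] by blast
  next
    fix x assume "x \<in> corbit m \<zeta>'"
    then obtain s where s: "s \<in> ctorus m" "x = \<zeta>' * s" by (auto simp: corbit_def)
    then have "x = \<zeta> * (t * s)" using t by (simp add: mult.assoc)
    then show "x \<in> corbit m \<zeta>" unfolding corbit_def using ctorus_mult[OF m t(1) s(1)] by blast
  qed
qed

lemma chart_datum_sum:
  fixes f :: "'d::finite \<Rightarrow> 'a::comm_ring_1" and N :: "'d \<Rightarrow> 'n::finite \<Rightarrow> int"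
  assumes "chart_datum m k N"
  shows "(\<Sum>i\<in>UNIV. of_int (N i j) * f i) = f (k j) + (\<Sum>i\<in>-range k. of_int (N i j) * f i)"
proof -
  have k: "inj k" "\<And>j j'. N (k j) j' = (if j = j' then 1 else 0)"
    using assms by (auto simp: chart_datum_def)
  have "(\<Sum>i\<in>UNIV. of_int (N i j) * f i) = (\<Sum>i\<in>range k. of_int (N i j) * f i) + (\<Sum>i\<in>-range k. of_int (N i j) * f i)"
    by (subst sum.union_disjoint[symmetric]) auto
  also have "(\<Sum>i\<in>range k. of_int (N i j) * f i) = (\<Sum>j'\<in>UNIV. of_int (N (k j') j) * f (k j'))"
    by (simp add: sum.reindex[OF k(1)])
  also have "\<dots> = (\<Sum>j'\<in>UNIV. if j' = j then f (k j') else 0)"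
    by (intro sum.cong) (auto simp: k(2))
  finally show ?thesis by simp
qed

lemma monomials_split:
  fixes N :: "'d::finite \<Rightarrow> 'n::finite \<Rightarrow> int"
  assumes "chart_datum m k N"
  shows "monomials N \<zeta> $ j = \<zeta> $ k j * (\<Prod>i\<in>-range k. \<zeta> $ i powi N i j)"
proof -
  have k: "inj k" "\<And>j j'. N (k j) j' = (if j = j' then 1 else 0)"
    using assms by (auto simp: chart_datum_def)
  have "(\<Prod>i\<in>UNIV. \<zeta> $ i powi N i j) = (\<Prod>i\<in>range k. \<zeta> $ i powi N i j) * (\<Prod>i\<in>-range k. \<zeta> $ i powi N i j)"
    by (subst prod.union_disjoint[symmetric]) auto
  also have "(\<Prod>i\<in>range k. \<zeta> $ i powi N i j) = (\<Prod>j'\<in>UNIV. \<zeta> $ k j' powi N (k j') j)"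
    by (simp add: prod.reindex[OF k(1)])
  also have "\<dots> = (\<Prod>j'\<in>UNIV. if j' = j then \<zeta> $ k j' else 1)"
    by (intro prod.cong) (auto simp: k(2))
  finally show ?thesis by (simp add: monomials_def)
qed

lemma monomials_ctorus:
  fixes N :: "'d::finite \<Rightarrow> 'n::finite \<Rightarrow> int"
  assumes "chart_datum m k N" "t \<in> ctorus m"
  shows "monomials N (\<zeta> * t) = monomials N \<zeta>"
proof -
  obtain x y where t: "x \<in> m" "y \<in> m" "\<forall>i. t $ i = exp (2 * pi * \<i> * Complex (x $ i) (y $ i))"
    using ctorusE[OF assms(2)] .
  have "(\<Prod>i\<in>UNIV. t $ i powi N i j) = 1" for j
  proof -
    have xy: "(\<Sum>i\<in>UNIV. of_int (N i j) * x $ i) = 0" "(\<Sum>i\<in>UNIV. of_int (N i j) * y $ i) = 0"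
      using assms(1) t by (auto simp: chart_datum_def)
    have "(\<Sum>i\<in>UNIV. of_int (N i j) * (2 * pi * \<i> * Complex (x $ i) (y $ i))) =
       2 * of_real pi * \<i> * (of_real (\<Sum>i\<in>UNIV. of_int (N i j) * x $ i) + \<i> * of_real (\<Sum>i\<in>UNIV. of_int (N i j) * y $ i))"
      by (simp add: sum_distrib_left algebra_simps Complex_eq flip: sum.distrib)
    also have "\<dots> = 0" by (simp only: xy) simp
    finally show ?thesis
      by (simp add: t(3) exp_power_int exp_sum[symmetric])
  qed
  then show ?thesis
    by (simp add: monomials_def vec_eq_iff power_int_mult_distrib prod.distrib)
qed

lemma monomials_slice:
  assumes "chart_datum m k N"
  shows "monomials N (slice k y) = y"
proof -
  have "inj k" using assms by (auto simp: chart_datum_def)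
  then show ?thesis by (simp add: vec_eq_iff monomials_split[OF assms] slice_def)
qed

text \<open>The torus element that makes all coordinates outside the range of \<open>k\<close> equal to \<open>1\<close> is found by
choosing logarithms of these coordinates; the equations for \<open>m\<close> then fix the remaining entries of
the logarithm. What becomes of the coordinates \<open>k j\<close> can be read off from invariance of
the monomials.\<close>

lemma slice_monomials:
  fixes N :: "'d::finite \<Rightarrow> 'n::finite \<Rightarrow> int"
  assumes cd: "chart_datum m k N" and nz: "\<And>i. i \<notin> range k \<Longrightarrow> \<zeta> $ i \<noteq> 0"
  shows "\<exists>t\<in>ctorus m. slice k (monomials N \<zeta>) = \<zeta> * t"
proof -
  have k: "inj k" "m = {v. \<forall>j. (\<Sum>i\<in>UNIV. of_int (N i j) * v $ i) = 0}"
    using cd by (auto simp: chart_datum_def)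
  define c where "c i = (if i \<in> range k then - (\<Sum>i'\<in>-range k. of_int (N i' (inv k i)) * (- Ln (\<zeta> $ i') / (2 * pi * \<i>)))
     else - Ln (\<zeta> $ i) / (2 * pi * \<i>))" for i
  define t where "t = (\<chi> i. exp (2 * pi * \<i> * (\<chi> i. c i) $ i))"
  have sum0: "(\<Sum>i\<in>UNIV. of_int (N i j) * c i) = 0" for j
    unfolding chart_datum_sum[OF cd] using k(1) by (simp add: c_def)
  have "(\<Sum>i\<in>UNIV. of_int (N i j) * Re (c i)) = 0" "(\<Sum>i\<in>UNIV. of_int (N i j) * Im (c i)) = 0" for j
    using arg_cong[OF sum0[of j], of Re] arg_cong[OF sum0[of j], of Im] by simp_all
  then have t: "t \<in> ctorus m" unfolding t_def by (intro ctorusI) (simp_all add: k(2))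
  have one: "(\<zeta> * t) $ i = 1" if "i \<notin> range k" for i
    using that nz[OF that] by (simp add: t_def c_def exp_minus)
  have "slice k (monomials N \<zeta>) = \<zeta> * t"
    unfolding vec_eq_iff
  proof
    fix i
    show "slice k (monomials N \<zeta>) $ i = (\<zeta> * t) $ i"
    proof (cases "i \<in> range k")
      case False
      then show ?thesis using one by (simp add: slice_def)
    next
      case True
      then obtain j where i: "i = k j" by blast
      have "monomials N \<zeta> $ j = monomials N (\<zeta> * t) $ j" by (simp only: monomials_ctorus[OF cd t])
      also have "\<dots> = (\<zeta> * t) $ k j"
        unfolding monomials_split[OF cd] using one by simp
      finally show ?thesis using i k(1) by (simp add: slice_def)
    qed
  qed
  then show ?thesis using t by blast
qed

lemma cdiff_map_at_slice: "cdiff_map_at (*s) (*s) (slice k :: complex^'n \<Rightarrow> complex^'d) p"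
proof (rule cdiff_map_at_vec)
  fix i
  show "cdiff_map_at (*s) (*) (\<lambda>y. (slice k y :: complex^'d) $ i) p"
    by (cases "i \<in> range k") (auto simp: slice_def intro: cdiff_map_at_nth)
qed

lemma cdiff_map_at_monomials:
  fixes N :: "'d::finite \<Rightarrow> 'n::finite \<Rightarrow> int"
  assumes cd: "chart_datum m k N" and nz: "\<And>i. i \<notin> range k \<Longrightarrow> \<zeta> $ i \<noteq> 0"
  shows "cdiff_map_at (*s) (*s) (monomials N) \<zeta>"
proof (rule cdiff_map_at_vec)
  fix j
  show "cdiff_map_at (*s) (*) (\<lambda>\<zeta>. monomials N \<zeta> $ j) \<zeta>"
    unfolding monomials_split[OF cd]
    by (intro cdiff_map_at_mult cdiff_map_at_prod cdiff_map_at_nth cdiff_map_at_powi) (use nz in auto)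
qed

section \<open>The quotient by a complex torus as a complex manifold\<close>

text \<open>The set of chart data is a parameter of the locale because it carries the type \<open>'n\<close>, the
dimension of the quotient. The last assumption says that the monomial charts cover the
quotient.\<close>

locale torus_quotient =
  fixes m :: "(real^'d::finite) set" and S :: "(complex^'d) set"
    and charts :: "(('n::finite \<Rightarrow> 'd) \<times> ('d \<Rightarrow> 'n \<Rightarrow> int)) set"
  assumes subspace_m: "subspace m"
    and open_S: "open S"
    and S_invariant: "\<zeta> \<in> S \<Longrightarrow> t \<in> ctorus m \<Longrightarrow> \<zeta> * t \<in> S"
    and charts_datum: "(k, N) \<in> charts \<Longrightarrow> chart_datum m k N"
    and charts_cover: "\<zeta> \<in> S \<Longrightarrow> \<exists>k N. (k, N) \<in> charts \<and> (\<forall>i. i \<notin> range k \<longrightarrow> \<zeta> $ i \<noteq> 0)"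
begin

abbreviation "q \<equiv> corbit m"

definition X where "X = torus_quotient_cspace m S"

lemma q_eq_iff: "q \<zeta> = q \<zeta>' \<longleftrightarrow> (\<exists>t\<in>ctorus m. \<zeta>' = \<zeta> * t)"
  by (rule corbit_eq_iff[OF subspace_m])

lemma q_mult: "t \<in> ctorus m \<Longrightarrow> q (\<zeta> * t) = q \<zeta>"
  using q_eq_iff[of \<zeta> "\<zeta> * t"] by auto

lemma openin_X: "openin (fst X) V \<longleftrightarrow> V \<subseteq> q ` S \<and> open {\<zeta>\<in>S. q \<zeta> \<in> V}"
proof -
  have "openin (top_of_set S) {\<zeta>\<in>S. q \<zeta> \<in> V} \<longleftrightarrow> open {\<zeta>\<in>S. q \<zeta> \<in> V}"
    using open_S openin_open_eq by blast
  then show ?thesis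
    by (simp add: X_def torus_quotient_cspace_def openin_quotient_topology)
qed

lemma holo_X: "snd X V f \<longleftrightarrow> holo_map (*s) (*) {\<zeta>\<in>S. q \<zeta> \<in> V} (\<lambda>\<zeta>. f (q \<zeta>))"
  by (simp add: X_def torus_quotient_cspace_def holo_on_iff comp_def)

lemma holo_X_cong:
  assumes "\<And>x. x \<in> V \<Longrightarrow> f x = g x"
  shows "snd X V f \<longleftrightarrow> snd X V g"
  unfolding holo_X by (rule holo_map_cong) (use assms in auto)

lemma holo_X_subset: "snd X V f \<Longrightarrow> V' \<subseteq> V \<Longrightarrow> snd X V' f"
  unfolding holo_X by (erule holo_map_subset) auto

lemma holo_X_pullback_diff:
  assumes "openin (fst X) V" "snd X V f" "\<zeta> \<in> S" "q \<zeta> \<in> V"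
  shows "cdiff_map_at (*s) (*) (\<lambda>\<zeta>. f (q \<zeta>)) \<zeta>"
proof -
  have "open {\<zeta>\<in>S. q \<zeta> \<in> V}" using assms openin_X by auto
  then have "\<forall>\<zeta>\<in>{\<zeta>\<in>S. q \<zeta> \<in> V}. cdiff_map_at (*s) (*) (\<lambda>\<zeta>. f (q \<zeta>)) \<zeta>"
    using assms(2) by (simp add: holo_map_open_iff holo_X)
  then show ?thesis using assms by blast
qed

definition chart_dom :: "('n \<Rightarrow> 'd) \<Rightarrow> (complex^'d) set" where
  "chart_dom k = {\<zeta>\<in>S. \<forall>i. i \<notin> range k \<longrightarrow> \<zeta> $ i \<noteq> 0}"

definition coord :: "('n \<Rightarrow> 'd) \<Rightarrow> ('d \<Rightarrow> 'n \<Rightarrow> int) \<Rightarrow> (complex^'d) set \<Rightarrow> complex^'n" where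
  "coord k N x = monomials N (SOME \<zeta>. \<zeta> \<in> chart_dom k \<and> q \<zeta> = x)"

lemma chart_dom_subset: "chart_dom k \<subseteq> S" by (auto simp: chart_dom_def)

lemma open_chart_dom: "open (chart_dom k)"
proof -
  have "open {\<zeta>::complex^'d. \<zeta> $ i \<noteq> 0}" for i
    by (intro open_Collect_neq continuous_intros)
  then have "open (\<Inter>i\<in>-range k. {\<zeta>::complex^'d. \<zeta> $ i \<noteq> 0})" by (intro open_INT) auto
  then have "open (S \<inter> (\<Inter>i\<in>-range k. {\<zeta>::complex^'d. \<zeta> $ i \<noteq> 0}))" using open_S by blast
  also have "S \<inter> (\<Inter>i\<in>-range k. {\<zeta>. \<zeta> $ i \<noteq> 0}) = chart_dom k" by (auto simp: chart_dom_def)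
  finally show ?thesis .
qed

lemma chart_dom_mult: "\<zeta> \<in> chart_dom k \<Longrightarrow> t \<in> ctorus m \<Longrightarrow> \<zeta> * t \<in> chart_dom k"
  by (auto simp: chart_dom_def S_invariant ctorus_nonzero)

lemma chart_dom_saturated: "\<zeta> \<in> S \<Longrightarrow> q \<zeta> \<in> q ` chart_dom k \<longleftrightarrow> \<zeta> \<in> chart_dom k"
proof
  assume "q \<zeta> \<in> q ` chart_dom k"
  then obtain \<zeta>' where "\<zeta>' \<in> chart_dom k" "q \<zeta>' = q \<zeta>" by auto
  then show "\<zeta> \<in> chart_dom k" using q_eq_iff chart_dom_mult by metis
qed auto

context
  fixes k N assumes kN: "(k, N) \<in> charts"
begin

lemma monomials_q:
  assumes "q \<zeta> = q \<zeta>'" shows "monomials N \<zeta> = monomials N \<zeta>'"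
  using assms monomials_ctorus[OF charts_datum[OF kN]] q_eq_iff by metis

lemma coord_q: "\<zeta> \<in> chart_dom k \<Longrightarrow> coord k N (q \<zeta>) = monomials N \<zeta>"
  unfolding coord_def
  by (rule someI2[of "\<lambda>\<zeta>'. \<zeta>' \<in> chart_dom k \<and> q \<zeta>' = q \<zeta>" \<zeta>]) (auto intro: monomials_q)

lemma slice_coord:
  assumes "\<zeta> \<in> chart_dom k"
  shows "\<exists>t\<in>ctorus m. slice k (monomials N \<zeta>) = \<zeta> * t"
  using assms by (intro slice_monomials[OF charts_datum[OF kN]]) (auto simp: chart_dom_def)

lemma slice_in_chart_dom:
  assumes "\<zeta> \<in> chart_dom k"
  shows "slice k (monomials N \<zeta>) \<in> chart_dom k" "q (slice k (monomials N \<zeta>)) = q \<zeta>"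
  using slice_coord[OF assms] assms chart_dom_mult q_mult by metis+

lemma inj_on_coord: "inj_on (coord k N) (q ` chart_dom k)"
proof (rule inj_onI, elim imageE)
  fix x y \<zeta> \<zeta>' assume *: "coord k N x = coord k N y" "x = q \<zeta>" "\<zeta> \<in> chart_dom k" "y = q \<zeta>'" "\<zeta>' \<in> chart_dom k"
  then have "monomials N \<zeta> = monomials N \<zeta>'" by (simp add: coord_q)
  then show "x = y" using * slice_in_chart_dom by metis
qed

lemma coord_image: "coord k N ` q ` chart_dom k = {y. slice k y \<in> S}"
proof (intro equalityI subsetI)
  fix y assume "y \<in> coord k N ` q ` chart_dom k"
  then obtain \<zeta> where "\<zeta> \<in> chart_dom k" "y = monomials N \<zeta>" by (auto simp: coord_q)
  then show "y \<in> {y. slice k y \<in> S}" using slice_in_chart_dom(1) chart_dom_subset[of k] by blast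
next
  fix y assume y: "y \<in> {y. slice k y \<in> S}"
  then have "slice k y \<in> chart_dom k" by (auto simp: chart_dom_def slice_def)
  moreover have "coord k N (q (slice k y)) = y"
    using coord_q[OF calculation] monomials_slice[OF charts_datum[OF kN]] by metis
  ultimately show "y \<in> coord k N ` q ` chart_dom k" by force
qed

lemma slice_in_dom: "slice k y \<in> S \<Longrightarrow> slice k y \<in> chart_dom k"
  by (auto simp: chart_dom_def slice_def)

lemma continuous_slice: "continuous_on A (slice k :: complex^'n \<Rightarrow> complex^'d)"
  using cdiff_map_at_imp_isCont[OF cdiff_map_at_slice] continuous_at_imp_continuous_on by blast

lemma holo_slice: "holo_map (*s) (*s) A (slice k :: complex^'n \<Rightarrow> complex^'d)"
  by (rule holo_map_subset[of _ _ UNIV]) (auto intro: holo_mapI cdiff_map_at_slice)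

lemma holo_monomials: "holo_map (*s) (*s) (chart_dom k) (monomials N)"
  by (rule holo_mapI[OF cdiff_map_at_monomials[OF charts_datum[OF kN]] open_chart_dom])
     (auto simp: chart_dom_def)

lemma open_coord_image: "open (coord k N ` q ` chart_dom k)"
proof -
  have "open (slice k -` S :: (complex^'n) set)"
    using open_vimage[OF open_S] continuous_slice by blast
  then show ?thesis unfolding coord_image vimage_def .
qed

lemma openin_chart_dom: "openin (fst X) (q ` chart_dom k)"
proof -
  have "{\<zeta>\<in>S. q \<zeta> \<in> q ` chart_dom k} = chart_dom k"
    using chart_dom_saturated chart_dom_subset by blast
  then show ?thesis using openin_X open_chart_dom chart_dom_subset by (simp add: image_mono)
qed

lemma coord_preimage:
  "{\<zeta>\<in>S. q \<zeta> \<in> {x \<in> q ` chart_dom k. coord k N x \<in> U}} = {\<zeta>\<in>chart_dom k. monomials N \<zeta> \<in> U}"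
  using chart_dom_saturated[of _ k] chart_dom_subset[of k] by (auto simp: coord_q) (metis imageI coord_q)+

lemma open_coord_preimage_iff:
  assumes U: "U \<subseteq> coord k N ` q ` chart_dom k"
  shows "openin (fst X) {x \<in> q ` chart_dom k. coord k N x \<in> U} \<longleftrightarrow> open U"
proof -
  have "openin (fst X) {x \<in> q ` chart_dom k. coord k N x \<in> U} \<longleftrightarrow> open {\<zeta>\<in>chart_dom k. monomials N \<zeta> \<in> U}"
    unfolding openin_X coord_preimage using chart_dom_subset by auto
  also have "\<dots> \<longleftrightarrow> open U"
  proof
    assume "open U"
    then show "open {\<zeta>\<in>chart_dom k. monomials N \<zeta> \<in> U}"
      using continuous_open_preimage[OF holo_map_imp_continuous_on[OF holo_monomials] open_chart_dom]
      by (simp add: vimage_def Int_def)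
  next
    assume "open {\<zeta>\<in>chart_dom k. monomials N \<zeta> \<in> U}"
    then have "open (slice k -` {\<zeta>\<in>chart_dom k. monomials N \<zeta> \<in> U} :: (complex^'n) set)"
      using open_vimage continuous_slice by blast
    moreover have "slice k -` {\<zeta>\<in>chart_dom k. monomials N \<zeta> \<in> U} = U"
      using U monomials_slice[OF charts_datum[OF kN]] slice_in_dom unfolding coord_image by auto
    ultimately show "open U" by simp
  qed
  finally show ?thesis .
qed

text \<open>The monomials and the slice are mutually inverse up to the torus action and holomorphic, so
openness and holomorphy can be carried from the total space to the chart and back.\<close>

lemma is_chart_coord: "is_chart X (q ` chart_dom k, coord k N)"
proof -
  let ?W = "q ` chart_dom k" and ?\<phi> = "coord k N"
  have tsW: "topspace (subtopology (fst X) ?W) = ?W"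
    using openin_chart_dom openin_subset by (simp add: topspace_subtopology) blast
  have hom: "homeomorphic_map (subtopology (fst X) ?W) (subtopology euclidean (?\<phi> ` ?W)) ?\<phi>"
    unfolding homeomorphic_map_def quotient_map_def tsW
  proof (intro conjI allI impI inj_on_coord)
    fix U assume U: "U \<subseteq> topspace (top_of_set (?\<phi> ` ?W))"
    have "openin (subtopology (fst X) ?W) {x \<in> ?W. ?\<phi> x \<in> U} \<longleftrightarrow> openin (fst X) {x \<in> ?W. ?\<phi> x \<in> U}"
      using openin_chart_dom openin_open_subtopology by blast
    also have "\<dots> \<longleftrightarrow> open U" using U open_coord_preimage_iff by simp
    also have "\<dots> \<longleftrightarrow> openin (top_of_set (?\<phi> ` ?W)) U"
      using U openin_open_eq[OF open_coord_image] by simp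
    finally show "openin (subtopology (fst X) ?W) {x \<in> ?W. ?\<phi> x \<in> U} \<longleftrightarrow> openin (top_of_set (?\<phi> ` ?W)) U" .
  qed simp
  have sh: "holo_on (*s) V f \<longleftrightarrow> snd X {x \<in> ?W. ?\<phi> x \<in> V} (f \<circ> ?\<phi>)"
    if "openin (top_of_set (?\<phi> ` ?W)) V" for V f
  proof -
    have V: "open V" "V \<subseteq> ?\<phi> ` ?W" using that openin_open_eq[OF open_coord_image] by auto
    have "snd X {x \<in> ?W. ?\<phi> x \<in> V} (f \<circ> ?\<phi>) \<longleftrightarrow>
       holo_map (*s) (*) {\<zeta>\<in>chart_dom k. monomials N \<zeta> \<in> V} (\<lambda>\<zeta>. f (?\<phi> (q \<zeta>)))"
      unfolding holo_X coord_preimage by simp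
    also have "\<dots> \<longleftrightarrow> holo_map (*s) (*) {\<zeta>\<in>chart_dom k. monomials N \<zeta> \<in> V} (\<lambda>\<zeta>. f (monomials N \<zeta>))"
      by (rule holo_map_cong) (simp add: coord_q)
    also have "\<dots> \<longleftrightarrow> holo_map (*s) (*) V f"
    proof
      assume "holo_map (*s) (*) V f"
      then show "holo_map (*s) (*) {\<zeta>\<in>chart_dom k. monomials N \<zeta> \<in> V} (\<lambda>\<zeta>. f (monomials N \<zeta>))"
        by (rule holo_map_compose[rotated 2]) (auto intro: holo_map_subset[OF holo_monomials])
    next
      assume h: "holo_map (*s) (*) {\<zeta>\<in>chart_dom k. monomials N \<zeta> \<in> V} (\<lambda>\<zeta>. f (monomials N \<zeta>))"
      have "holo_map (*s) (*) V (\<lambda>y. f (monomials N (slice k y)))"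
        by (rule holo_map_compose[OF holo_slice _ h])
           (use V monomials_slice[OF charts_datum[OF kN]] slice_in_dom coord_image in auto)
      then show "holo_map (*s) (*) V f" by (simp add: monomials_slice[OF charts_datum[OF kN]])
    qed
    finally show ?thesis by (simp add: holo_on_iff)
  qed
  show ?thesis
    unfolding is_chart_def prod.case biholomorphic_map_def open_subspace_def affine_cspace_def fst_conv snd_conv tsW
    using openin_chart_dom open_coord_image hom sh by auto
qed

end

end

section \<open>Arbitrary holomorphic charts\<close>

lemma homeomorphic_map_openin_image:
  assumes "homeomorphic_map X Y f" "openin X V"
  shows "openin Y (f ` V)"
  using assms by (simp add: homeomorphic_eq_everything_map open_map_def)

lemma is_chartD:
  fixes X :: "'a cspace"
  assumes "is_chart X (W, \<phi>)"
  shows is_chart_openin: "openin (fst X) W"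
    and is_chart_open_image: "open (\<phi> ` W)"
    and is_chart_inj: "inj_on \<phi> W"
    and is_chart_open_image_subset: "openin (fst X) V \<Longrightarrow> V \<subseteq> W \<Longrightarrow> open (\<phi> ` V)"
    and is_chart_open_preimage: "open O' \<Longrightarrow> O' \<subseteq> \<phi> ` W \<Longrightarrow> openin (fst X) {x\<in>W. \<phi> x \<in> O'}"
    and is_chart_holo: "open O' \<Longrightarrow> O' \<subseteq> \<phi> ` W \<Longrightarrow>
       holo_map (*s) (*) O' f \<longleftrightarrow> snd X {x\<in>W. \<phi> x \<in> O'} (f \<circ> \<phi>)"
proof -
  have W: "openin (fst X) W" "open (\<phi> ` W)"
    and hom: "homeomorphic_map (subtopology (fst X) W) (top_of_set (\<phi> ` W)) \<phi>"
    and sh: "\<And>V f. openin (top_of_set (\<phi> ` W)) V \<Longrightarrow>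
       holo_on (*s) V f \<longleftrightarrow> snd X {x \<in> topspace (subtopology (fst X) W). \<phi> x \<in> V} (f \<circ> \<phi>)"
    using assms by (auto simp: is_chart_def biholomorphic_map_def open_subspace_def affine_cspace_def)
  have ts: "topspace (subtopology (fst X) W) = W"
    using openin_subset[OF W(1)] by (auto simp: topspace_subtopology)
  show "openin (fst X) W" "open (\<phi> ` W)" by fact+
  show "inj_on \<phi> W" using hom ts by (simp add: homeomorphic_map_def)
  show "open (\<phi> ` V)" if "openin (fst X) V" "V \<subseteq> W"
  proof -
    have "openin (subtopology (fst X) W) V" using that W openin_open_subtopology by blast
    from homeomorphic_map_openin_image[OF hom this] show ?thesis
      using W(2) openin_open_eq by blast
  qed
  show "openin (fst X) {x\<in>W. \<phi> x \<in> O'}" if "open O'" "O' \<subseteq> \<phi> ` W"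
  proof -
    have "openin (top_of_set (\<phi> ` W)) O'" using that W(2) openin_open_eq by blast
    then have "openin (subtopology (fst X) W) {x \<in> topspace (subtopology (fst X) W). \<phi> x \<in> O'}"
      using hom openin_continuous_map_preimage homeomorphic_imp_continuous_map by blast
    then show ?thesis unfolding ts using openin_open_subtopology[OF W(1)] by blast
  qed
  show "holo_map (*s) (*) O' f \<longleftrightarrow> snd X {x\<in>W. \<phi> x \<in> O'} (f \<circ> \<phi>)" if "open O'" "O' \<subseteq> \<phi> ` W"
  proof -
    have "openin (top_of_set (\<phi> ` W)) O'" using that W(2) openin_open_eq by blast
    from sh[OF this, of f] show ?thesis unfolding ts holo_on_iff .
  qed
qed

lemma cdiff_map_at_mult_vec: "cdiff_map_at (*s) (*s) (\<lambda>z::complex^'k. z * a) p"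
proof (rule cdiff_map_at_vec)
  fix i show "cdiff_map_at (*s) (*) (\<lambda>z. (z * a) $ i) p"
    unfolding vector_mult_component
    by (rule cdiff_map_at_mult[OF cdiff_map_at_nth]) auto
qed

lemma holo_map_mult_vec:
  assumes "holo_map sc (*s) A h" shows "holo_map sc (*s) A (\<lambda>y. h y * (a::complex^'k))"
  by (rule holo_map_compose[OF assms, of UNIV]) (auto intro: holo_mapI cdiff_map_at_mult_vec)

context torus_quotient
begin

lemma chart_function_holo:
  assumes ch: "is_chart X (W, \<phi> :: _ \<Rightarrow> complex^'n)" and F: "holo_map (*s) (*) (\<phi> ` W) F"
  shows "snd X W (\<lambda>x. F (\<phi> x))"
proof -
  have "snd X {x\<in>W. \<phi> x \<in> \<phi> ` W} (F \<circ> \<phi>)"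
    using F is_chart_holo[OF ch is_chart_open_image[OF ch]] by blast
  moreover have "{x\<in>W. \<phi> x \<in> \<phi> ` W} = W" by auto
  ultimately show ?thesis by (simp add: comp_def)
qed

lemma chart_coordinate_holo:
  assumes ch: "is_chart X (W, \<phi> :: _ \<Rightarrow> complex^'n)"
  shows "snd X W (\<lambda>x. \<phi> x $ j)"
  by (rule chart_function_holo[OF ch]) (rule holo_mapI[OF cdiff_map_at_nth is_chart_open_image[OF ch]])

lemma holo_in_chart:
  assumes ch: "is_chart X (W, \<phi> :: _ \<Rightarrow> complex^'n)" and V: "openin (fst X) V" "V \<subseteq> W" and g: "snd X V g"
  shows "holo_map (*s) (*) (\<phi> ` V) (\<lambda>y. g (inv_into W \<phi> y))"
proof -
  have op: "open (\<phi> ` V)" by (rule is_chart_open_image_subset[OF ch V])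
  have sub: "\<phi> ` V \<subseteq> \<phi> ` W" using V by auto
  have eq: "{x\<in>W. \<phi> x \<in> \<phi> ` V} = V"
    using V is_chart_inj[OF ch] by (auto simp: inj_on_def subset_iff)
  have "snd X V ((\<lambda>y. g (inv_into W \<phi> y)) \<circ> \<phi>)"
    using V is_chart_inj[OF ch] g by (subst holo_X_cong[of _ _ g]) (auto simp: subset_iff)
  then show ?thesis using is_chart_holo[OF ch op sub] unfolding eq by blast
qed

lemma q_in_open: "openin (fst X) V \<Longrightarrow> x \<in> V \<Longrightarrow> \<exists>\<zeta>\<in>S. x = q \<zeta>"
  using openin_X by auto

text \<open>Through \<open>slice\<close> a monomial chart has a section, and the coordinate change from \<open>\<phi>\<close> to a monomial
chart is holomorphic. The composition hits the orbit of \<open>\<zeta>\<close> in a possibly different point, and a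
fixed torus element moves it to \<open>\<zeta>\<close>.\<close>

lemma local_section:
  fixes \<phi> :: "(complex^'d) set \<Rightarrow> complex^'n"
  assumes ch: "is_chart X (W, \<phi>)" and \<zeta>: "\<zeta> \<in> S" "q \<zeta> \<in> W"
  obtains G \<sigma> where "open G" "\<phi> (q \<zeta>) \<in> G" "G \<subseteq> \<phi> ` W" "holo_map (*s) (*s) G \<sigma>"
    "\<And>y. y \<in> G \<Longrightarrow> \<sigma> y \<in> S" "\<And>y. y \<in> G \<Longrightarrow> q (\<sigma> y) = inv_into W \<phi> y" "\<sigma> (\<phi> (q \<zeta>)) = \<zeta>"
proof -
  obtain k N where kN: "(k, N) \<in> charts" "\<zeta> \<in> chart_dom k"
    using charts_cover[OF \<zeta>(1)] \<zeta> by (auto simp: chart_dom_def)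
  obtain t where t: "t \<in> ctorus m" "slice k (monomials N \<zeta>) = \<zeta> * t"
    using slice_coord[OF kN] by blast
  let ?W' = "q ` chart_dom k" and ?\<psi> = "coord k N"
  have ch': "is_chart X (?W', ?\<psi>)" by (rule is_chart_coord[OF kN(1)])
  have WW: "openin (fst X) (W \<inter> ?W')" using is_chart_openin[OF ch] is_chart_openin[OF ch'] by blast
  define G where "G = \<phi> ` (W \<inter> ?W')"
  define \<tau> where "\<tau> y = ?\<psi> (inv_into W \<phi> y)" for y
  define \<sigma> where "\<sigma> y = slice k (\<tau> y) * vinv t" for y
  have inj: "inj_on \<phi> W" by (rule is_chart_inj[OF ch])
  have inv: "inv_into W \<phi> y \<in> W \<inter> ?W'" if "y \<in> G" for y
    using that inj by (auto simp: G_def)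
  have hol\<tau>: "holo_map (*s) (*s) G \<tau>"
  proof (rule holo_map_vec)
    fix j
    have "snd X (W \<inter> ?W') (\<lambda>x. ?\<psi> x $ j)"
      by (rule holo_X_subset[OF chart_coordinate_holo[OF ch']]) auto
    from holo_in_chart[OF ch WW _ this]
    show "holo_map (*s) (*) G (\<lambda>y. \<tau> y $ j)" by (simp add: G_def \<tau>_def)
  qed
  have hol: "holo_map (*s) (*s) G \<sigma>"
    unfolding \<sigma>_def
    by (rule holo_map_mult_vec, rule holo_map_compose[OF hol\<tau> _ holo_slice[OF kN(1), where A=UNIV]]) simp
  have sl: "slice k (\<tau> y) \<in> S \<and> q (slice k (\<tau> y)) = inv_into W \<phi> y" if y: "y \<in> G" for y
  proof -
    obtain \<xi> where \<xi>: "\<xi> \<in> chart_dom k" "inv_into W \<phi> y = q \<xi>" using inv[OF y] by auto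
    then have "\<tau> y = monomials N \<xi>" by (simp add: \<tau>_def coord_q[OF kN(1)])
    then show ?thesis using slice_in_chart_dom[OF kN(1) \<xi>(1)] \<xi> chart_dom_subset[of k] by auto
  qed
  have vt: "vinv t \<in> ctorus m" by (rule ctorus_vinv[OF subspace_m t(1)])
  show thesis
  proof
    show "open G" unfolding G_def by (rule is_chart_open_image_subset[OF ch WW]) auto
    show "\<phi> (q \<zeta>) \<in> G" using \<zeta> kN by (auto simp: G_def)
    show "G \<subseteq> \<phi> ` W" by (auto simp: G_def)
    show "holo_map (*s) (*s) G \<sigma>" by (rule hol)
    show "\<sigma> y \<in> S" if "y \<in> G" for y
      unfolding \<sigma>_def using sl[OF that] S_invariant[OF _ vt] by blast
    show "q (\<sigma> y) = inv_into W \<phi> y" if "y \<in> G" for y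
      unfolding \<sigma>_def using sl[OF that] q_mult[OF vt] by simp
    have "\<tau> (\<phi> (q \<zeta>)) = monomials N \<zeta>"
      using \<zeta> kN inj by (simp add: \<tau>_def coord_q[OF kN(1)])
    then show "\<sigma> (\<phi> (q \<zeta>)) = \<zeta>" using t vinv_cancel(1)[OF t(1)] by (simp add: \<sigma>_def)
  qed
qed

section \<open>Covectors as gradients on the total space\<close>

text \<open>A function \<open>g\<close> near a point of the quotient is determined to first order by the gradient of its
pullback at any point over it. This turns covectors, which are given by their components in all
charts, into vectors of the total space.\<close>

abbreviation qgrad :: "((complex^'d) set \<Rightarrow> complex) \<Rightarrow> complex^'d \<Rightarrow> complex^'d" where
  "qgrad g \<equiv> cgrad (\<lambda>\<zeta>. g (q \<zeta>))"

text \<open>In a chart, \<open>g\<close> is the pullback of \<open>g\<close> composed with a local section, so its derivative is obtained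
from the gradient of the pullback by the derivative of a section that does not depend on \<open>g\<close>.\<close>

lemma differential_determined:
  fixes W :: "(complex^'d) set set" and \<phi> :: "(complex^'d) set \<Rightarrow> complex^'n"
  assumes ch: "is_chart X (W, \<phi>)" and \<zeta>: "\<zeta> \<in> S" "q \<zeta> \<in> W"
  shows "\<exists>D. \<forall>V g. openin (fst X) V \<longrightarrow> snd X V g \<longrightarrow> q \<zeta> \<in> V \<longrightarrow>
     ((g \<circ> inv_into W \<phi>) has_derivative (\<lambda>v. \<Sum>i\<in>UNIV. qgrad g \<zeta> $ i * D v $ i)) (at (\<phi> (q \<zeta>)))"
proof -
  obtain G \<sigma> where G: "open G" "\<phi> (q \<zeta>) \<in> G" "G \<subseteq> \<phi> ` W" "holo_map (*s) (*s) G \<sigma>"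
    "\<And>y. y \<in> G \<Longrightarrow> \<sigma> y \<in> S" "\<And>y. y \<in> G \<Longrightarrow> q (\<sigma> y) = inv_into W \<phi> y" "\<sigma> (\<phi> (q \<zeta>)) = \<zeta>"
    using local_section[OF ch \<zeta>] by metis
  have "cdiff_map_at (*s) (*s) \<sigma> (\<phi> (q \<zeta>))" using G holo_map_open_iff by blast
  then obtain D where D: "(\<sigma> has_derivative D) (at (\<phi> (q \<zeta>)))" by (auto simp: cdiff_map_at_def)
  show ?thesis
  proof (intro exI allI impI)
    fix V g assume V: "openin (fst X) V" "snd X V g" "q \<zeta> \<in> V"
    have "cdiff_map_at (*s) (*) (\<lambda>\<zeta>. g (q \<zeta>)) (\<sigma> (\<phi> (q \<zeta>)))"
      using holo_X_pullback_diff[OF V(1,2) \<zeta>(1) V(3)] G(7) by simp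
    from has_derivative_compose[OF D has_derivative_cgrad[OF this]]
    have "((\<lambda>y. g (q (\<sigma> y))) has_derivative (\<lambda>v. \<Sum>i\<in>UNIV. qgrad g \<zeta> $ i * D v $ i)) (at (\<phi> (q \<zeta>)))"
      by (simp add: G(7))
    then show "((g \<circ> inv_into W \<phi>) has_derivative (\<lambda>v. \<Sum>i\<in>UNIV. qgrad g \<zeta> $ i * D v $ i)) (at (\<phi> (q \<zeta>)))"
      by (rule has_derivative_transform_within_open[OF _ G(1,2)]) (simp add: G(6))
  qed
qed

lemma differential_eqI:
  assumes \<zeta>: "\<zeta> \<in> S" and V: "openin (fst X) V" "snd X V g" "q \<zeta> \<in> V"
    and V': "openin (fst X) V'" "snd X V' g'" "q \<zeta> \<in> V'" and eq: "qgrad g \<zeta> = qgrad g' \<zeta>"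
  shows "(differential X (q \<zeta>) g :: (_, 'n) covector) = differential X (q \<zeta>) g'"
proof (rule ext, rule prod_cases)
  fix W and \<phi> :: "(complex^'d) set \<Rightarrow> complex^'n"
  show "differential X (q \<zeta>) g (W, \<phi>) = differential X (q \<zeta>) g' (W, \<phi>)"
  proof (cases "is_chart X (W, \<phi>) \<and> q \<zeta> \<in> W")
    case True
    then have "is_chart X (W, \<phi>)" "q \<zeta> \<in> W" by auto
    from differential_determined[OF this(1) \<zeta> this(2)]
    obtain D where D: "\<forall>V g. openin (fst X) V \<longrightarrow> snd X V g \<longrightarrow> q \<zeta> \<in> V \<longrightarrow>
     ((g \<circ> inv_into W \<phi>) has_derivative (\<lambda>v. \<Sum>i\<in>UNIV. qgrad g \<zeta> $ i * D v $ i)) (at (\<phi> (q \<zeta>)))"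
      by (elim exE)
    show ?thesis
      using frechet_derivative_at[OF D[rule_format, OF V]] frechet_derivative_at[OF D[rule_format, OF V']] eq
      by (simp add: differential_def)
  qed (auto simp: differential_def)
qed

text \<open>Conversely, near \<open>\<zeta>\<close> the pullback of \<open>g\<close> is the expression of \<open>g\<close> in a monomial chart composed with
the monomials, so a single chart suffices to recover the gradient.\<close>

lemma qgrad_eqI:
  assumes \<zeta>: "\<zeta> \<in> S" and V: "openin (fst X) V" "snd X V g" "q \<zeta> \<in> V"
    and V': "openin (fst X) V'" "snd X V' g'" "q \<zeta> \<in> V'"
    and eq: "(differential X (q \<zeta>) g :: (_, 'n) covector) = differential X (q \<zeta>) g'"
  shows "qgrad g \<zeta> = qgrad g' \<zeta>"
proof -
  obtain k N where kN: "(k, N) \<in> charts" "\<zeta> \<in> chart_dom k"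
    using charts_cover[OF \<zeta>(1)] \<zeta> by (auto simp: chart_dom_def)
  let ?W = "q ` chart_dom k" and ?\<phi> = "coord k N"
  have ch: "is_chart X (?W, ?\<phi>)" by (rule is_chart_coord[OF kN(1)])
  have xW: "q \<zeta> \<in> ?W" using kN by auto
  obtain D where D: "(monomials N has_derivative D) (at \<zeta>)"
    using holo_monomials[OF kN(1)] kN(2) open_chart_dom holo_map_open_iff unfolding cdiff_map_at_def by blast
  have *: "qgrad h \<zeta> = (\<chi> i. frechet_derivative (h \<circ> inv_into ?W ?\<phi>) (at (?\<phi> (q \<zeta>))) (D (axis i 1)))"
    if U: "openin (fst X) U" "snd X U h" "q \<zeta> \<in> U" for U h
  proof -
    have UW: "openin (fst X) (U \<inter> ?W)" "snd X (U \<inter> ?W) h"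
      using U is_chart_openin[OF ch] holo_X_subset[OF U(2)] by auto
    have "holo_map (*s) (*) (?\<phi> ` (U \<inter> ?W)) (\<lambda>y. h (inv_into ?W ?\<phi> y))"
      by (rule holo_in_chart[OF ch UW(1) _ UW(2)]) auto
    moreover have "open (?\<phi> ` (U \<inter> ?W))" by (rule is_chart_open_image_subset[OF ch UW(1)]) auto
    moreover have "?\<phi> (q \<zeta>) \<in> ?\<phi> ` (U \<inter> ?W)" using U xW by auto
    ultimately have "cdiff_map_at (*s) (*) (h \<circ> inv_into ?W ?\<phi>) (?\<phi> (q \<zeta>))"
      unfolding comp_def using holo_map_open_iff by blast
    then obtain E where E: "((h \<circ> inv_into ?W ?\<phi>) has_derivative E) (at (?\<phi> (q \<zeta>)))"
      unfolding cdiff_map_at_def by blast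
    then have E': "((h \<circ> inv_into ?W ?\<phi>) has_derivative E) (at (monomials N \<zeta>))"
      using coord_q[OF kN] by simp
    have "((\<lambda>z. (h \<circ> inv_into ?W ?\<phi>) (monomials N z)) has_derivative (\<lambda>v. E (D v))) (at \<zeta>)"
      by (rule has_derivative_compose[OF D E'])
    moreover have "(h \<circ> inv_into ?W ?\<phi>) (monomials N z) = h (q z)" if "z \<in> chart_dom k" for z
      using that coord_q[OF kN(1) that] inv_into_f_f[OF is_chart_inj[OF ch], of "q z"] by simp
    ultimately have "((\<lambda>z. h (q z)) has_derivative (\<lambda>v. E (D v))) (at \<zeta>)"
      by (rule has_derivative_transform_within_open[OF _ open_chart_dom kN(2)])
    then show ?thesis
      unfolding cgrad_def using frechet_derivative_at[OF E] frechet_derivative_at by metis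
  qed
  have "frechet_derivative (g \<circ> inv_into ?W ?\<phi>) (at (?\<phi> (q \<zeta>))) = frechet_derivative (g' \<circ> inv_into ?W ?\<phi>) (at (?\<phi> (q \<zeta>)))"
    using fun_cong[OF eq, of "(?W, ?\<phi>)"] ch xW by (simp add: differential_def)
  then show ?thesis using *[OF V] *[OF V'] by simp
qed

end

lemma has_derivative_exp_line:
  "((\<lambda>s::real. a * exp (c * complex_of_real s)) has_derivative (\<lambda>h. a * c * of_real h)) (at 0)"
proof -
  have 1: "(complex_of_real has_derivative of_real) (at 0)"
    by (rule bounded_linear_imp_has_derivative[OF bounded_linear_of_real])
  have "((\<lambda>z. a * exp (c * z)) has_field_derivative a * c) (at (complex_of_real 0))"
    by (auto intro!: derivative_eq_intros)
  from has_derivative_compose[OF 1 this[unfolded has_field_derivative_def]] show ?thesis .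
qed

lemma cgrad_linear_combination:
  fixes F :: "'j::finite \<Rightarrow> complex^'k \<Rightarrow> complex"
  assumes "\<And>j. cdiff_map_at (*s) (*) (F j) p"
  shows "cgrad (\<lambda>z. \<Sum>j\<in>UNIV. c j * F j z) p = (\<chi> i. \<Sum>j\<in>UNIV. c j * cgrad (F j) p $ i)"
proof (rule cgrad_unique)
  have "((\<lambda>z. \<Sum>j\<in>UNIV. c j * F j z) has_derivative
      (\<lambda>v. \<Sum>j\<in>UNIV. c j * (\<Sum>i\<in>UNIV. cgrad (F j) p $ i * v $ i))) (at p)"
    by (intro has_derivative_sum has_derivative_mult_right has_derivative_cgrad assms)
  also have "(\<lambda>v. \<Sum>j\<in>UNIV. c j * (\<Sum>i\<in>UNIV. cgrad (F j) p $ i * v $ i)) =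
     (\<lambda>v. \<Sum>i\<in>UNIV. (\<chi> i. \<Sum>j\<in>UNIV. c j * cgrad (F j) p $ i) $ i * v $ i)"
    unfolding sum_distrib_left sum_distrib_right vec_lambda_beta
    by (subst sum.swap) (simp add: mult.assoc)
  finally show "((\<lambda>z. \<Sum>j\<in>UNIV. c j * F j z) has_derivative
      (\<lambda>v. \<Sum>i\<in>UNIV. (\<chi> i. \<Sum>j\<in>UNIV. c j * cgrad (F j) p $ i) $ i * v $ i)) (at p)" .
qed

text \<open>The factor of the \<open>j\<close>-th monomial other than \<open>\<zeta> $ k j\<close>, hence its partial derivative in
direction \<open>k j\<close>.\<close>

definition cofactor_monomial :: "('n \<Rightarrow> 'd) \<Rightarrow> ('d \<Rightarrow> 'n \<Rightarrow> int) \<Rightarrow> complex^'d \<Rightarrow> 'n \<Rightarrow> complex" where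
  "cofactor_monomial k N \<zeta> j = (\<Prod>i\<in>-range k. \<zeta> $ i powi N i j)"

lemma has_derivative_monomial:
  fixes N :: "'d::finite \<Rightarrow> 'n::finite \<Rightarrow> int"
  assumes cd: "chart_datum m k N" and nz: "\<And>i. i \<notin> range k \<Longrightarrow> \<zeta> $ i \<noteq> 0"
  shows "((\<lambda>z. monomials N z $ j) has_derivative
     (\<lambda>v. cofactor_monomial k N \<zeta> j * (v $ k j + \<zeta> $ k j * (\<Sum>i\<in>-range k. of_int (N i j) * v $ i / \<zeta> $ i)))) (at \<zeta>)"
proof -
  have nth: "((\<lambda>z::complex^'d. z $ i) has_derivative (\<lambda>v. v $ i)) (at \<zeta>)" for i
    by (rule bounded_linear_imp_has_derivative[OF bounded_linear_vec_nth])
  have cof: "((\<lambda>z. \<Prod>i\<in>-range k. z $ i powi N i j) has_derivative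
     (\<lambda>v. \<Sum>i\<in>-range k. v $ i * (of_int (N i j) * \<zeta> $ i powi (N i j - 1)) *
        (\<Prod>l\<in>-range k - {i}. \<zeta> $ l powi N l j))) (at \<zeta>)"
    by (intro has_derivative_prod has_derivative_power_int nth) (use nz in auto)
  have eq: "v $ i * (of_int (N i j) * \<zeta> $ i powi (N i j - 1)) * (\<Prod>l\<in>-range k - {i}. \<zeta> $ l powi N l j) =
      cofactor_monomial k N \<zeta> j * (of_int (N i j) * v $ i / \<zeta> $ i)" if "i \<in> - range k" for i and v :: "complex^'d"
  proof -
    have "cofactor_monomial k N \<zeta> j = \<zeta> $ i powi N i j * (\<Prod>l\<in>-range k - {i}. \<zeta> $ l powi N l j)"
      unfolding cofactor_monomial_def using that by (subst prod.remove[of _ i]) auto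
    then show ?thesis using nz[of i] that by (simp add: power_int_diff)
  qed
  have "(\<lambda>v. \<Sum>i\<in>-range k. v $ i * (of_int (N i j) * \<zeta> $ i powi (N i j - 1)) *
        (\<Prod>l\<in>-range k - {i}. \<zeta> $ l powi N l j)) =
      (\<lambda>v. cofactor_monomial k N \<zeta> j * (\<Sum>i\<in>-range k. of_int (N i j) * v $ i / \<zeta> $ i))"
    unfolding sum_distrib_left using eq by (intro ext sum.cong refl) blast
  with cof have cof': "((\<lambda>z. \<Prod>i\<in>-range k. z $ i powi N i j) has_derivative
     (\<lambda>v. cofactor_monomial k N \<zeta> j * (\<Sum>i\<in>-range k. of_int (N i j) * v $ i / \<zeta> $ i))) (at \<zeta>)"
    by simp
  show ?thesis
    unfolding monomials_split[OF cd]
    by (rule has_derivative_eq_rhs[OF has_derivative_mult[OF nth cof']])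
       (auto simp: cofactor_monomial_def algebra_simps)
qed

context torus_quotient
begin

text \<open>The pairs \<open>(\<zeta>, \<eta>)\<close> for which \<open>\<eta>\<close> vanishes on the tangent space of the orbit of \<open>\<zeta>\<close>, up to a
factor \<open>2\<pi>\<i>\<close> spanned by the vectors with entries \<open>\<zeta>\<^sub>i v\<^sub>i\<close>, \<open>v \<in> m\<close>; at the same time the zero
level of the complex moment map.\<close>

definition P :: "((complex^'d) \<times> (complex^'d)) set" where
  "P = {(\<zeta>, \<eta>). \<zeta> \<in> S \<and> (\<forall>v\<in>m. (\<Sum>i\<in>UNIV. \<zeta> $ i * \<eta> $ i * of_real (v $ i)) = 0)}"

text \<open>The covector whose pullback to \<open>\<zeta>\<close> is \<open>\<eta>\<close>; by \<open>covec_qgrad\<close> the choice of \<open>g\<close> does not matter.\<close>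

definition covec :: "complex^'d \<Rightarrow> complex^'d \<Rightarrow> ((complex^'d) set, 'n) covector" where
  "covec \<zeta> \<eta> = differential X (q \<zeta>)
     (SOME g. \<exists>V. openin (fst X) V \<and> q \<zeta> \<in> V \<and> snd X V g \<and> qgrad g \<zeta> = \<eta>)"

definition psi :: "(complex^'d) \<times> (complex^'d) \<Rightarrow> (complex^'d) set \<times> ((complex^'d) set, 'n) covector" where
  "psi p = (q (fst p), covec (fst p) (snd p))"

lemma covec_qgrad:
  assumes "\<zeta> \<in> S" "openin (fst X) V" "snd X V g" "q \<zeta> \<in> V"
  shows "covec \<zeta> (qgrad g \<zeta>) = differential X (q \<zeta>) g"
proof -
  let ?Q = "\<lambda>h. \<exists>V. openin (fst X) V \<and> q \<zeta> \<in> V \<and> snd X V h \<and> qgrad h \<zeta> = qgrad g \<zeta>"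
  have "?Q (SOME h. ?Q h)" by (rule someI[of ?Q g]) (use assms in auto)
  then show ?thesis unfolding covec_def using differential_eqI[OF assms(1)] assms by blast
qed

lemma qgrad_mult:
  assumes \<zeta>: "\<zeta> \<in> S" and V: "openin (fst X) V" "snd X V g" "q \<zeta> \<in> V" and t: "t \<in> ctorus m"
  shows "qgrad g (\<zeta> * t) = qgrad g \<zeta> * vinv t"
proof -
  have "cdiff_map_at (*s) (*) (\<lambda>\<zeta>. g (q \<zeta>)) (\<zeta> * t)"
    by (rule holo_X_pullback_diff[OF V(1,2)]) (use V \<zeta> t q_mult S_invariant in auto)
  moreover have "((\<lambda>z. z * t) has_derivative (\<lambda>v. v * t)) (at \<zeta>)"
    by (rule has_derivative_vecI)
       (auto intro!: has_derivative_mult_left bounded_linear_imp_has_derivative[OF bounded_linear_vec_nth])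
  ultimately have "((\<lambda>z. g (q (z * t))) has_derivative (\<lambda>v. \<Sum>i\<in>UNIV. qgrad g (\<zeta> * t) $ i * (v * t) $ i)) (at \<zeta>)"
    using has_derivative_compose has_derivative_cgrad by blast
  then have "((\<lambda>z. g (q z)) has_derivative (\<lambda>v. \<Sum>i\<in>UNIV. (qgrad g (\<zeta> * t) * t) $ i * v $ i)) (at \<zeta>)"
    by (simp add: q_mult[OF t] mult_ac)
  then have "qgrad g \<zeta> = qgrad g (\<zeta> * t) * t" by (rule cgrad_unique)
  then show ?thesis using vinv_cancel(1)[OF t] by simp
qed

text \<open>The pullback of \<open>g\<close> is constant along the curves \<open>s \<mapsto> \<zeta> exp (2\<pi>\<i> s v)\<close>, so its derivative at
\<open>s = 0\<close> vanishes.\<close>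

lemma qgrad_in_P:
  assumes \<zeta>: "\<zeta> \<in> S" and V: "openin (fst X) V" "snd X V g" "q \<zeta> \<in> V"
  shows "(\<zeta>, qgrad g \<zeta>) \<in> P"
proof -
  have "(\<Sum>i\<in>UNIV. \<zeta> $ i * qgrad g \<zeta> $ i * of_real (v $ i)) = 0" if v: "v \<in> m" for v
  proof -
    define t where "t s = (\<chi> i. exp (2 * pi * \<i> * complex_of_real (s * v $ i)))" for s
    define D where "D h = (\<chi> i. \<zeta> $ i * (2 * pi * \<i> * complex_of_real (h * v $ i)))" for h
    have t: "t s \<in> ctorus m" for s
    proof -
      have "s *\<^sub>R v \<in> m" "0 \<in> m" using v subspace_m subspace_scale subspace_0 by blast+
      then show ?thesis unfolding t_def ctorus_def
        by (intro CollectI exI[of _ "s *\<^sub>R v"] exI[of _ 0]) (simp add: vec_eq_iff Complex_eq)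
    qed
    have t0: "\<zeta> * t 0 = \<zeta>" by (simp add: t_def vec_eq_iff)
    have "((\<lambda>s. \<zeta> * t s) has_derivative D) (at 0)"
    proof (rule has_derivative_vecI)
      fix i
      show "((\<lambda>s. (\<zeta> * t s) $ i) has_derivative (\<lambda>h. D h $ i)) (at 0)"
        using has_derivative_exp_line[of "\<zeta> $ i" "2 * pi * \<i> * complex_of_real (v $ i)"]
        by (simp add: t_def D_def mult_ac)
    qed
    moreover have "cdiff_map_at (*s) (*) (\<lambda>\<zeta>. g (q \<zeta>)) (\<zeta> * t 0)"
      using holo_X_pullback_diff[OF V(1,2) \<zeta> V(3)] by (simp add: t0)
    ultimately have "((\<lambda>s. g (q (\<zeta> * t s))) has_derivative (\<lambda>h. \<Sum>i\<in>UNIV. qgrad g (\<zeta> * t 0) $ i * D h $ i)) (at 0)"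
      using has_derivative_compose has_derivative_cgrad by blast
    then have "((\<lambda>s. g (q \<zeta>)) has_derivative (\<lambda>h. \<Sum>i\<in>UNIV. qgrad g \<zeta> $ i * D h $ i)) (at 0)"
      by (simp add: q_mult[OF t] t0)
    then have "(\<lambda>h. \<Sum>i\<in>UNIV. qgrad g \<zeta> $ i * D h $ i) = (\<lambda>_. 0)"
      using has_derivative_unique has_derivative_const by blast
    from fun_cong[OF this, of 1]
    have "2 * pi * \<i> * (\<Sum>i\<in>UNIV. \<zeta> $ i * qgrad g \<zeta> $ i * of_real (v $ i)) = 0"
      by (simp add: D_def sum_distrib_left mult_ac)
    then show ?thesis by simp
  qed
  then show ?thesis using \<zeta> by (auto simp: P_def)
qed

lemma chart_linear_holo:
  assumes ch: "is_chart X (W, \<phi> :: _ \<Rightarrow> complex^'n)"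
  shows "snd X W (\<lambda>x. \<Sum>j\<in>UNIV. c $ j * \<phi> x $ j)"
  by (rule chart_function_holo[OF ch, of "\<lambda>y. \<Sum>j\<in>UNIV. c $ j * y $ j"], rule holo_mapI[OF _ is_chart_open_image[OF ch]])
     (intro cdiff_map_at_sum cdiff_map_at_mult cdiff_map_at_nth cdiff_map_at_const; simp)

text \<open>Both \<open>\<eta>\<close> and the gradient on the left annihilate the orbit directions, and these together with the axes \<open>k j\<close> span the total space; the coefficients \<open>c\<close> are fixed by comparing the entries
\<open>k j\<close>.\<close>

lemma qgrad_coord:
  assumes kN: "(k, N) \<in> charts" and p: "(\<zeta>, \<eta>) \<in> P" and \<zeta>: "\<zeta> \<in> chart_dom k"
    and c: "\<And>j. c $ j * cofactor_monomial k N \<zeta> j = \<eta> $ k j"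
  shows "qgrad (\<lambda>x. \<Sum>j\<in>UNIV. c $ j * coord k N x $ j) \<zeta> = \<eta>"
proof (rule cgrad_unique)
  have cd: "chart_datum m k N" by (rule charts_datum[OF kN])
  have k: "inj k" "m = {v. \<forall>j. (\<Sum>i\<in>UNIV. of_int (N i j) * v $ i) = 0}"
    using cd by (auto simp: chart_datum_def)
  have nz: "\<zeta> $ i \<noteq> 0" if "i \<notin> range k" for i using \<zeta> that by (auto simp: chart_dom_def)
  let ?K = "range k"
  have rel: "\<zeta> $ i * \<eta> $ i = (\<Sum>j\<in>UNIV. of_int (N i j) * (\<zeta> $ k j * \<eta> $ k j))" if i: "i \<notin> ?K" for i
  proof -
    \<comment> \<open>This \<open>v\<close> is the element of \<open>m\<close> that has entry \<open>1\<close> at \<open>i\<close> and \<open>0\<close> at the other indices outside \<open>?K\<close>.\<close>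
    define v where "v = (\<chi> l. if l \<in> ?K then - of_int (N i (inv k l)) else if l = i then 1 else (0::real))"
    have vk: "v $ k j = - of_int (N i j)" for j using k(1) by (simp add: v_def)
    have "(\<Sum>l\<in>UNIV. of_int (N l j) * v $ l) = 0" for j
    proof -
      have "(\<Sum>l\<in>-?K. of_int (N l j) * v $ l) = (\<Sum>l\<in>-?K. if l = i then of_int (N i j) else 0)"
        by (intro sum.cong) (auto simp: v_def)
      also have "\<dots> = of_int (N i j)" using i by simp
      finally show ?thesis unfolding chart_datum_sum[OF cd] vk by simp
    qed
    then have "v \<in> m" using k(2) by blast
    then have "0 = (\<Sum>l\<in>UNIV. \<zeta> $ l * \<eta> $ l * of_real (v $ l))" using p by (auto simp: P_def)
    also have "\<dots> = (\<Sum>l\<in>?K. \<zeta> $ l * \<eta> $ l * of_real (v $ l)) + (\<Sum>l\<in>-?K. \<zeta> $ l * \<eta> $ l * of_real (v $ l))"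
      by (subst sum.union_disjoint[symmetric]) auto
    also have "(\<Sum>l\<in>?K. \<zeta> $ l * \<eta> $ l * of_real (v $ l)) = (\<Sum>j\<in>UNIV. \<zeta> $ k j * \<eta> $ k j * of_real (v $ k j))"
      by (simp add: sum.reindex[OF k(1)])
    also have "(\<Sum>l\<in>-?K. \<zeta> $ l * \<eta> $ l * of_real (v $ l)) = (\<Sum>l\<in>-?K. if l = i then \<zeta> $ i * \<eta> $ i else 0)"
      by (intro sum.cong) (auto simp: v_def)
    also have "\<dots> = \<zeta> $ i * \<eta> $ i" using i by simp
    finally show ?thesis by (simp add: vk sum_negf mult_ac)
  qed
  have "((\<lambda>z. \<Sum>j\<in>UNIV. c $ j * monomials N z $ j) has_derivative
     (\<lambda>v. \<Sum>j\<in>UNIV. c $ j * (cofactor_monomial k N \<zeta> j * (v $ k j + \<zeta> $ k j * (\<Sum>i\<in>-?K. of_int (N i j) * v $ i / \<zeta> $ i))))) (at \<zeta>)"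
    by (intro has_derivative_sum has_derivative_mult_right has_derivative_monomial[OF cd] nz)
  moreover have "(\<Sum>j\<in>UNIV. c $ j * (cofactor_monomial k N \<zeta> j * (v $ k j + \<zeta> $ k j * (\<Sum>i\<in>-?K. of_int (N i j) * v $ i / \<zeta> $ i))))
      = (\<Sum>i\<in>UNIV. \<eta> $ i * v $ i)" for v :: "complex^'d"
  proof -
    have "(\<Sum>j\<in>UNIV. c $ j * (cofactor_monomial k N \<zeta> j * (v $ k j + \<zeta> $ k j * (\<Sum>i\<in>-?K. of_int (N i j) * v $ i / \<zeta> $ i))))
       = (\<Sum>j\<in>UNIV. \<eta> $ k j * v $ k j) + (\<Sum>j\<in>UNIV. \<Sum>i\<in>-?K. of_int (N i j) * (\<zeta> $ k j * \<eta> $ k j) * (v $ i / \<zeta> $ i))"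
      unfolding mult.assoc[symmetric] c sum.distrib[symmetric]
      by (intro sum.cong refl) (simp add: algebra_simps sum_distrib_left)
    also have "(\<Sum>j\<in>UNIV. \<Sum>i\<in>-?K. of_int (N i j) * (\<zeta> $ k j * \<eta> $ k j) * (v $ i / \<zeta> $ i))
       = (\<Sum>i\<in>-?K. (\<Sum>j\<in>UNIV. of_int (N i j) * (\<zeta> $ k j * \<eta> $ k j)) * (v $ i / \<zeta> $ i))"
      unfolding sum_distrib_right by (rule sum.swap)
    also have "\<dots> = (\<Sum>i\<in>-?K. \<eta> $ i * v $ i)"
      by (intro sum.cong refl) (use nz in \<open>simp add: rel[symmetric]\<close>)
    also have "(\<Sum>j\<in>UNIV. \<eta> $ k j * v $ k j) = (\<Sum>i\<in>?K. \<eta> $ i * v $ i)"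
      by (simp add: sum.reindex[OF k(1)])
    also have "\<dots> + (\<Sum>i\<in>-?K. \<eta> $ i * v $ i) = (\<Sum>i\<in>UNIV. \<eta> $ i * v $ i)"
      by (subst sum.union_disjoint[symmetric]) auto
    finally show ?thesis .
  qed
  ultimately have "((\<lambda>z. \<Sum>j\<in>UNIV. c $ j * monomials N z $ j) has_derivative (\<lambda>v. \<Sum>i\<in>UNIV. \<eta> $ i * v $ i)) (at \<zeta>)"
    by simp
  then show "((\<lambda>z. \<Sum>j\<in>UNIV. c $ j * coord k N (q z) $ j) has_derivative (\<lambda>v. \<Sum>i\<in>UNIV. \<eta> $ i * v $ i)) (at \<zeta>)"
    by (rule has_derivative_transform_within_open[OF _ open_chart_dom \<zeta>]) (simp add: coord_q[OF kN])
qed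

text \<open>The coordinates of the covector \<open>covec \<zeta> \<eta>\<close> in the trivialisation given by a monomial chart, by
the previous lemma. In this form they are visibly holomorphic in \<open>(\<zeta>, \<eta>)\<close>.\<close>

definition fibre_coord :: "('n \<Rightarrow> 'd) \<Rightarrow> ('d \<Rightarrow> 'n \<Rightarrow> int) \<Rightarrow> (complex^'d) \<times> (complex^'d) \<Rightarrow> (complex^'n) \<times> (complex^'n)" where
  "fibre_coord k N p = (monomials N (fst p), \<chi> j. snd p $ k j * (\<Prod>i\<in>-range k. fst p $ i powi (- N i j)))"

lemma triv_fibre_coord:
  assumes kN: "(k, N) \<in> charts" and p: "p \<in> P" and d: "fst p \<in> chart_dom k"
  shows "fst (fibre_coord k N p) \<in> coord k N ` q ` chart_dom k"
    "triv X (q ` chart_dom k, coord k N) (fibre_coord k N p) = psi p"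
    "\<exists>V g. openin (fst X) V \<and> q (fst p) \<in> V \<and> snd X V g \<and> qgrad g (fst p) = snd p"
proof -
  have ch: "is_chart X (q ` chart_dom k, coord k N)" by (rule is_chart_coord[OF kN])
  let ?c = "snd (fibre_coord k N p)" and ?g = "\<lambda>x. \<Sum>j\<in>UNIV. snd (fibre_coord k N p) $ j * coord k N x $ j"
  have y: "fst (fibre_coord k N p) = coord k N (q (fst p))"
    using coord_q[OF kN d] by (simp add: fibre_coord_def)
  then show "fst (fibre_coord k N p) \<in> coord k N ` q ` chart_dom k" using d by auto
  have inv: "inv_into (q ` chart_dom k) (coord k N) (fst (fibre_coord k N p)) = q (fst p)"
    unfolding y using is_chart_inj[OF ch] d by simp
  have *: "?c $ j * cofactor_monomial k N (fst p) j = snd p $ k j" for j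
  proof -
    have "(\<Prod>i\<in>-range k. fst p $ i powi (- N i j)) * cofactor_monomial k N (fst p) j = 1"
      unfolding cofactor_monomial_def prod.distrib[symmetric]
      by (intro prod.neutral ballI) (use d in \<open>auto simp: chart_dom_def power_int_minus\<close>)
    then show ?thesis by (simp add: fibre_coord_def mult.assoc)
  qed
  have g: "qgrad ?g (fst p) = snd p"
    by (rule qgrad_coord[OF kN _ d *]) (use p in simp)
  have V: "openin (fst X) (q ` chart_dom k)" "snd X (q ` chart_dom k) ?g" "q (fst p) \<in> q ` chart_dom k"
    using is_chart_openin[OF ch] chart_linear_holo[OF ch] d by auto
  then show "\<exists>V g. openin (fst X) V \<and> q (fst p) \<in> V \<and> snd X V g \<and> qgrad g (fst p) = snd p"
    using g by blast
  have "fst p \<in> S" using p by (auto simp: P_def)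
  from covec_qgrad[OF this V] show "triv X (q ` chart_dom k, coord k N) (fibre_coord k N p) = psi p"
    unfolding g triv_def psi_def by (simp add: split_beta inv)
qed

lemma holo_fibre_coord:
  assumes kN: "(k, N) \<in> charts"
  shows "holo_map csc2 csc2 (chart_dom k \<times> UNIV) (fibre_coord k N)"
proof (rule holo_mapI)
  show "open (chart_dom k \<times> (UNIV :: (complex^'d) set))" by (intro open_Times open_chart_dom open_UNIV)
  fix p :: "(complex^'d) \<times> (complex^'d)" assume p: "p \<in> chart_dom k \<times> UNIV"
  then have nz: "fst p $ i \<noteq> 0" if "i \<notin> range k" for i using that by (auto simp: chart_dom_def)
  show "cdiff_map_at csc2 csc2 (fibre_coord k N) p"
    unfolding fibre_coord_def
  proof (rule cdiff_map_at_Pair)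
    show "cdiff_map_at csc2 (*s) (\<lambda>p. monomials N (fst p)) p"
      by (rule cdiff_map_at_compose[OF cdiff_map_at_fst cdiff_map_at_monomials[OF charts_datum[OF kN]]]) (rule nz)
    show "cdiff_map_at csc2 (*s) (\<lambda>p. \<chi> j. snd p $ k j * (\<Prod>i\<in>-range k. fst p $ i powi (- N i j))) p"
      by (rule cdiff_map_at_vec, unfold vec_lambda_beta,
          intro cdiff_map_at_mult cdiff_map_at_prod cdiff_map_at_powi cdiff_map_at_fst_nth cdiff_map_at_snd_nth)
         (use nz in auto)
  qed
qed

lemma P_qgrad:
  assumes "(\<zeta>, \<eta>) \<in> P"
  obtains V g where "openin (fst X) V" "snd X V g" "q \<zeta> \<in> V" "qgrad g \<zeta> = \<eta>"
proof -
  have "\<zeta> \<in> S" using assms by (auto simp: P_def)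
  then obtain k N where kN: "(k, N) \<in> charts" "\<zeta> \<in> chart_dom k"
    using charts_cover[OF \<open>\<zeta> \<in> S\<close>] by (auto simp: chart_dom_def)
  from triv_fibre_coord(3)[OF kN(1) assms] kN(2) show thesis using that by auto
qed

lemma psi_image: "psi ` P = cotangent_points X"
proof (intro equalityI subsetI)
  fix x :: "(complex^'d) set \<times> ((complex^'d) set, 'n) covector" assume "x \<in> psi ` P"
  then obtain \<zeta> \<eta> where p: "(\<zeta>, \<eta>) \<in> P" "x = psi (\<zeta>, \<eta>)" by auto
  obtain V g where g: "openin (fst X) V" "snd X V g" "q \<zeta> \<in> V" "qgrad g \<zeta> = \<eta>" using P_qgrad[OF p(1)] .
  have "\<zeta> \<in> S" using p by (auto simp: P_def)
  from covec_qgrad[OF this g(1-3)] g show "x \<in> cotangent_points X"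
    using p by (auto simp: psi_def cotangent_points_def)
next
  fix x :: "(complex^'d) set \<times> ((complex^'d) set, 'n) covector" assume "x \<in> cotangent_points X"
  then obtain V g where g: "openin (fst X) V" "fst x \<in> V" "snd X V g" "snd x = differential X (fst x) g"
    by (auto simp: cotangent_points_def)
  then obtain \<zeta> where \<zeta>: "\<zeta> \<in> S" "fst x = q \<zeta>" using q_in_open by blast
  have "psi (\<zeta>, qgrad g \<zeta>) = x"
    using covec_qgrad[OF \<zeta>(1) g(1,3)] g \<zeta> by (simp add: psi_def prod_eq_iff)
  moreover have "(\<zeta>, qgrad g \<zeta>) \<in> P" using qgrad_in_P[OF \<zeta>(1) g(1,3)] g \<zeta> by simp
  ultimately show "x \<in> psi ` P" by force
qed

text \<open>Multiplying \<open>\<zeta>\<close> by \<open>t\<close> divides the gradient of an invariant function by \<open>t\<close>, and over a fixed \<open>\<zeta>\<close>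
covectors and gradients determine each other.\<close>

lemma psi_eq_iff:
  assumes p: "p \<in> P" "p' \<in> P"
  shows "psi p = psi p' \<longleftrightarrow> (\<exists>t\<in>ctorus m. fst p' = fst p * t \<and> snd p' = snd p * vinv t)"
proof -
  obtain \<zeta> \<eta> \<zeta>' \<eta>' where e: "p = (\<zeta>, \<eta>)" "p' = (\<zeta>', \<eta>')" by fastforce
  have S: "\<zeta> \<in> S" "\<zeta>' \<in> S" using p e by (auto simp: P_def)
  obtain V g where g: "openin (fst X) V" "snd X V g" "q \<zeta> \<in> V" "qgrad g \<zeta> = \<eta>" using P_qgrad p e by blast
  obtain V' g' where g': "openin (fst X) V'" "snd X V' g'" "q \<zeta>' \<in> V'" "qgrad g' \<zeta>' = \<eta>'" using P_qgrad p e by blast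
  have 1: "psi p = (q \<zeta>, differential X (q \<zeta>) g)" using covec_qgrad[OF S(1) g(1-3)] g by (simp add: psi_def e)
  have 2: "psi p' = (q \<zeta>', differential X (q \<zeta>') g')" using covec_qgrad[OF S(2) g'(1-3)] g' by (simp add: psi_def e)
  show ?thesis
  proof
    assume eq: "psi p = psi p'"
    then have qq: "q \<zeta> = q \<zeta>'" using 1 2 by simp
    then obtain t where t: "t \<in> ctorus m" "\<zeta>' = \<zeta> * t" using q_eq_iff by blast
    have "qgrad g \<zeta>' = qgrad g' \<zeta>'"
      by (rule qgrad_eqI[OF S(2) g(1,2) _ g'(1-3)]) (use g qq eq 1 2 in auto)
    then have "\<eta>' = \<eta> * vinv t" using qgrad_mult[OF S(1) g(1-3) t(1)] g g' t by simp
    then show "\<exists>t\<in>ctorus m. fst p' = fst p * t \<and> snd p' = snd p * vinv t" using t e by auto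
  next
    assume "\<exists>t\<in>ctorus m. fst p' = fst p * t \<and> snd p' = snd p * vinv t"
    then obtain t where t: "t \<in> ctorus m" "\<zeta>' = \<zeta> * t" "\<eta>' = \<eta> * vinv t" using e by auto
    have qq: "q \<zeta>' = q \<zeta>" using t q_mult by simp
    have "qgrad g \<zeta>' = qgrad g' \<zeta>'" using qgrad_mult[OF S(1) g(1-3) t(1)] g g' t by simp
    then have "(differential X (q \<zeta>') g :: (_, 'n) covector) = differential X (q \<zeta>') g'"
      by (intro differential_eqI[OF S(2) g(1,2) _ g'(1-3)]) (use g qq in auto)
    then show "psi p = psi p'" using 1 2 qq by simp
  qed
qed

text \<open>The trivialisation of the cotangent bundle over an arbitrary chart lifts locally to a
holomorphic map into \<open>P\<close>: follow a local section and take the gradient there. It is holomorphic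
because gradients of holomorphic functions are.\<close>

lemma local_lift:
  fixes \<phi> :: "(complex^'d) set \<Rightarrow> complex^'n"
  assumes ch: "is_chart X (W, \<phi>)" and y: "fst p0 \<in> \<phi> ` W"
  shows "\<exists>G T. open G \<and> p0 \<in> G \<and> holo_map csc2 csc2 G T \<and>
     (\<forall>p\<in>G. fst p \<in> \<phi> ` W \<and> T p \<in> P \<and> psi (T p) = triv X (W, \<phi>) p)"
proof -
  obtain x0 where x0: "x0 \<in> W" "fst p0 = \<phi> x0" using y by auto
  obtain \<zeta>0 where \<zeta>0: "\<zeta>0 \<in> S" "x0 = q \<zeta>0" using q_in_open[OF is_chart_openin[OF ch] x0(1)] by blast
  obtain G \<sigma> where G: "open G" "\<phi> (q \<zeta>0) \<in> G" "G \<subseteq> \<phi> ` W" "holo_map (*s) (*s) G \<sigma>"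
    "\<And>y. y \<in> G \<Longrightarrow> \<sigma> y \<in> S" "\<And>y. y \<in> G \<Longrightarrow> q (\<sigma> y) = inv_into W \<phi> y"
    using local_section[OF ch \<zeta>0(1)] x0 \<zeta>0 by metis
  let ?h = "\<lambda>j x. \<phi> x $ j"
  define T where "T p = (\<sigma> (fst p), \<chi> i. \<Sum>j\<in>UNIV. snd p $ j * qgrad (?h j) (\<sigma> (fst p)) $ i)" for p
  have h: "snd X W (?h j)" for j by (rule chart_coordinate_holo[OF ch])
  have W: "openin (fst X) W" by (rule is_chart_openin[OF ch])
  have \<sigma>W: "q (\<sigma> y) \<in> W" if "y \<in> G" for y using that G(3,6) by (auto intro: inv_into_into)
  have opW: "open {\<zeta>\<in>S. q \<zeta> \<in> W}" using W openin_X by auto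
  have hq: "holo_map (*s) (*s) {\<zeta>\<in>S. q \<zeta> \<in> W} (qgrad (?h j))" for j
    by (rule holo_map_cgrad[OF opW]) (use h in \<open>simp add: holo_X\<close>)
  have hol: "cdiff_map_at csc2 csc2 T p" if "p \<in> G \<times> UNIV" for p
  proof -
    have y: "fst p \<in> G" using that by auto
    have 1: "cdiff_map_at csc2 (*s) (\<lambda>p. \<sigma> (fst p)) p"
      by (rule cdiff_map_at_compose[OF cdiff_map_at_fst]) (use G y holo_map_open_iff in blast)
    have 2: "cdiff_map_at (*s) (*s) (qgrad (?h j)) (\<sigma> (fst p))" for j
      using hq opW G(5)[OF y] \<sigma>W[OF y] holo_map_open_iff by blast
    have 3: "cdiff_map_at csc2 (*) (\<lambda>p. qgrad (?h j) (\<sigma> (fst p)) $ i) p" for j i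
      by (rule cdiff_map_at_compose[OF cdiff_map_at_compose[OF 1 2] cdiff_map_at_nth])
    show ?thesis unfolding T_def
      by (intro cdiff_map_at_Pair 1, rule cdiff_map_at_vec, unfold vec_lambda_beta,
          intro cdiff_map_at_sum cdiff_map_at_mult cdiff_map_at_snd_nth 3)
  qed
  have T: "T p \<in> P \<and> psi (T p) = triv X (W, \<phi>) p" if "fst p \<in> G" for p
  proof -
    let ?\<zeta> = "\<sigma> (fst p)" and ?g = "\<lambda>x. \<Sum>j\<in>UNIV. snd p $ j * \<phi> x $ j"
    have S: "?\<zeta> \<in> S" "q ?\<zeta> \<in> W" using G(5) \<sigma>W that by auto
    have g: "snd X W ?g" by (rule chart_linear_holo[OF ch])
    have "qgrad ?g ?\<zeta> = snd (T p)"
      unfolding T_def snd_conv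
      by (rule cgrad_linear_combination) (rule holo_X_pullback_diff[OF W h S])
    moreover have "fst (T p) = ?\<zeta>" by (simp add: T_def)
    ultimately have Tp: "T p = (?\<zeta>, qgrad ?g ?\<zeta>)" by (simp add: prod_eq_iff)
    show ?thesis
      unfolding Tp using qgrad_in_P[OF S(1) W g S(2)] covec_qgrad[OF S(1) W g S(2)] G(6)[OF that]
      by (simp add: psi_def triv_def split_beta)
  qed
  have "open (G \<times> (UNIV :: (complex^'n) set))" using G(1) by (intro open_Times) auto
  then show ?thesis
    using hol T G(2,3) x0 \<zeta>0
    by (intro exI[of _ "G \<times> UNIV"] exI[of _ T]) (auto intro!: holo_mapI simp: mem_Times_iff)
qed

lemma local_coordinates:
  assumes "p \<in> P"
  shows "\<exists>W (\<phi> :: _ \<Rightarrow> complex^'n) G A. is_chart X (W, \<phi>) \<and> open G \<and> p \<in> G \<and> holo_map csc2 csc2 G A \<and>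
     (\<forall>p'\<in>G \<inter> P. fst (A p') \<in> \<phi> ` W \<and> triv X (W, \<phi>) (A p') = psi p')"
proof -
  have "fst p \<in> S" using assms by (auto simp: P_def)
  then obtain k N where kN: "(k, N) \<in> charts" "fst p \<in> chart_dom k"
    using charts_cover[OF \<open>fst p \<in> S\<close>] by (auto simp: chart_dom_def)
  show ?thesis
  proof (intro exI conjI ballI)
    show "is_chart X (q ` chart_dom k, coord k N)" by (rule is_chart_coord[OF kN(1)])
    show "open (chart_dom k \<times> (UNIV :: (complex^'d) set))" by (intro open_Times open_chart_dom open_UNIV)
    show "p \<in> chart_dom k \<times> UNIV" using kN by (simp add: mem_Times_iff)
    show "holo_map csc2 csc2 (chart_dom k \<times> UNIV) (fibre_coord k N)" by (rule holo_fibre_coord[OF kN(1)])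
    fix p' assume "p' \<in> chart_dom k \<times> UNIV \<inter> P"
    then have p': "p' \<in> P" "fst p' \<in> chart_dom k" by auto
    show "fst (fibre_coord k N p') \<in> coord k N ` q ` chart_dom k"
      "triv X (q ` chart_dom k, coord k N) (fibre_coord k N p') = psi p'"
      using triv_fibre_coord[OF kN(1) p'] by auto
  qed
qed

text \<open>Topology and complex structure of the cotangent bundle are the quotient structures of those on
\<open>P\<close>. One direction uses \<open>local_coordinates\<close>, which expresses \<open>psi\<close> through trivialisations, the other
one \<open>local_lift\<close>, which expresses every trivialisation through \<open>psi\<close>.\<close>

lemma openin_cotangent_iff:
  assumes G: "G \<subseteq> cotangent_points X"
  shows "openin (cotangent_topology X) G \<longleftrightarrow> openin (top_of_set P) {p\<in>P. psi p \<in> G}"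
proof
  assume o: "openin (cotangent_topology X) G"
  show "openin (top_of_set P) {p\<in>P. psi p \<in> G}"
  proof (rule openin_subspace_local)
    fix p assume p: "p \<in> {p\<in>P. psi p \<in> G}"
    then obtain W and \<phi> :: "_ \<Rightarrow> complex^'n" and U A where
      A: "is_chart X (W, \<phi>)" "open U" "p \<in> U" "holo_map csc2 csc2 U A"
       "\<forall>p'\<in>U \<inter> P. fst (A p') \<in> \<phi> ` W \<and> triv X (W, \<phi>) (A p') = psi p'"
      using local_coordinates by blast
    have "open (triv_preimage X (W, \<phi>) G)" using o A(1) openin_cotangent_topology by blast
    then have "open (U \<inter> A -` triv_preimage X (W, \<phi>) G)"
      using continuous_open_preimage[OF holo_map_imp_continuous_on[OF A(4)] A(2)] by blast
    then show "\<exists>U. open U \<and> p \<in> U \<and> U \<inter> P \<subseteq> {p\<in>P. psi p \<in> G}"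
      using A(3,5) p
      by (intro exI[of _ "U \<inter> A -` triv_preimage X (W, \<phi>) G"]) (auto simp: triv_preimage_def split_beta)
  qed auto
next
  assume "openin (top_of_set P) {p\<in>P. psi p \<in> G}"
  then obtain O' where O': "open O'" "{p\<in>P. psi p \<in> G} = P \<inter> O'" using openin_open by blast
  have "open (triv_preimage X (W, \<phi>) G)" if ch: "is_chart X (W, \<phi>)" for W and \<phi> :: "_ \<Rightarrow> complex^'n"
  proof (rule open_subopen[THEN iffD2], rule ballI)
    fix p0 assume p0: "p0 \<in> triv_preimage X (W, \<phi>) G"
    then have "fst p0 \<in> \<phi> ` W" by (auto simp: triv_preimage_def)
    from local_lift[OF ch this] obtain U T where
      T: "open U" "p0 \<in> U" "holo_map csc2 csc2 U T"
       "\<forall>p\<in>U. fst p \<in> \<phi> ` W \<and> T p \<in> P \<and> psi (T p) = triv X (W, \<phi>) p"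
      by blast
    have "open (U \<inter> T -` O')"
      using continuous_open_preimage[OF holo_map_imp_continuous_on[OF T(3)] T(1) O'(1)] by blast
    moreover have "p0 \<in> U \<inter> T -` O'" using T p0 O'(2) by (auto simp: triv_preimage_def)
    moreover have "U \<inter> T -` O' \<subseteq> triv_preimage X (W, \<phi>) G"
      using T(4) O'(2) by (force simp: triv_preimage_def)
    ultimately show "\<exists>T. open T \<and> p0 \<in> T \<and> T \<subseteq> triv_preimage X (W, \<phi>) G" by blast
  qed
  then show "openin (cotangent_topology X) G" using G by (auto simp: openin_cotangent_topology)
qed

lemma cotangent_holo_iff:
  "snd (cotangent_bundle X) G F \<longleftrightarrow> holo_map csc2 (*) {p\<in>P. psi p \<in> G} (\<lambda>p. F (psi p))"
proof
  assume F: "snd (cotangent_bundle X) G F"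
  show "holo_map csc2 (*) {p\<in>P. psi p \<in> G} (\<lambda>p. F (psi p))"
  proof (rule holo_map_local)
    fix p assume p: "p \<in> {p\<in>P. psi p \<in> G}"
    then obtain W and \<phi> :: "_ \<Rightarrow> complex^'n" and U A where
      A: "is_chart X (W, \<phi>)" "open U" "p \<in> U" "holo_map csc2 csc2 U A"
       "\<forall>p'\<in>U \<inter> P. fst (A p') \<in> \<phi> ` W \<and> triv X (W, \<phi>) (A p') = psi p'"
      using local_coordinates by blast
    have *: "holo_map csc2 (*) (triv_preimage X (W, \<phi>) G) (\<lambda>x. F (triv X (W, \<phi>) x))"
      using F A(1) by (simp add: cotangent_bundle_def holo_on_iff comp_def)
    have "holo_map csc2 (*) ({p\<in>P. psi p \<in> G} \<inter> U) (\<lambda>p. F (triv X (W, \<phi>) (A p)))"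
      by (rule holo_map_compose[OF holo_map_subset[OF A(4)] _ *])
         (use A(5) in \<open>auto simp: triv_preimage_def split_beta\<close>)
    then have "holo_map csc2 (*) ({p\<in>P. psi p \<in> G} \<inter> U) (\<lambda>p. F (psi p))"
      by (rule holo_map_cong_subset) (use A(5) in auto)
    then show "\<exists>U. open U \<and> p \<in> U \<and> holo_map csc2 (*) ({p\<in>P. psi p \<in> G} \<inter> U) (\<lambda>p. F (psi p))"
      using A by blast
  qed
next
  assume F: "holo_map csc2 (*) {p\<in>P. psi p \<in> G} (\<lambda>p. F (psi p))"
  have "holo_map csc2 (*) (triv_preimage X (W, \<phi>) G) (\<lambda>x. F (triv X (W, \<phi>) x))"
    if ch: "is_chart X (W, \<phi>)" for W and \<phi> :: "_ \<Rightarrow> complex^'n"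
  proof (rule holo_map_local)
    fix p0 assume p0: "p0 \<in> triv_preimage X (W, \<phi>) G"
    then have "fst p0 \<in> \<phi> ` W" by (auto simp: triv_preimage_def)
    from local_lift[OF ch this] obtain U T where
      T: "open U" "p0 \<in> U" "holo_map csc2 csc2 U T"
       "\<forall>p\<in>U. fst p \<in> \<phi> ` W \<and> T p \<in> P \<and> psi (T p) = triv X (W, \<phi>) p"
      by blast
    have "holo_map csc2 (*) (triv_preimage X (W, \<phi>) G \<inter> U) (\<lambda>p. F (psi (T p)))"
      by (rule holo_map_compose[OF holo_map_subset[OF T(3)] _ F])
         (use T(4) in \<open>auto simp: triv_preimage_def\<close>)
    then have "holo_map csc2 (*) (triv_preimage X (W, \<phi>) G \<inter> U) (\<lambda>x. F (triv X (W, \<phi>) x))"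
      by (rule holo_map_cong_subset) (use T(4) in auto)
    then show "\<exists>U. open U \<and> p0 \<in> U \<and> holo_map csc2 (*) (triv_preimage X (W, \<phi>) G \<inter> U) (\<lambda>x. F (triv X (W, \<phi>) x))"
      using T by blast
  qed
  then show "snd (cotangent_bundle X) G F"
    by (auto simp: cotangent_bundle_def holo_on_iff comp_def)
qed

lemma topspace_cotangent: "topspace (cotangent_topology X :: ((complex^'d) set \<times> ((complex^'d) set, 'n) covector) topology) = cotangent_points X"
proof
  have "{p\<in>P. psi p \<in> cotangent_points X} = P" using psi_image by blast
  then have "openin (cotangent_topology X) (cotangent_points X :: ((complex^'d) set \<times> ((complex^'d) set, 'n) covector) set)"
    using openin_cotangent_iff[OF subset_refl] by simp
  then show "cotangent_points X \<subseteq> topspace (cotangent_topology X :: ((complex^'d) set \<times> ((complex^'d) set, 'n) covector) topology)"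
    by (rule openin_subset)
  show "topspace (cotangent_topology X :: ((complex^'d) set \<times> ((complex^'d) set, 'n) covector) topology) \<subseteq> cotangent_points X"
    using openin_cotangent_topology openin_topspace by blast
qed

end

section \<open>Closed connected subgroups of the compact torus\<close>

definition texp :: "real^'d \<Rightarrow> complex^'d" where "texp v = (\<chi> i. cis (2 * pi * v $ i))"

lemma texp_add: "texp (u + v) = texp u * texp v"
  by (simp add: texp_def vec_eq_iff cis_mult algebra_simps)

lemma texp_minus: "texp (- v) = vinv (texp v)"
  by (simp add: texp_def vec_eq_iff)

lemma texp_0: "texp 0 = 1"
  by (simp add: texp_def vec_eq_iff)

lemma continuous_texp: "continuous_on A texp"
  unfolding texp_def by (intro continuous_intros)

lemma lie_iff: "v \<in> lie M \<longleftrightarrow> (\<forall>s. texp (s *\<^sub>R v) \<in> M)"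
  by (simp add: lie_def texp_def)

lemma subtorusD:
  assumes "subtorus M"
  shows "t \<in> M \<Longrightarrow> norm (t $ i) = 1" "1 \<in> M" "s \<in> M \<Longrightarrow> t \<in> M \<Longrightarrow> s * t \<in> M"
    "t \<in> M \<Longrightarrow> vinv t \<in> M" "closed M" "connected M"
  using assms by (auto simp: subtorus_def vinv_def)

lemma texp_multiple:
  assumes M: "subtorus M" and w: "texp w \<in> M"
  shows "texp (of_int k *\<^sub>R w) \<in> M"
proof -
  have nat: "texp (real n *\<^sub>R w) \<in> M" for n
  proof (induction n)
    case (Suc n)
    have "real (Suc n) *\<^sub>R w = real n *\<^sub>R w + w" by (simp add: algebra_simps)
    then show ?case using subtorusD(3)[OF M Suc w] by (simp add: texp_add)
  qed (simp add: texp_0 subtorusD(2)[OF M])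
  show ?thesis
  proof (cases "k \<ge> 0")
    case True
    then show ?thesis using nat[of "nat k"] by simp
  next
    case False
    then have "of_int k *\<^sub>R w = - (real (nat (-k)) *\<^sub>R w)" by simp
    then show ?thesis using subtorusD(4)[OF M nat] by (simp only: texp_minus)
  qed
qed

text \<open>Cartan's argument. Otherwise there are logarithms \<open>w n \<rightarrow> 0\<close> of elements of \<open>M\<close> that are nonzero
and orthogonal to the Lie algebra. If \<open>x\<close> is a limit of their directions, then every multiple
\<open>s x\<close> is a limit of integer multiples of the \<open>w n\<close>, so \<open>x\<close> belongs to the Lie algebra although
it is a unit vector orthogonal to it.\<close>

lemma small_logarithms_in_lie:
  fixes M :: "(complex^'d) set"
  assumes M: "subtorus M" and sub: "subspace (lie M)"
  shows "\<exists>e>0. \<forall>v. texp v \<in> M \<and> norm v < e \<longrightarrow> v \<in> lie M"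
proof (rule ccontr)
  assume neg: "\<not> ?thesis"
  have "\<exists>w. texp w \<in> M \<and> w \<noteq> 0 \<and> norm w < inverse (real (Suc n)) \<and> (\<forall>u\<in>lie M. orthogonal w u)" for n
  proof -
    have "inverse (real (Suc n)) > 0" by simp
    then obtain v where v: "texp v \<in> M" "norm v < inverse (real (Suc n))" "v \<notin> lie M" using neg by blast
    obtain y z where yz: "y \<in> span (lie M)" "\<And>w. w \<in> span (lie M) \<Longrightarrow> orthogonal z w" "v = y + z"
      using orthogonal_subspace_decomp_exists[of "lie M" v] by metis
    have y: "y \<in> lie M" using yz(1) sub span_eq_iff by blast
    have "texp (- y) \<in> M" using subspace_neg[OF sub y] lie_iff[of "-y" M] by (metis scaleR_one)
    then have "texp z \<in> M" using subtorusD(3)[OF M v(1), of "texp (-y)"] yz(3) by (simp flip: texp_add)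
    moreover have "z \<noteq> 0" using yz(3) y v(3) by auto
    moreover have "norm z \<le> norm v"
    proof -
      have "orthogonal y z" using yz(1,2) orthogonal_commute by blast
      then have "(norm v)\<^sup>2 = (norm y)\<^sup>2 + (norm z)\<^sup>2" using yz(3) norm_add_Pythagorean by blast
      then show ?thesis using norm_ge_zero by (metis le_add_same_cancel2 power2_le_imp_le zero_le_power2)
    qed
    moreover have "\<forall>u\<in>lie M. orthogonal z u" using yz(2) span_base by blast
    ultimately show ?thesis using v(2) by (intro exI[of _ z]) auto
  qed
  then obtain w where w: "\<And>n. texp (w n) \<in> M" "\<And>n. w n \<noteq> 0" "\<And>n. norm (w n) < inverse (real (Suc n))"
    "\<And>n u. u \<in> lie M \<Longrightarrow> orthogonal (w n) u" by metis
  have w0: "(\<lambda>n. norm (w n)) \<longlonglongrightarrow> 0"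
  proof (rule real_tendsto_sandwich[OF _ _ tendsto_const LIMSEQ_inverse_real_of_nat])
    show "\<forall>\<^sub>F n in sequentially. norm (w n) \<le> inverse (real (Suc n))"
      by (rule always_eventually, rule allI, rule less_imp_le, rule w(3))
  qed auto
  define u where "u n = (1 / norm (w n)) *\<^sub>R w n" for n
  have "u n \<in> sphere 0 1" for n using w(2) by (simp add: u_def)
  then obtain x r where x: "x \<in> sphere 0 1" "strict_mono r" "(u \<circ> r) \<longlonglongrightarrow> x"
    using compact_sphere[of 0 1] unfolding compact_def by metis
  have "texp (s *\<^sub>R x) \<in> M" for s
  proof -
    define k where "k n = \<lfloor>s / norm (w (r n))\<rfloor>" for n
    have lim: "(\<lambda>n. of_int (k n) * norm (w (r n))) \<longlonglongrightarrow> s"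
    proof (rule LIM_zero_cancel, rule tendsto_rabs_zero_cancel, rule real_tendsto_sandwich[OF _ _ tendsto_const])
      show "\<forall>\<^sub>F n in sequentially. \<bar>of_int (k n) * norm (w (r n)) - s\<bar> \<le> norm (w (r n))"
      proof (rule always_eventually, rule allI)
        fix n
        have pos: "norm (w (r n)) > 0" using w(2) by simp
        have "of_int (k n) \<le> s / norm (w (r n))" "s / norm (w (r n)) \<le> of_int (k n) + 1"
          unfolding k_def by linarith+
        then have "of_int (k n) * norm (w (r n)) \<le> s" "s \<le> (of_int (k n) + 1) * norm (w (r n))"
          using pos by (simp_all add: field_simps)
        then show "\<bar>of_int (k n) * norm (w (r n)) - s\<bar> \<le> norm (w (r n))" by (simp add: algebra_simps)
      qed
      show "(\<lambda>n. norm (w (r n))) \<longlonglongrightarrow> 0" using LIMSEQ_subseq_LIMSEQ[OF w0 x(2)] by (simp add: comp_def)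
    qed auto
    have "(\<lambda>n. (of_int (k n) * norm (w (r n))) *\<^sub>R u (r n)) \<longlonglongrightarrow> s *\<^sub>R x"
      using tendsto_scaleR[OF lim x(3)] by (simp add: comp_def)
    moreover have "(of_int (k n) * norm (w (r n))) *\<^sub>R u (r n) = of_int (k n) *\<^sub>R w (r n)" for n
      using w(2) by (simp add: u_def)
    ultimately have "(\<lambda>n. of_int (k n) *\<^sub>R w (r n)) \<longlonglongrightarrow> s *\<^sub>R x" by simp
    moreover have "isCont texp (s *\<^sub>R x)"
      using continuous_texp[of "UNIV :: (real^'d) set"] continuous_on_eq_continuous_at[OF open_UNIV] by blast
    ultimately have limt: "(\<lambda>n. texp (of_int (k n) *\<^sub>R w (r n))) \<longlonglongrightarrow> texp (s *\<^sub>R x)"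
      using isCont_tendsto_compose by blast
    show ?thesis
      by (rule closed_sequentially[OF subtorusD(5)[OF M] _ limt]) (rule texp_multiple[OF M w(1)])
  qed
  then have "x \<in> lie M" by (simp add: lie_iff)
  then have "orthogonal (u n) x" for n using w(4)[of x n] by (simp add: u_def orthogonal_def)
  then have "(\<lambda>n. (u \<circ> r) n \<bullet> x) \<longlonglongrightarrow> 0" by (simp add: orthogonal_def)
  moreover have "(\<lambda>n. (u \<circ> r) n \<bullet> x) \<longlonglongrightarrow> x \<bullet> x" by (intro tendsto_inner x(3) tendsto_const)
  ultimately have "x \<bullet> x = 0" using LIMSEQ_unique by blast
  then show False using x(1) by simp
qed

lemma texp_onto_near_one:
  assumes "e > 0"
  shows "\<exists>d>0. \<forall>t::complex^'d. (\<forall>i. norm (t $ i) = 1) \<and> norm (t - 1) < d \<longrightarrow> (\<exists>v. texp v = t \<and> norm v < e)"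
proof -
  have "isCont Ln 1" by (rule continuous_at_Ln) simp
  define e' where "e' = e * (2 * pi) / (real CARD('d))"
  have e': "e' > 0" using assms by (simp add: e'_def)
  then obtain d where d: "d > 0" "\<And>x. dist x 1 < d \<Longrightarrow> dist (Ln x) (Ln 1) < e'"
    using \<open>isCont Ln 1\<close> unfolding continuous_at_eps_delta by (metis dist_norm)
  show ?thesis
  proof (intro exI[of _ d] conjI allI impI d(1), elim conjE)
    fix t :: "complex^'d" assume n1: "\<forall>i. norm (t $ i) = 1" and nd: "norm (t - 1) < d"
    define v where "v = (\<chi> i. Im (Ln (t $ i)) / (2 * pi))"
    have t0: "t $ i \<noteq> 0" for i using n1 by (metis norm_zero zero_neq_one)
    have "cis (2 * pi * v $ i) = t $ i" for i
    proof -
      have "Re (Ln (t $ i)) = 0" using n1 t0 by (simp add: Re_Ln)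
      then have "Ln (t $ i) = \<i> * Im (Ln (t $ i))" by (simp add: complex_eq_iff)
      then have "exp (\<i> * Im (Ln (t $ i))) = t $ i" using exp_Ln[OF t0] by metis
      then show ?thesis by (simp add: v_def cis_conv_exp)
    qed
    then have "texp v = t" by (simp add: texp_def vec_eq_iff)
    moreover have "norm v < e"
    proof -
      have "\<bar>v $ i\<bar> < e / real CARD('d)" for i
      proof -
        have "dist (t $ i) 1 \<le> norm (t - 1)"
          using Finite_Cartesian_Product.norm_nth_le[of "t - 1" i] by (simp add: dist_norm)
        then have "norm (Ln (t $ i)) < e'" using d(2)[of "t $ i"] nd by simp
        then have "\<bar>Im (Ln (t $ i))\<bar> < e'" using abs_Im_le_cmod le_less_trans by blast
        then show ?thesis by (simp add: v_def e'_def field_simps)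
      qed
      then have "(\<Sum>i\<in>UNIV. \<bar>v $ i\<bar>) < (\<Sum>i\<in>(UNIV::'d set). e / real CARD('d))"
        by (intro sum_strict_mono) auto
      then show ?thesis using norm_le_l1_cart[of v] by simp
    qed
    ultimately show "\<exists>v. texp v = t \<and> norm v < e" by blast
  qed
qed

text \<open>By the two preceding lemmas the image of the Lie algebra contains all elements of \<open>M\<close> near \<open>1\<close>.
Translating, it is open and closed in \<open>M\<close>.\<close>

lemma subtorus_eq_texp_lie:
  assumes M: "subtorus M" and sub: "subspace (lie M)"
  shows "M = texp ` lie M"
proof -
  let ?H = "texp ` lie M"
  have HM: "?H \<subseteq> M" by (auto simp: lie_iff dest!: spec[of _ 1])
  obtain e where e: "e > 0" "\<And>v. texp v \<in> M \<Longrightarrow> norm v < e \<Longrightarrow> v \<in> lie M"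
    using small_logarithms_in_lie[OF M sub] by auto
  obtain d where d: "d > 0" "\<And>t::complex^'a. (\<forall>i. norm (t $ i) = 1) \<Longrightarrow> norm (t - 1) < d \<Longrightarrow> (\<exists>v. texp v = t \<and> norm v < e)"
    using texp_onto_near_one[OF e(1), where 'd='a] by auto
  have near: "s \<in> ?H \<longleftrightarrow> t \<in> ?H" if st: "s \<in> M" "t \<in> M" "dist s t < d" for s t
  proof -
    have t1: "norm (t $ i) = 1" for i using subtorusD(1)[OF M st(2)] .
    then have t0: "t $ i \<noteq> 0" for i by (metis norm_zero zero_neq_one)
    let ?x = "s * vinv t"
    have xM: "?x \<in> M" using st subtorusD(3,4)[OF M] by blast
    have "(?x - 1) $ i = (s - t) $ i * inverse (t $ i)" for i using t0[of i] by (simp add: field_simps)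
    then have "norm ((?x - 1) $ i) = norm ((s - t) $ i)" for i
      using t1[of i] by (simp add: norm_mult norm_inverse)
    then have "norm (?x - 1) = norm (s - t)" by (simp add: norm_vec_def)
    then obtain v where v: "texp v = ?x" "norm v < e"
      using d(2)[of ?x] subtorusD(1)[OF M xM] st(3) by (auto simp: dist_norm)
    then have vl: "v \<in> lie M" using e(2) xM by simp
    have s: "s = texp v * t" using t0 v by (simp add: vec_eq_iff)
    have t: "t = texp (-v) * s" unfolding s texp_minus mult.assoc[symmetric]
      by (simp add: vec_eq_iff texp_def cis_mult)
    show ?thesis
    proof
      assume "s \<in> ?H"
      then obtain u where "u \<in> lie M" "s = texp u" by blast
      then show "t \<in> ?H" using t subspace_add[OF sub subspace_neg[OF sub vl]] by (auto simp flip: texp_add)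
    next
      assume "t \<in> ?H"
      then obtain u where "u \<in> lie M" "t = texp u" by blast
      then show "s \<in> ?H" using s subspace_add[OF sub vl] by (auto simp flip: texp_add)
    qed
  qed
  have op1: "openin (top_of_set M) ?H"
  proof (rule openin_subspace_local[OF HM])
    fix t assume t: "t \<in> ?H"
    have "ball t d \<inter> M \<subseteq> ?H"
    proof
      fix s assume "s \<in> ball t d \<inter> M"
      then show "s \<in> ?H" using near[of s t] t HM by (auto simp: dist_commute)
    qed
    then show "\<exists>U. open U \<and> t \<in> U \<and> U \<inter> M \<subseteq> ?H" using d(1) by (intro exI[of _ "ball t d"]) simp
  qed
  have op2: "openin (top_of_set M) (M - ?H)"
  proof (rule openin_subspace_local)
    fix t assume t: "t \<in> M - ?H"
    have "ball t d \<inter> M \<subseteq> M - ?H"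
    proof
      fix s assume "s \<in> ball t d \<inter> M"
      then show "s \<in> M - ?H" using near[of s t] t by (auto simp: dist_commute)
    qed
    then show "\<exists>U. open U \<and> t \<in> U \<and> U \<inter> M \<subseteq> M - ?H" using d(1) by (intro exI[of _ "ball t d"]) simp
  qed auto
  have "closedin (top_of_set M) ?H" using op2 HM by (simp add: closedin_def)
  moreover have "?H \<noteq> {}" using subspace_0[OF sub] by blast
  ultimately show ?thesis using op1 subtorusD(6)[OF M] connected_clopen by metis
qed

section \<open>Regular values and unimodular charts\<close>

text \<open>The point with \<open>\<bar>z\<^sub>i\<bar>\<^sup>2 = 2 c\<^sub>i\<close> for positive and \<open>\<bar>w\<^sub>i\<bar>\<^sup>2 = - 2 c\<^sub>i\<close> for negative \<open>c\<^sub>i\<close>, all other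
coordinates being zero, lies in the fibre over \<open>(\<alpha>, 0)\<close>. The derivative of the real moment map
there, evaluated at \<open>v0\<close>, is zero, whereas surjectivity would let it take the value
\<open>v0 \<bullet> v0\<close>.\<close>

lemma regular_value_nondegenerate:
  fixes M :: "(complex^'d) set"
  assumes reg: "regular_value M \<alpha>"
    and \<alpha>: "\<alpha> = (\<lambda>v\<in>lie M. \<Sum>i\<in>UNIV. c i * v $ i)"
    and v0: "v0 \<in> lie M" "\<And>i. c i \<noteq> 0 \<Longrightarrow> v0 $ i = 0"
  shows "v0 = 0"
proof -
  define z where "z = (\<chi> i. complex_of_real (sqrt (2 * max (c i) 0)))"
  define w where "w = (\<chi> i. complex_of_real (sqrt (2 * max (- c i) 0)))"
  have zw0: "z $ i * w $ i = 0" for i by (auto simp: z_def w_def max_def)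
  have nzw: "(norm (z $ i))\<^sup>2 - (norm (w $ i))\<^sup>2 = 2 * c i" for i
    by (auto simp: z_def w_def max_def)
  have muC: "mu_C M (z, w) = zero_C M" by (simp add: mu_C_def zero_C_def zw0)
  have "1/2 * (\<Sum>i\<in>UNIV. ((norm (z $ i))\<^sup>2 - (norm (w $ i))\<^sup>2) * v $ i) = (\<Sum>i\<in>UNIV. c i * v $ i)" for v
    unfolding nzw sum_distrib_left by (intro sum.cong) auto
  then have "mu_R M (z, w) = \<alpha>" by (simp add: mu_R_def \<alpha>)
  with muC have "(z, w) \<in> mu_fibre M \<alpha>" by (simp add: mu_fibre_def)
  then have rg: "range (dmu M (z, w)) = dual_of (lie M) \<times> dual_of (lie M)"
    using reg by (auto simp: regular_value_def)
  have "restrict (\<lambda>v. v \<bullet> v0) (lie M) \<in> dual_of (lie M)"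
    unfolding dual_of_def by (intro CollectI exI[of _ "\<lambda>v. v \<bullet> v0"] conjI refl
         bounded_linear.linear[OF bounded_linear_inner_left])
  moreover have "restrict (\<lambda>v. 0) (lie M) \<in> dual_of (lie M)"
    unfolding dual_of_def by (intro CollectI exI[of _ "\<lambda>v. 0"] conjI refl linearI) auto
  ultimately have "(restrict (\<lambda>v. v \<bullet> v0) (lie M), restrict (\<lambda>v. 0) (lie M)) \<in> range (dmu M (z, w))"
    using rg by auto
  then obtain h where h: "(\<lambda>v\<in>lie M. frechet_derivative (\<lambda>q. mu_R M q v) (at (z, w)) h) = restrict (\<lambda>v. v \<bullet> v0) (lie M)"
    unfolding dmu_def by auto
  have "frechet_derivative (\<lambda>q. mu_R M q v0) (at (z, w)) h = v0 \<bullet> v0"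
    using fun_cong[OF h, of v0] v0 by simp
  moreover have "frechet_derivative (\<lambda>q. mu_R M q v0) (at (z, w)) h = 0"
  proof -
    have fz: "((\<lambda>q. fst q $ i) has_derivative (\<lambda>h. fst h $ i)) F"
      "((\<lambda>q. snd q $ i) has_derivative (\<lambda>h. snd h $ i)) F" for i and F :: "((complex^'d) \<times> (complex^'d)) filter"
      by (rule bounded_linear_imp_has_derivative,
          simp add: bounded_linear_compose[OF bounded_linear_vec_nth bounded_linear_fst]
             bounded_linear_compose[OF bounded_linear_vec_nth bounded_linear_snd])+
    have "((\<lambda>q. 1/2 * (\<Sum>i\<in>UNIV. (fst q $ i \<bullet> fst q $ i - snd q $ i \<bullet> snd q $ i) * v0 $ i)) has_derivative
        (\<lambda>h. 1/2 * (\<Sum>i\<in>UNIV. ((z $ i \<bullet> fst h $ i + fst h $ i \<bullet> z $ i) - (w $ i \<bullet> snd h $ i + snd h $ i \<bullet> w $ i)) * v0 $ i))) (at (z, w))"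
      by (intro has_derivative_mult_right has_derivative_sum has_derivative_mult_left has_derivative_diff
          has_derivative_eq_rhs[OF has_derivative_inner[OF fz(1) fz(1)]]
          has_derivative_eq_rhs[OF has_derivative_inner[OF fz(2) fz(2)]]) auto
    moreover have "(\<lambda>q. mu_R M q v0) = (\<lambda>q. 1/2 * (\<Sum>i\<in>UNIV. (fst q $ i \<bullet> fst q $ i - snd q $ i \<bullet> snd q $ i) * v0 $ i))"
      using v0(1) by (auto simp: mu_R_def split_beta dot_square_norm)
    moreover have "((z $ i \<bullet> fst h $ i + fst h $ i \<bullet> z $ i) - (w $ i \<bullet> snd h $ i + snd h $ i \<bullet> w $ i)) * v0 $ i = 0" for i h
    proof (cases "c i = 0")
      case True
      then have "z $ i = 0" "w $ i = 0" by (auto simp: z_def w_def)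
      then show ?thesis by simp
    qed (use v0(2) in simp)
    ultimately have "((\<lambda>q. mu_R M q v0) has_derivative (\<lambda>h. 0)) (at (z, w))" by simp
    from frechet_derivative_at[OF this] show ?thesis by metis
  qed
  ultimately show ?thesis by simp
qed

definition twist :: "('d \<Rightarrow> real) \<Rightarrow> (real^'d) set \<Rightarrow> (real^'d) set" where
  "twist \<epsilon> m = {v. (\<chi> i. \<epsilon> i * v $ i) \<in> m}"

lemma subspace_twist:
  assumes "subspace m" shows "subspace (twist \<epsilon> m)"
proof -
  have "linear (\<lambda>v::real^'a. \<chi> i. \<epsilon> i * v $ i)"
    by (rule linearI) (auto simp: vec_eq_iff algebra_simps)
  from linear_subspace_vimage[OF this assms] show ?thesis by (simp add: twist_def vimage_def)
qed

lemma proj_sum: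
  fixes proj :: "real^'d \<Rightarrow> real^'n"
  assumes "linear proj"
  shows "proj v = (\<Sum>i\<in>UNIV. v $ i *\<^sub>R normal proj i)"
proof -
  have "proj v = proj (\<Sum>i\<in>UNIV. v $ i *s axis i 1)" by (simp only: basis_expansion)
  also have "\<dots> = (\<Sum>i\<in>UNIV. v $ i *\<^sub>R normal proj i)"
    by (simp add: linear_sum[OF assms] linear_scale[OF assms] scalar_mult_eq_scaleR normal_def)
  finally show ?thesis .
qed

text \<open>The hypothesis on \<open>I\<close> says that the normals with index outside \<open>I\<close> are linearly independent.
They extend to a basis among all normals, which by regularity is a basis of the lattice; the
integers \<open>N\<close> are the coordinates of the normals in it, up to the signs \<open>\<epsilon>\<close>.\<close>

lemma exists_chart_datum:
  fixes proj :: "real^'d \<Rightarrow> real^'n"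
  assumes lin: "linear proj" and surj: "surj proj" and ker: "{v. proj v = 0} = m"
    and reg: "regular_normals proj" and \<epsilon>: "\<epsilon> \<in> Theta"
    and I: "\<And>v. v \<in> m \<Longrightarrow> (\<And>i. i \<in> I \<Longrightarrow> v $ i = 0) \<Longrightarrow> v = 0"
  shows "\<exists>(k :: 'n \<Rightarrow> 'd) N. chart_datum (twist \<epsilon> m) k N \<and> (\<forall>i. i \<notin> range k \<longrightarrow> i \<in> I)"
proof -
  let ?u = "normal proj"
  have free: "f i = 0" if f: "(\<Sum>i\<in>-I. f i *\<^sub>R ?u i) = 0" and i: "i \<in> -I" for f i
  proof -
    define v where "v = (\<chi> i. if i \<in> I then 0 else f i)"
    have "proj v = (\<Sum>i\<in>I. v $ i *\<^sub>R ?u i) + (\<Sum>i\<in>-I. v $ i *\<^sub>R ?u i)"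
      using proj_sum[OF lin, of v] sum.union_disjoint[of I "-I" "\<lambda>i. v $ i *\<^sub>R ?u i"] by simp
    also have "\<dots> = 0" using f by (simp add: v_def)
    finally have "v \<in> m" using ker by blast
    then have "v = 0" by (rule I) (simp add: v_def)
    then have "v $ i = 0" by simp
    then show ?thesis using i by (simp add: v_def)
  qed
  have inj: "inj_on ?u (-I)"
  proof (rule inj_onI, rule ccontr)
    fix i j assume ij: "i \<in> -I" "j \<in> -I" "?u i = ?u j" "i \<noteq> j"
    define f where "f l = (if l = i then 1 else if l = j then -1 else (0::real))" for l
    have "(\<Sum>l\<in>-I. f l *\<^sub>R ?u l) = (\<Sum>l\<in>-I. (if l = i then ?u l else 0) - (if l = j then ?u l else 0))"
      by (intro sum.cong) (use ij(4) in \<open>auto simp: f_def\<close>)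
    also have "\<dots> = 0" using ij by (simp add: sum_subtractf)
    finally have "f i = 0" using free ij(1) by blast
    then show False by (simp add: f_def)
  qed
  have indep: "independent (?u ` (-I))"
  proof -
    have c0: "c b = 0" if c: "(\<Sum>b\<in>?u ` (-I). c b *\<^sub>R b) = 0" and b: "b \<in> ?u ` (-I)" for c b
    proof -
      obtain i where i: "i \<in> -I" "b = ?u i" using b by blast
      have "(\<Sum>i\<in>-I. c (?u i) *\<^sub>R ?u i) = 0"
        using c sum.reindex[OF inj, of "\<lambda>b. c b *\<^sub>R b"] by (simp add: comp_def)
      from free[OF this i(1)] show ?thesis by (simp add: i(2))
    qed
    have fin: "finite (?u ` (-I))" by simp
    show ?thesis
    proof
      assume "dependent (?u ` (-I))"
      then obtain c b where "b \<in> ?u ` (-I)" "c b \<noteq> 0" "(\<Sum>b\<in>?u ` (-I). c b *\<^sub>R b) = 0"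
        unfolding dependent_finite[OF fin] by (elim exE conjE bexE)
      then show False using c0 by blast
    qed
  qed
  obtain B where B: "?u ` (-I) \<subseteq> B" "B \<subseteq> range ?u" "independent B" "range ?u \<subseteq> span B"
    by (rule maximal_independent_subset_extend[OF image_mono[OF subset_UNIV] indep])
  have finB: "finite B" by (rule finite_subset[OF B(2)]) simp
  have "y \<in> span B" for y
  proof -
    obtain v where "y = proj v" using surjD[OF surj] by blast
    then have "y = (\<Sum>i\<in>UNIV. v $ i *\<^sub>R ?u i)" using proj_sum[OF lin, of v] by simp
    moreover have "?u i \<in> span B" for i using B(4) by blast
    ultimately show ?thesis by (simp add: span_sum span_scale)
  qed
  then have "span B = UNIV" by blast
  then have cardB: "card B = CARD('n)"
    using dim_eq_card_independent[OF B(3)] dim_span[of B] by simp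
  have lat: "int_span B = proj ` int_lattice"
    using reg B(2,3) cardB by (auto simp: regular_normals_def)
  have "\<exists>idx. \<forall>b\<in>B. ?u (idx b) = b \<and> (b \<in> ?u ` (-I) \<longrightarrow> idx b \<in> -I)"
  proof (rule bchoice, rule ballI)
    fix b assume "b \<in> B"
    then show "\<exists>i. ?u i = b \<and> (b \<in> ?u ` (-I) \<longrightarrow> i \<in> -I)"
      using B(2) by (cases "b \<in> ?u ` (-I)") auto
  qed
  then obtain idx where idx: "\<And>b. b \<in> B \<Longrightarrow> ?u (idx b) = b" "\<And>b. b \<in> B \<Longrightarrow> b \<in> ?u ` (-I) \<Longrightarrow> idx b \<in> -I"
    by blast
  obtain h where h: "bij_betw h (UNIV :: 'n set) B"
    using finite_same_card_bij[of "UNIV :: 'n set" B] finB cardB by auto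
  have hB: "h j \<in> B" for j using h bij_betw_apply by fastforce
  have injh: "inj h" using h bij_betw_imp_inj_on by blast
  define k where "k j = idx (h j)" for j
  have uk: "?u (k j) = h j" for j by (simp add: k_def idx(1) hB)
  have injk: "inj k" using uk injh by (metis injI injD)
  have rk: "i \<in> I" if "i \<notin> range k" for i
  proof (rule ccontr)
    assume "i \<notin> I"
    then have i: "i \<in> -I" by simp
    then have uB: "?u i \<in> B" using B(1) by auto
    then obtain j where j: "?u i = h j" using h by (metis bij_betw_imp_surj_on imageE)
    have "k j \<in> -I" unfolding k_def j[symmetric] by (rule idx(2)[OF uB imageI[OF i]])
    moreover have "?u (k j) = ?u i" using uk j by simp
    ultimately have "k j = i" using inj i by (auto simp: inj_on_def)
    then show False using that by auto
  qed
  have "\<exists>c :: real^'n \<Rightarrow> int. ?u i = (\<Sum>b\<in>B. of_int (c b) *\<^sub>R b)" for i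
  proof -
    have "axis i 1 \<in> (int_lattice :: (real^'d) set)" by (simp add: int_lattice_def axis_def)
    then have "?u i \<in> int_span B" unfolding lat normal_def by blast
    then show ?thesis by (auto simp: int_span_def)
  qed
  then obtain c :: "'d \<Rightarrow> real^'n \<Rightarrow> int" where c: "\<And>i. ?u i = (\<Sum>b\<in>B. of_int (c i b) *\<^sub>R b)" by metis
  define e :: "'d \<Rightarrow> int" where "e i = (if \<epsilon> i = 1 then 1 else - 1)" for i
  have e: "of_int (e i) = \<epsilon> i" "e i * e i = 1" for i using \<epsilon> by (auto simp: e_def Theta_def)
  define n where "n i j = (if i \<in> range k then (if i = k j then 1 else 0) else c i (h j))" for i j
  define N where "N i j = e i * e (k j) * n i j" for i j
  have un: "?u i = (\<Sum>j\<in>UNIV. of_int (n i j) *\<^sub>R h j)" for i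
  proof (cases "i \<in> range k")
    case True
    then obtain l where l: "i = k l" by blast
    have "(\<Sum>j\<in>UNIV. of_int (n i j) *\<^sub>R h j) = (\<Sum>j\<in>UNIV. if j = l then h j else 0)"
      by (intro sum.cong) (use l injk in \<open>auto simp: n_def inj_eq\<close>)
    then show ?thesis using uk l by simp
  next
    case False
    have "?u i = (\<Sum>j\<in>UNIV. of_int (c i (h j)) *\<^sub>R h j)"
      using c[of i] sum.reindex_bij_betw[OF h, of "\<lambda>b. of_int (c i b) *\<^sub>R b"] by simp
    then show ?thesis using False by (simp add: n_def)
  qed
  have hfree: "x j = 0" if "(\<Sum>j\<in>UNIV. x j *\<^sub>R h j) = 0" for x :: "'n \<Rightarrow> real" and j
  proof -
    have "(\<Sum>b\<in>B. x (inv h b) *\<^sub>R b) = (\<Sum>j\<in>UNIV. x j *\<^sub>R h j)"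
      using sum.reindex_bij_betw[OF h, of "\<lambda>b. x (inv h b) *\<^sub>R b"] injh by simp
    then have "x (inv h (h j)) = 0"
      using that B(3) finB hB[of j] independentD[of B B "\<lambda>b. x (inv h b)" "h j"] by auto
    then show ?thesis using injh by simp
  qed
  have mem: "v \<in> twist \<epsilon> m \<longleftrightarrow> (\<forall>j. (\<Sum>i\<in>UNIV. of_int (N i j) * v $ i) = 0)" for v
  proof -
    have "proj (\<chi> i. \<epsilon> i * v $ i) = (\<Sum>i\<in>UNIV. \<Sum>j\<in>UNIV. (\<epsilon> i * v $ i * of_int (n i j)) *\<^sub>R h j)"
      by (subst proj_sum[OF lin], subst un) (simp add: scaleR_sum_right)
    also have "\<dots> = (\<Sum>j\<in>UNIV. (\<Sum>i\<in>UNIV. \<epsilon> i * v $ i * of_int (n i j)) *\<^sub>R h j)"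
      by (subst sum.swap) (simp add: scaleR_sum_left)
    finally have "v \<in> twist \<epsilon> m \<longleftrightarrow> (\<Sum>j\<in>UNIV. (\<Sum>i\<in>UNIV. \<epsilon> i * v $ i * of_int (n i j)) *\<^sub>R h j) = 0"
      using ker by (auto simp: twist_def)
    also have "\<dots> \<longleftrightarrow> (\<forall>j. (\<Sum>i\<in>UNIV. \<epsilon> i * v $ i * of_int (n i j)) = 0)"
      using hfree[of "\<lambda>j. \<Sum>i\<in>UNIV. \<epsilon> i * v $ i * of_int (n i j)"] by auto
    also have "\<dots> \<longleftrightarrow> (\<forall>j. (\<Sum>i\<in>UNIV. of_int (N i j) * v $ i) = 0)"
    proof -
      have "(\<Sum>i\<in>UNIV. of_int (N i j) * v $ i) = \<epsilon> (k j) * (\<Sum>i\<in>UNIV. \<epsilon> i * v $ i * of_int (n i j))" for j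
        by (simp add: N_def e sum_distrib_left mult_ac)
      moreover have "\<epsilon> (k j) \<noteq> 0" for j using \<epsilon> by (auto simp: Theta_def dest!: spec[of _ "k j"])
      ultimately show ?thesis by simp
    qed
    finally show ?thesis .
  qed
  have "chart_datum (twist \<epsilon> m) k N"
    unfolding chart_datum_def using injk mem e(2) by (auto simp: N_def n_def inj_eq)
  then show ?thesis using rk by blast
qed

section \<open>The moment map equation along a torus orbit\<close>

text \<open>For \<open>x \<ge> 0\<close>, replace \<open>exp (2 * x)\<close> by \<open>2 * x\<^sup>2\<close> and complete the square.\<close>

lemma exp_minus_linear_lower_bound:
  fixes A h x :: real
  assumes "A \<ge> 0" "h \<ge> 0" "h \<noteq> 0 \<Longrightarrow> A \<noteq> 0"
  shows "A * exp (2 * x) / 2 - 2 * h * x \<ge> 2 * h * \<bar>x\<bar> - 4 * h\<^sup>2 / A"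
proof (cases "h = 0")
  case True
  then show ?thesis using assms(1) by simp
next
  case False
  then have A: "A > 0" and h: "h > 0" using assms by auto
  show ?thesis
  proof (cases "x \<le> 0")
    case True
    have "A * exp (2 * x) / 2 \<ge> 0" "4 * h\<^sup>2 / A \<ge> 0" using A by simp_all
    moreover have "- 2 * h * x = 2 * h * \<bar>x\<bar>" using True by simp
    ultimately show ?thesis by linarith
  next
    case x: False
    then have "1 + 2 * x + (2 * x)\<^sup>2 / 2 \<le> exp (2 * x)" by (intro exp_lower_Taylor_quadratic) simp
    then have "2 * x\<^sup>2 \<le> exp (2 * x)" using x by (simp add: power2_eq_square)
    then have "A * x\<^sup>2 \<le> A * exp (2 * x) / 2" using A by (simp add: field_simps)
    moreover have "A * x\<^sup>2 - 4 * h * x + 4 * h\<^sup>2 / A = (A * x - 2 * h)\<^sup>2 / A"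
      using A by (simp add: field_simps power2_eq_square)
    then have "A * x\<^sup>2 - 4 * h * x + 4 * h\<^sup>2 / A \<ge> 0" using A by simp
    ultimately show ?thesis using x by simp
  qed
qed

text \<open>The left side minus the right side is the derivative in direction \<open>v\<close> of the function \<open>f\<close> below,
which is coercive on \<open>m\<close> and hence has a minimum. The numbers \<open>h\<close> and \<open>k\<close> stand for the products
\<open>a\<^sub>i \<bar>z\<^sub>i\<bar>\<^sup>2\<close> and \<open>b\<^sub>i \<bar>w\<^sub>i\<bar>\<^sup>2\<close> in the semistability condition. They can be kept fixed while \<open>A\<close> and
\<open>B\<close> vary, so the bound on \<open>y\<close> is locally uniform; division by zero in this bound only occurs
under a zero numerator.\<close>

lemma moment_equation_solvable:
  fixes m :: "(real^'d) set" and A B h k :: "'d \<Rightarrow> real"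
  assumes m: "subspace m" and \<kappa>: "\<kappa> > 0" "\<And>y. y \<in> m \<Longrightarrow> \<kappa> * norm y \<le> (\<Sum>i\<in>UNIV. (h i + k i) * \<bar>y $ i\<bar>)"
    and nn: "\<And>i. A i \<ge> 0" "\<And>i. B i \<ge> 0" "\<And>i. h i \<ge> 0" "\<And>i. k i \<ge> 0"
    and nz: "\<And>i. h i \<noteq> 0 \<Longrightarrow> A i \<noteq> 0" "\<And>i. k i \<noteq> 0 \<Longrightarrow> B i \<noteq> 0"
  shows "\<exists>y\<in>m. (\<forall>v\<in>m. (\<Sum>i\<in>UNIV. (exp (2 * y $ i) * A i - exp (- 2 * y $ i) * B i) * v $ i)
                      = 2 * (\<Sum>i\<in>UNIV. (h i - k i) * v $ i)) \<and>
     2 * \<kappa> * norm y \<le> (\<Sum>i\<in>UNIV. (A i + B i) / 2) + (\<Sum>i\<in>UNIV. 4 * (h i)\<^sup>2 / A i + 4 * (k i)\<^sup>2 / B i)"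
proof -
  define f where "f y = (\<Sum>i\<in>UNIV. (A i * exp (2 * y $ i) / 2 - 2 * h i * y $ i) +
      (B i * exp (- 2 * y $ i) / 2 + 2 * k i * y $ i))" for y :: "real^'d"
  define C where "C = (\<Sum>i\<in>UNIV. 4 * (h i)\<^sup>2 / A i + 4 * (k i)\<^sup>2 / B i)"
  have lower: "2 * \<kappa> * norm y - C \<le> f y" if y: "y \<in> m" for y
  proof -
    have "(\<Sum>i\<in>UNIV. 2 * ((h i + k i) * \<bar>y $ i\<bar>) - (4 * (h i)\<^sup>2 / A i + 4 * (k i)\<^sup>2 / B i)) \<le> f y"
      unfolding f_def
    proof (rule sum_mono)
      fix i
      show "2 * ((h i + k i) * \<bar>y $ i\<bar>) - (4 * (h i)\<^sup>2 / A i + 4 * (k i)\<^sup>2 / B i) \<le>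
        (A i * exp (2 * y $ i) / 2 - 2 * h i * y $ i) + (B i * exp (- 2 * y $ i) / 2 + 2 * k i * y $ i)"
        using exp_minus_linear_lower_bound[OF nn(1)[of i] nn(3)[of i] nz(1)[of i], of "y $ i"]
          exp_minus_linear_lower_bound[OF nn(2)[of i] nn(4)[of i] nz(2)[of i], of "- y $ i"]
        by (simp add: algebra_simps)
    qed
    moreover have "(\<Sum>i\<in>UNIV. 2 * ((h i + k i) * \<bar>y $ i\<bar>) - (4 * (h i)\<^sup>2 / A i + 4 * (k i)\<^sup>2 / B i)) =
       2 * (\<Sum>i\<in>UNIV. (h i + k i) * \<bar>y $ i\<bar>) - C"
      unfolding C_def sum_subtractf sum_distrib_left ..
    ultimately show ?thesis using \<kappa>(2)[OF y] by linarith
  qed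
  have f0: "f 0 = (\<Sum>i\<in>UNIV. (A i + B i) / 2)" unfolding f_def by (simp add: add_divide_distrib)
  define R where "R = (f 0 + C) / (2 * \<kappa>)"
  have "2 * \<kappa> * norm (0::real^'d) - C \<le> f 0" by (rule lower[OF subspace_0[OF m]])
  then have R0: "R \<ge> 0" unfolding R_def using \<kappa>(1) by simp
  have "continuous_on (m \<inter> cball 0 R) f" unfolding f_def by (intro continuous_intros) auto
  moreover have "compact (m \<inter> cball 0 R)" using closed_subspace[OF m] by (simp add: closed_Int_compact)
  moreover have "m \<inter> cball 0 R \<noteq> {}" using R0 subspace_0[OF m] by auto
  ultimately obtain y where y: "y \<in> m \<inter> cball 0 R" "\<forall>x\<in>m \<inter> cball 0 R. f y \<le> f x"
    using continuous_attains_inf by blast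
  have ym: "y \<in> m" using y(1) by simp
  have min: "f y \<le> f x" if x: "x \<in> m" for x
  proof (cases "norm x \<le> R")
    case True
    then show ?thesis using y(2) x by simp
  next
    case False
    then have "R * (2 * \<kappa>) < norm x * (2 * \<kappa>)" using \<kappa>(1) by simp
    moreover have "R * (2 * \<kappa>) = f 0 + C" unfolding R_def using \<kappa>(1) by simp
    moreover have "f y \<le> f 0" using y(2) R0 subspace_0[OF m] by simp
    ultimately show ?thesis using lower[OF x] by (simp add: mult_ac)
  qed
  have "(\<Sum>i\<in>UNIV. (exp (2 * y $ i) * A i - exp (- 2 * y $ i) * B i) * v $ i) = 2 * (\<Sum>i\<in>UNIV. (h i - k i) * v $ i)"
    if v: "v \<in> m" for v
  proof -
    define l where "l = (\<Sum>i\<in>UNIV. (exp (2 * y $ i) * A i - exp (- 2 * y $ i) * B i) * v $ i - 2 * ((h i - k i) * v $ i))"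
    have "((\<lambda>s. f (y + s *\<^sub>R v)) has_field_derivative l) (at 0)"
      unfolding f_def l_def
      by (rule DERIV_sum) (auto intro!: derivative_eq_intros simp: algebra_simps)
    moreover have "f (y + 0 *\<^sub>R v) \<le> f (y + s *\<^sub>R v)" for s
      using min[OF subspace_add[OF m ym subspace_scale[OF m v]]] by simp
    ultimately have "l = 0" using DERIV_local_min[of "\<lambda>s. f (y + s *\<^sub>R v)" l 0 1] by simp
    then show ?thesis by (simp add: l_def sum_subtractf sum_distrib_left)
  qed
  moreover have "2 * \<kappa> * norm y \<le> f 0 + C"
  proof -
    have "norm y * (2 * \<kappa>) \<le> R * (2 * \<kappa>)" using y(1) \<kappa>(1) by simp
    also have "\<dots> = f 0 + C" unfolding R_def using \<kappa>(1) by simp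
    finally show ?thesis by (simp add: mult_ac)
  qed
  ultimately show ?thesis using ym unfolding f0 C_def by blast
qed

text \<open>The exponential is monotone, so testing the difference of the two equations with \<open>y - y'\<close> gives a
sum of nonnegative terms that vanishes.\<close>

lemma moment_equation_unique:
  fixes m :: "(real^'d) set" and A B :: "'d \<Rightarrow> real"
  assumes m: "subspace m" and y: "y \<in> m" "y' \<in> m"
    and nn: "\<And>i. A i \<ge> 0" "\<And>i. B i \<ge> 0"
    and nd: "\<And>v. v \<in> m \<Longrightarrow> (\<And>i. A i \<noteq> 0 \<or> B i \<noteq> 0 \<Longrightarrow> v $ i = 0) \<Longrightarrow> v = 0"
    and eq: "\<And>v. v \<in> m \<Longrightarrow> (\<Sum>i\<in>UNIV. (exp (2 * y $ i) * A i - exp (- 2 * y $ i) * B i) * v $ i)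
         = (\<Sum>i\<in>UNIV. (exp (2 * y' $ i) * A i - exp (- 2 * y' $ i) * B i) * v $ i)"
  shows "y = y'"
proof -
  let ?v = "y - y'"
  have v: "?v \<in> m" by (rule subspace_diff[OF m y])
  define t where "t i = A i * ((exp (2 * y $ i) - exp (2 * y' $ i)) * ?v $ i) +
      B i * ((exp (- 2 * y' $ i) - exp (- 2 * y $ i)) * ?v $ i)" for i
  have mono: "(exp (2 * a) - exp (2 * b)) * (a - b) \<ge> 0" "(exp (- 2 * b) - exp (- 2 * a)) * (a - b) \<ge> 0"
    for a b :: real
    by (cases "a \<le> b"; simp add: mult_nonpos_nonpos)+
  have pos: "A i * ((exp (2 * y $ i) - exp (2 * y' $ i)) * ?v $ i) \<ge> 0"
    "B i * ((exp (- 2 * y' $ i) - exp (- 2 * y $ i)) * ?v $ i) \<ge> 0" for i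
    unfolding vector_minus_component
    by (rule mult_nonneg_nonneg[OF nn(1) mono(1)], rule mult_nonneg_nonneg[OF nn(2) mono(2)])
  have t0: "t i \<ge> 0" for i
    unfolding t_def by (rule add_nonneg_nonneg[OF pos])
  have "(\<Sum>i\<in>UNIV. t i) = 0"
    using eq[OF v] by (simp add: t_def algebra_simps sum.distrib sum_subtractf)
  then have tz: "t i = 0" for i using t0 sum_nonneg_eq_0_iff[of UNIV t] by simp
  have "?v $ i = 0" if i: "A i \<noteq> 0 \<or> B i \<noteq> 0" for i
  proof -
    have "A i * ((exp (2 * y $ i) - exp (2 * y' $ i)) * ?v $ i) = 0"
      "B i * ((exp (- 2 * y' $ i) - exp (- 2 * y $ i)) * ?v $ i) = 0"
      using tz[of i] pos[of i] unfolding t_def by linarith+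
    then show ?thesis using i by auto
  qed
  from nd[OF v this] show ?thesis by simp
qed

section \<open>The hyperkaehler quotient as a quotient of the semistable points\<close>

definition hact :: "complex^'d \<Rightarrow> (complex^'d) \<times> (complex^'d) \<Rightarrow> (complex^'d) \<times> (complex^'d)" where
  "hact t p = (fst p * t, snd p * vinv t)"

lemma horbit_hact: "horbit T p = {hact t p | t. t \<in> T}"
proof -
  have "(\<chi> i. fst p $ i * t $ i, \<chi> i. snd p $ i * inverse (t $ i)) = hact t p" for t
    by (simp add: hact_def vec_eq_iff)
  then show ?thesis by (simp add: horbit_def split_beta)
qed

lemma hact_hact: "hact s (hact t p) = hact (t * s) p"
  by (simp add: hact_def vec_eq_iff mult_ac)

lemma hact_one: "hact 1 p = p"
  by (simp add: hact_def vec_eq_iff prod_eq_iff)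

definition rexp :: "real^'d \<Rightarrow> complex^'d" where "rexp y = (\<chi> i. of_real (exp (y $ i)))"

lemma continuous_rexp: "continuous_on A rexp"
  unfolding rexp_def by (intro continuous_intros)

lemma texp_ctorus: "0 \<in> m \<Longrightarrow> x \<in> m \<Longrightarrow> texp x \<in> ctorus m"
  unfolding ctorus_def texp_def
  by (intro CollectI exI[of _ x] exI[of _ 0]) (simp add: vec_eq_iff cis_conv_exp Complex_eq mult_ac)

lemma rexp_ctorus:
  assumes "subspace m" "y \<in> m" shows "rexp y \<in> ctorus m"
proof -
  have "rexp y = (\<chi> i. exp (2 * pi * \<i> * Complex ((0::real^'a) $ i) ((- (1 / (2 * pi)) *\<^sub>R y) $ i)))"
    by (simp add: rexp_def vec_eq_iff Complex_eq exp_of_real[symmetric])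
  then show ?thesis
    unfolding ctorus_def using subspace_0[OF assms(1)] subspace_scale[OF assms] by blast
qed

lemma ctorus_polar:
  assumes "subspace m" "t \<in> ctorus m"
  obtains x y where "x \<in> m" "y \<in> m" "t = texp x * rexp y"
proof -
  obtain x y where xy: "x \<in> m" "y \<in> m" "\<forall>i. t $ i = exp (2 * pi * \<i> * Complex (x $ i) (y $ i))"
    using ctorusE[OF assms(2)] .
  have "exp (2 * pi * \<i> * Complex a b) = cis (2 * pi * a) * exp (- (2 * pi * b))" for a b :: real
    by (simp add: cis_conv_exp Complex_eq algebra_simps exp_of_real[symmetric] flip: exp_add)
  then have "t = texp x * rexp (- (2 * pi) *\<^sub>R y)"
    using xy(3) by (simp add: vec_eq_iff texp_def rexp_def)
  then show thesis using that xy subspace_scale[OF assms(1) xy(2)] by blast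
qed

text \<open>Regularity of \<open>(\<alpha>, 0)\<close> as a value of the moment map enters only through the last assumption.\<close>

locale hyperkaehler_torus =
  fixes M :: "(complex^'d) set" and \<alpha> :: "real^'d \<Rightarrow> real"
  assumes subtorus_M: "subtorus M" and subspace_lie: "subspace (lie M)"
    and \<alpha>_ext: "\<alpha> = restrict \<alpha> (lie M)"
    and nondegenerate: "\<alpha> = (\<lambda>v\<in>lie M. \<Sum>i\<in>UNIV. c i * v $ i) \<Longrightarrow> v \<in> lie M \<Longrightarrow>
       (\<And>i. c i \<noteq> 0 \<Longrightarrow> v $ i = 0) \<Longrightarrow> v = 0"
begin

abbreviation "MC \<equiv> ctorus (lie M)"

abbreviation "F \<equiv> mu_fibre M \<alpha>"

abbreviation "S \<equiv> semistable M \<alpha>"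

lemma MC_eq: "complexification M = MC"
  by (simp add: complexification_def ctorus_def)

lemma M_eq: "M = texp ` lie M"
  by (rule subtorus_eq_texp_lie[OF subtorus_M subspace_lie])

lemma M_subset_MC: "M \<subseteq> MC"
  using texp_ctorus[OF subspace_0[OF subspace_lie]] by (subst M_eq) auto

lemma restrict_eq_iff: "restrict f D = restrict g D \<longleftrightarrow> (\<forall>x\<in>D. f x = g x)"
  by (auto simp: fun_eq_iff restrict_def)

lemma \<alpha>_eq_iff: "\<alpha> = restrict f (lie M) \<longleftrightarrow> (\<forall>v\<in>lie M. \<alpha> v = f v)"
  by (subst \<alpha>_ext) (simp only: restrict_eq_iff)

definition complex_moment_zero :: "(complex^'d) \<times> (complex^'d) \<Rightarrow> bool" where
  "complex_moment_zero p \<longleftrightarrow> (\<forall>v\<in>lie M. (\<Sum>i\<in>UNIV. fst p $ i * snd p $ i * of_real (v $ i)) = 0)"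

lemma mu_C_zero_iff: "mu_C M p = zero_C M \<longleftrightarrow> complex_moment_zero p"
  by (simp add: mu_C_def zero_C_def split_beta restrict_eq_iff complex_moment_zero_def)

lemma complex_moment_zero_hact:
  assumes "t \<in> MC" shows "complex_moment_zero (hact t p) \<longleftrightarrow> complex_moment_zero p"
proof -
  have "fst (hact t p) $ i * snd (hact t p) $ i = fst p $ i * snd p $ i" for i
    using ctorus_nonzero[OF assms, of i] by (simp add: hact_def)
  then show ?thesis by (simp add: complex_moment_zero_def)
qed

text \<open>By \<open>moment_eq_hact\<close>, it says that the real moment map takes the value \<open>\<alpha>\<close> at the translate of \<open>p\<close> by
the positive torus element \<open>rexp y\<close>.\<close>

definition moment_eq :: "(complex^'d) \<times> (complex^'d) \<Rightarrow> real^'d \<Rightarrow> bool" where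
  "moment_eq p y \<longleftrightarrow> (\<forall>v\<in>lie M. (\<Sum>i\<in>UNIV. (exp (2 * y $ i) * (norm (fst p $ i))\<^sup>2
      - exp (- 2 * y $ i) * (norm (snd p $ i))\<^sup>2) * v $ i) = 2 * \<alpha> v)"

lemma F_iff: "p \<in> F \<longleftrightarrow> complex_moment_zero p \<and> moment_eq p 0"
proof -
  have "mu_R M p = \<alpha> \<longleftrightarrow> \<alpha> = restrict (\<lambda>v. 1/2 * (\<Sum>i\<in>UNIV. ((norm (fst p $ i))\<^sup>2 - (norm (snd p $ i))\<^sup>2) * v $ i)) (lie M)"
    by (auto simp: mu_R_def split_beta)
  also have "\<dots> \<longleftrightarrow> moment_eq p 0"
    unfolding \<alpha>_eq_iff moment_eq_def by auto
  finally show ?thesis by (auto simp: mu_fibre_def mu_C_zero_iff)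
qed

lemma moment_eq_hact: "moment_eq (hact (texp x * rexp y) p) y' \<longleftrightarrow> moment_eq p (y + y')"
proof -
  have "(norm (fst (hact (texp x * rexp y) p) $ i))\<^sup>2 = exp (2 * y $ i) * (norm (fst p $ i))\<^sup>2" for i
    by (simp add: hact_def texp_def rexp_def norm_mult power_mult_distrib exp_double)
  moreover have "(norm (snd (hact (texp x * rexp y) p) $ i))\<^sup>2 = exp (- 2 * y $ i) * (norm (snd p $ i))\<^sup>2" for i
  proof -
    have "(norm (snd (hact (texp x * rexp y) p) $ i))\<^sup>2 = (exp (- y $ i))\<^sup>2 * (norm (snd p $ i))\<^sup>2"
      by (simp add: hact_def texp_def rexp_def norm_mult norm_inverse power_mult_distrib exp_minus)
    also have "(exp (- y $ i))\<^sup>2 = exp (- 2 * y $ i)" using exp_double[of "- y $ i"] by simp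
    finally show ?thesis .
  qed
  moreover have "exp (2 * y' $ i) * (exp (2 * y $ i) * a) = exp (2 * (y + y') $ i) * a"
      "exp (- 2 * y' $ i) * (exp (- 2 * y $ i) * a) = exp (- 2 * (y + y') $ i) * a" for a i
  proof -
    have "exp (2 * (y + y') $ i) = exp (2 * y' $ i) * exp (2 * y $ i)"
      "exp (- 2 * (y + y') $ i) = exp (- 2 * y' $ i) * exp (- 2 * y $ i)"
      unfolding exp_add[symmetric] by simp_all
    then show "exp (2 * y' $ i) * (exp (2 * y $ i) * a) = exp (2 * (y + y') $ i) * a"
      "exp (- 2 * y' $ i) * (exp (- 2 * y $ i) * a) = exp (- 2 * (y + y') $ i) * a"
      by (simp_all only: mult.assoc)
  qed
  ultimately show ?thesis
    unfolding moment_eq_def by (simp only: simp_thms)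
qed

text \<open>The coefficients in the semistability condition multiplied by the squared absolute values of the
coordinates. Only the vanishing of coordinates is left to constrain them, which makes it evident
that semistability persists when fewer coordinates vanish.\<close>

definition weights :: "(complex^'d) \<times> (complex^'d) \<Rightarrow> ('d \<Rightarrow> real) \<Rightarrow> ('d \<Rightarrow> real) \<Rightarrow> bool" where
  "weights p h k \<longleftrightarrow> (\<forall>i. h i \<ge> 0 \<and> k i \<ge> 0 \<and> (h i \<noteq> 0 \<longrightarrow> fst p $ i \<noteq> 0) \<and> (k i \<noteq> 0 \<longrightarrow> snd p $ i \<noteq> 0)) \<and>
     (\<forall>v\<in>lie M. \<alpha> v = (\<Sum>i\<in>UNIV. (h i - k i) * v $ i))"

lemma S_iff: "p \<in> S \<longleftrightarrow> complex_moment_zero p \<and> (\<exists>h k. weights p h k)"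
proof -
  have *: "\<alpha> = (\<lambda>v\<in>lie M. (\<Sum>i\<in>UNIV. a i * (norm (fst p $ i))\<^sup>2 * v $ i) + (\<Sum>i\<in>UNIV. b i * (norm (snd p $ i))\<^sup>2 * (- (v $ i))))
     \<longleftrightarrow> (\<forall>v\<in>lie M. \<alpha> v = (\<Sum>i\<in>UNIV. (a i * (norm (fst p $ i))\<^sup>2 - b i * (norm (snd p $ i))\<^sup>2) * v $ i))" for a b
    unfolding \<alpha>_eq_iff by (simp add: sum_subtractf left_diff_distrib sum_negf)
  show ?thesis
  proof
    assume "p \<in> S"
    then obtain a b where ab: "complex_moment_zero p" "\<forall>i. a i \<ge> 0 \<and> b i \<ge> 0"
      "\<forall>v\<in>lie M. \<alpha> v = (\<Sum>i\<in>UNIV. (a i * (norm (fst p $ i))\<^sup>2 - b i * (norm (snd p $ i))\<^sup>2) * v $ i)"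
      unfolding semistable_def split_beta mem_Collect_eq prod.collapse mu_C_zero_iff * by blast
    then have "weights p (\<lambda>i. a i * (norm (fst p $ i))\<^sup>2) (\<lambda>i. b i * (norm (snd p $ i))\<^sup>2)"
      unfolding weights_def by auto
    then show "complex_moment_zero p \<and> (\<exists>h k. weights p h k)" using ab(1) by blast
  next
    assume "complex_moment_zero p \<and> (\<exists>h k. weights p h k)"
    then obtain h k where hk: "complex_moment_zero p" "weights p h k" by blast
    define a where "a i = h i / (norm (fst p $ i))\<^sup>2" for i
    define b where "b i = k i / (norm (snd p $ i))\<^sup>2" for i
    have "a i * (norm (fst p $ i))\<^sup>2 = h i" "b i * (norm (snd p $ i))\<^sup>2 = k i" for i
      using hk(2) by (auto simp: a_def b_def weights_def)
    then have "\<forall>v\<in>lie M. \<alpha> v = (\<Sum>i\<in>UNIV. (a i * (norm (fst p $ i))\<^sup>2 - b i * (norm (snd p $ i))\<^sup>2) * v $ i)"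
      using hk(2) by (simp add: weights_def)
    moreover have "\<forall>i. a i \<ge> 0 \<and> b i \<ge> 0" using hk(2) by (simp add: a_def b_def weights_def)
    ultimately show "p \<in> S"
      unfolding semistable_def split_beta mem_Collect_eq prod.collapse mu_C_zero_iff * using hk(1) by blast
  qed
qed

lemma weights_mono:
  assumes "weights p h k" "\<And>i. fst p $ i \<noteq> 0 \<Longrightarrow> fst p' $ i \<noteq> 0" "\<And>i. snd p $ i \<noteq> 0 \<Longrightarrow> snd p' $ i \<noteq> 0"
  shows "weights p' h k"
  using assms unfolding weights_def by blast

lemma F_subset_S: "F \<subseteq> S"
proof
  fix p assume "p \<in> F"
  then have p: "complex_moment_zero p" "moment_eq p 0" using F_iff by auto
  have "\<alpha> v = (\<Sum>i\<in>UNIV. ((norm (fst p $ i))\<^sup>2 / 2 - (norm (snd p $ i))\<^sup>2 / 2) * v $ i)" if "v \<in> lie M" for v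
  proof -
    have "(\<Sum>i\<in>UNIV. ((norm (fst p $ i))\<^sup>2 - (norm (snd p $ i))\<^sup>2) * v $ i) = 2 * \<alpha> v"
      using p(2) that by (simp add: moment_eq_def)
    moreover have "(\<Sum>i\<in>UNIV. ((norm (fst p $ i))\<^sup>2 / 2 - (norm (snd p $ i))\<^sup>2 / 2) * v $ i) =
       (\<Sum>i\<in>UNIV. ((norm (fst p $ i))\<^sup>2 - (norm (snd p $ i))\<^sup>2) * v $ i) / 2"
      by (simp add: sum_divide_distrib diff_divide_distrib left_diff_distrib)
    ultimately show ?thesis by simp
  qed
  then have "weights p (\<lambda>i. (norm (fst p $ i))\<^sup>2 / 2) (\<lambda>i. (norm (snd p $ i))\<^sup>2 / 2)"
    by (auto simp: weights_def)
  then show "p \<in> S" using p(1) S_iff by blast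
qed

lemma weights_nondegenerate:
  assumes "weights p h k" "v \<in> lie M" "\<And>i. h i \<noteq> 0 \<or> k i \<noteq> 0 \<Longrightarrow> v $ i = 0"
  shows "v = 0"
proof (rule nondegenerate[OF _ assms(2)])
  show "\<alpha> = (\<lambda>v\<in>lie M. \<Sum>i\<in>UNIV. (h i - k i) * v $ i)"
    unfolding \<alpha>_eq_iff using assms(1) by (simp add: weights_def)
  show "v $ i = 0" if "h i - k i \<noteq> 0" for i using assms(3)[of i] that by auto
qed

lemma weights_coercive:
  assumes w: "weights p h k"
  shows "\<exists>\<kappa>>0. \<forall>y\<in>lie M. \<kappa> * norm y \<le> (\<Sum>i\<in>UNIV. (h i + k i) * \<bar>y $ i\<bar>)"
proof -
  define f where "f y = (\<chi> i. (h i + k i) * y $ i)" for y :: "real^'d"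
  have nn: "h i \<ge> 0" "k i \<ge> 0" for i using w by (auto simp: weights_def)
  have "linear f" unfolding f_def by (rule linearI) (auto simp: vec_eq_iff algebra_simps)
  then have bl: "bounded_linear f" using linear_conv_bounded_linear by blast
  have ker: "y = 0" if y: "y \<in> lie M" "f y = 0" for y
  proof (rule weights_nondegenerate[OF w y(1)])
    fix i assume i: "h i \<noteq> 0 \<or> k i \<noteq> 0"
    have "(h i + k i) * y $ i = 0" using y(2) by (simp add: f_def vec_eq_iff)
    moreover have "h i + k i \<noteq> 0" using i nn[of i] by (simp add: add_nonneg_eq_0_iff)
    ultimately show "y $ i = 0" by simp
  qed
  have "\<exists>e>0. \<forall>x\<in>lie M. norm (f x) \<ge> e * norm x"
    by (rule injective_imp_isometric[OF closed_subspace[OF subspace_lie] subspace_lie bl]) (use ker in blast)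
  then obtain e where e: "e > 0" "\<forall>x\<in>lie M. e * norm x \<le> norm (f x)" by blast
  have "norm (f y) \<le> (\<Sum>i\<in>UNIV. (h i + k i) * \<bar>y $ i\<bar>)" for y
    using norm_le_l1_cart[of "f y"] nn by (simp add: f_def abs_mult)
  then show ?thesis using e by (intro exI[of _ e]) (auto intro: order_trans)
qed

definition kn :: "(complex^'d) \<times> (complex^'d) \<Rightarrow> real^'d" where
  "kn p = (THE y. y \<in> lie M \<and> moment_eq p y)"

lemma moment_eq_unique:
  assumes "p \<in> S" "y \<in> lie M" "moment_eq p y" "y' \<in> lie M" "moment_eq p y'"
  shows "y = y'"
proof -
  obtain h k where w: "weights p h k" using assms(1) S_iff by blast
  show ?thesis
  proof (rule moment_equation_unique[OF subspace_lie assms(2,4), of "\<lambda>i. (norm (fst p $ i))\<^sup>2" "\<lambda>i. (norm (snd p $ i))\<^sup>2"])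
    fix v assume v: "v \<in> lie M" and z: "\<And>i. (norm (fst p $ i))\<^sup>2 \<noteq> 0 \<or> (norm (snd p $ i))\<^sup>2 \<noteq> 0 \<Longrightarrow> v $ i = 0"
    show "v = 0"
    proof (rule weights_nondegenerate[OF w v])
      fix i assume "h i \<noteq> 0 \<or> k i \<noteq> 0"
      then have "fst p $ i \<noteq> 0 \<or> snd p $ i \<noteq> 0" using w by (auto simp: weights_def)
      then show "v $ i = 0" using z[of i] by simp
    qed
  next
    fix v assume "v \<in> lie M"
    then show "(\<Sum>i\<in>UNIV. (exp (2 * y $ i) * (norm (fst p $ i))\<^sup>2 - exp (- 2 * y $ i) * (norm (snd p $ i))\<^sup>2) * v $ i)
         = (\<Sum>i\<in>UNIV. (exp (2 * y' $ i) * (norm (fst p $ i))\<^sup>2 - exp (- 2 * y' $ i) * (norm (snd p $ i))\<^sup>2) * v $ i)"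
      using assms(3,5) unfolding moment_eq_def by simp
  qed simp_all
qed

lemma kn_eqI: "p \<in> S \<Longrightarrow> y \<in> lie M \<Longrightarrow> moment_eq p y \<Longrightarrow> kn p = y"
  unfolding kn_def by (rule the_equality) (use moment_eq_unique in blast)+

definition kn_bound :: "('d \<Rightarrow> real) \<Rightarrow> ('d \<Rightarrow> real) \<Rightarrow> (complex^'d) \<times> (complex^'d) \<Rightarrow> real" where
  "kn_bound h k p = (\<Sum>i\<in>UNIV. ((norm (fst p $ i))\<^sup>2 + (norm (snd p $ i))\<^sup>2) / 2) +
     (\<Sum>i\<in>UNIV. 4 * (h i)\<^sup>2 / (norm (fst p $ i))\<^sup>2 + 4 * (k i)\<^sup>2 / (norm (snd p $ i))\<^sup>2)"

lemma kn_solution: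
  assumes p: "p \<in> S" and w: "weights p h k"
    and \<kappa>: "\<kappa> > 0" "\<And>y. y \<in> lie M \<Longrightarrow> \<kappa> * norm y \<le> (\<Sum>i\<in>UNIV. (h i + k i) * \<bar>y $ i\<bar>)"
  shows "kn p \<in> lie M" "moment_eq p (kn p)" "2 * \<kappa> * norm (kn p) \<le> kn_bound h k p"
proof -
  have "\<exists>y\<in>lie M. (\<forall>v\<in>lie M. (\<Sum>i\<in>UNIV. (exp (2 * y $ i) * (norm (fst p $ i))\<^sup>2 - exp (- 2 * y $ i) * (norm (snd p $ i))\<^sup>2) * v $ i)
                      = 2 * (\<Sum>i\<in>UNIV. (h i - k i) * v $ i)) \<and>
     2 * \<kappa> * norm y \<le> (\<Sum>i\<in>UNIV. ((norm (fst p $ i))\<^sup>2 + (norm (snd p $ i))\<^sup>2) / 2) +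
        (\<Sum>i\<in>UNIV. 4 * (h i)\<^sup>2 / (norm (fst p $ i))\<^sup>2 + 4 * (k i)\<^sup>2 / (norm (snd p $ i))\<^sup>2)"
    by (rule moment_equation_solvable[OF subspace_lie \<kappa>]) (use w in \<open>auto simp: weights_def\<close>)
  then obtain y where y: "y \<in> lie M" "2 * \<kappa> * norm y \<le> kn_bound h k p"
    and eq: "\<forall>v\<in>lie M. (\<Sum>i\<in>UNIV. (exp (2 * y $ i) * (norm (fst p $ i))\<^sup>2 - exp (- 2 * y $ i) * (norm (snd p $ i))\<^sup>2) * v $ i)
                      = 2 * (\<Sum>i\<in>UNIV. (h i - k i) * v $ i)"
    unfolding kn_bound_def by (elim bexE conjE)
  have "moment_eq p y"
    using eq w unfolding moment_eq_def weights_def by simp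
  then show "kn p \<in> lie M" "moment_eq p (kn p)" "2 * \<kappa> * norm (kn p) \<le> kn_bound h k p"
    using kn_eqI[OF p y(1)] y by simp_all
qed

lemma kn_props:
  assumes "p \<in> S" shows kn_in_lie: "kn p \<in> lie M" and moment_eq_kn: "moment_eq p (kn p)"
proof -
  obtain h k where w: "weights p h k" using assms S_iff by blast
  obtain \<kappa> where \<kappa>: "\<kappa> > 0" "\<forall>y\<in>lie M. \<kappa> * norm y \<le> (\<Sum>i\<in>UNIV. (h i + k i) * \<bar>y $ i\<bar>)"
    using weights_coercive[OF w] by blast
  show "kn p \<in> lie M" "moment_eq p (kn p)"
    using kn_solution[OF assms w \<kappa>(1)] \<kappa>(2) by blast+
qed

text \<open>Weights of \<open>p0\<close> are weights of all nearby points, and the bound of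
\<open>moment_equation_solvable\<close> is continuous at \<open>p0\<close>.\<close>

lemma kn_locally_bounded:
  assumes "p0 \<in> S"
  shows "\<exists>U R. open U \<and> p0 \<in> U \<and> (\<forall>p\<in>U \<inter> S. norm (kn p) \<le> R)"
proof -
  obtain h k where w: "weights p0 h k" using assms S_iff by blast
  obtain \<kappa> where \<kappa>: "\<kappa> > 0" "\<forall>y\<in>lie M. \<kappa> * norm y \<le> (\<Sum>i\<in>UNIV. (h i + k i) * \<bar>y $ i\<bar>)"
    using weights_coercive[OF w] by blast
  have tf: "((\<lambda>p. norm (fst p $ i)) \<longlongrightarrow> norm (fst p0 $ i)) (nhds p0)"
    and ts: "((\<lambda>p. norm (snd p $ i)) \<longlongrightarrow> norm (snd p0 $ i)) (nhds p0)" for i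
    by (intro tendsto_intros filterlim_ident)+
  have quot: "((\<lambda>p. 4 * c\<^sup>2 / (g p)\<^sup>2) \<longlongrightarrow> 4 * c\<^sup>2 / (g p0)\<^sup>2) (nhds p0)"
    if "(g \<longlongrightarrow> g p0) (nhds p0)" "c \<noteq> 0 \<longrightarrow> g p0 \<noteq> 0" for g :: "(complex^'d) \<times> (complex^'d) \<Rightarrow> real" and c :: real
  proof (cases "c = 0")
    case False
    then show ?thesis using that by (intro tendsto_intros) auto
  qed simp
  have "(kn_bound h k \<longlongrightarrow> kn_bound h k p0) (nhds p0)"
    unfolding kn_bound_def
    by (intro tendsto_add tendsto_sum tendsto_divide tendsto_const tendsto_power quot tf ts)
       (use w in \<open>auto simp: weights_def\<close>)
  then have "\<forall>\<^sub>F p in nhds p0. kn_bound h k p < kn_bound h k p0 + 1"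
    by (rule order_tendstoD(2)) simp
  moreover have "\<forall>\<^sub>F p in nhds p0. \<forall>i. fst p0 $ i \<noteq> 0 \<longrightarrow> fst p $ i \<noteq> 0"
  proof (rule eventually_all_finite)
    fix i
    show "\<forall>\<^sub>F p in nhds p0. fst p0 $ i \<noteq> 0 \<longrightarrow> fst p $ i \<noteq> 0"
    proof (cases "fst p0 $ i = 0")
      case False
      then have "\<forall>\<^sub>F p in nhds p0. 0 < norm (fst p $ i)" by (intro order_tendstoD(1)[OF tf]) simp
      then show ?thesis by (rule eventually_mono) auto
    qed simp
  qed
  moreover have "\<forall>\<^sub>F p in nhds p0. \<forall>i. snd p0 $ i \<noteq> 0 \<longrightarrow> snd p $ i \<noteq> 0"
  proof (rule eventually_all_finite)
    fix i
    show "\<forall>\<^sub>F p in nhds p0. snd p0 $ i \<noteq> 0 \<longrightarrow> snd p $ i \<noteq> 0"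
    proof (cases "snd p0 $ i = 0")
      case False
      then have "\<forall>\<^sub>F p in nhds p0. 0 < norm (snd p $ i)" by (intro order_tendstoD(1)[OF ts]) simp
      then show ?thesis by (rule eventually_mono) auto
    qed simp
  qed
  ultimately have "\<forall>\<^sub>F p in nhds p0. kn_bound h k p < kn_bound h k p0 + 1 \<and>
      (\<forall>i. fst p0 $ i \<noteq> 0 \<longrightarrow> fst p $ i \<noteq> 0) \<and> (\<forall>i. snd p0 $ i \<noteq> 0 \<longrightarrow> snd p $ i \<noteq> 0)"
    by eventually_elim blast
  then obtain U where U: "open U" "p0 \<in> U"
    "\<forall>p\<in>U. kn_bound h k p < kn_bound h k p0 + 1 \<and>
      (\<forall>i. fst p0 $ i \<noteq> 0 \<longrightarrow> fst p $ i \<noteq> 0) \<and> (\<forall>i. snd p0 $ i \<noteq> 0 \<longrightarrow> snd p $ i \<noteq> 0)"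
    unfolding eventually_nhds by blast
  have "norm (kn p) \<le> (kn_bound h k p0 + 1) / (2 * \<kappa>)" if p: "p \<in> U \<inter> S" for p
  proof -
    have "weights p h k" by (rule weights_mono[OF w]) (use U(3) p in auto)
    from kn_solution(3)[OF _ this \<kappa>(1)] have "2 * \<kappa> * norm (kn p) \<le> kn_bound h k p" using p \<kappa>(2) by blast
    also have "\<dots> \<le> kn_bound h k p0 + 1" using U(3) p by (intro less_imp_le) blast
    finally show ?thesis using \<kappa>(1) by (simp add: field_simps)
  qed
  then show ?thesis using U(1,2) by blast
qed

lemma closed_moment_eq: "closed {x. snd x \<in> lie M \<and> moment_eq (fst x) (snd x)}"
proof -
  have "{x. snd x \<in> lie M \<and> moment_eq (fst x) (snd x)} = snd -` lie M \<inter>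
     (\<Inter>v\<in>lie M. {x. (\<Sum>i\<in>UNIV. (exp (2 * snd x $ i) * (norm (fst (fst x) $ i))\<^sup>2
      - exp (- 2 * snd x $ i) * (norm (snd (fst x) $ i))\<^sup>2) * v $ i) = 2 * \<alpha> v})"
    by (auto simp: moment_eq_def)
  moreover have "closed (snd -` lie M :: (((complex^'d) \<times> (complex^'d)) \<times> (real^'d)) set)"
    by (rule closed_vimage_snd[OF closed_subspace[OF subspace_lie]])
  moreover have "closed {x :: ((complex^'d) \<times> (complex^'d)) \<times> (real^'d). (\<Sum>i\<in>UNIV. (exp (2 * snd x $ i) * (norm (fst (fst x) $ i))\<^sup>2
      - exp (- 2 * snd x $ i) * (norm (snd (fst x) $ i))\<^sup>2) * v $ i) = 2 * \<alpha> v}" for v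
    by (intro closed_Collect_eq continuous_intros)
  ultimately show ?thesis by (simp add: closed_Int closed_INT)
qed

text \<open>A locally bounded map with closed graph is continuous, and the graph is closed because it is the
solution set of the moment map equation.\<close>

lemma continuous_kn: "continuous_on S kn"
proof (rule continuous_on_eq_continuous_within[THEN iffD2], rule ballI)
  fix p0 assume p0: "p0 \<in> S"
  obtain U R where U: "open U" "p0 \<in> U" "\<forall>p\<in>U \<inter> S. norm (kn p) \<le> R"
    using kn_locally_bounded[OF p0] by blast
  let ?T = "cball (0::real^'d) R"
  have graph: "(\<lambda>p. (p, kn p)) ` (U \<inter> S) = ((U \<inter> S) \<times> ?T) \<inter> {x. snd x \<in> lie M \<and> moment_eq (fst x) (snd x)}"
  proof (intro equalityI subsetI)
    fix x assume "x \<in> (\<lambda>p. (p, kn p)) ` (U \<inter> S)"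
    then show "x \<in> ((U \<inter> S) \<times> ?T) \<inter> {x. snd x \<in> lie M \<and> moment_eq (fst x) (snd x)}"
      using U(3) kn_props by auto
  next
    fix x assume "x \<in> ((U \<inter> S) \<times> ?T) \<inter> {x. snd x \<in> lie M \<and> moment_eq (fst x) (snd x)}"
    then have "fst x \<in> U \<inter> S" "kn (fst x) = snd x" using kn_eqI[of "fst x" "snd x"] by auto
    then show "x \<in> (\<lambda>p. (p, kn p)) ` (U \<inter> S)" by (intro image_eqI[of _ _ "fst x"]) (auto simp: prod_eq_iff)
  qed
  have "closedin (top_of_set ((U \<inter> S) \<times> ?T)) ((\<lambda>p. (p, kn p)) ` (U \<inter> S))"
    unfolding graph by (rule closedin_closed_Int[OF closed_moment_eq])
  moreover have "kn \<in> (U \<inter> S) \<rightarrow> ?T" using U(3) by (simp add: Pi_iff)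
  ultimately have "continuous_on (U \<inter> S) kn"
    using continuous_closed_graph_eq[OF compact_cball] by blast
  then have "continuous (at p0 within (U \<inter> S)) kn"
    using U(2) p0 continuous_on_eq_continuous_within by blast
  moreover have "at p0 within (U \<inter> S) = at p0 within S"
    by (rule at_within_nhd[OF U(2,1)]) auto
  ultimately show "continuous (at p0 within S) kn" by simp
qed

definition retr :: "(complex^'d) \<times> (complex^'d) \<Rightarrow> (complex^'d) \<times> (complex^'d)" where
  "retr p = hact (rexp (kn p)) p"

lemma texp_zero_mult: "texp 0 * t = t" by (simp add: texp_0)

lemma retr_in_F: assumes "p \<in> S" shows "retr p \<in> F"
proof -
  have "moment_eq (hact (texp 0 * rexp (kn p)) p) 0"
    unfolding moment_eq_hact using moment_eq_kn[OF assms] by simp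
  moreover have "complex_moment_zero (hact (rexp (kn p)) p)"
    using complex_moment_zero_hact[OF rexp_ctorus[OF subspace_lie kn_in_lie[OF assms]]] assms S_iff by blast
  ultimately show ?thesis unfolding F_iff retr_def texp_zero_mult by blast
qed

lemma vinv_rexp: "vinv (rexp y) = rexp (- y)"
  by (simp add: rexp_def vec_eq_iff exp_minus)

lemma continuous_retr: "continuous_on S retr"
proof -
  have mult: "continuous_on A (\<lambda>x. f x * g x)" if "continuous_on A f" "continuous_on A g"
    for A :: "((complex^'d) \<times> (complex^'d)) set" and f g :: "_ \<Rightarrow> complex^'d"
  proof -
    have "(\<lambda>x. f x * g x) = (\<lambda>x. \<chi> i. f x $ i * g x $ i)" by (simp add: vec_eq_iff fun_eq_iff)
    moreover have "continuous_on A (\<lambda>x. \<chi> i. f x $ i * g x $ i)"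
      using that by (intro continuous_intros)
    ultimately show ?thesis by (simp only:)
  qed
  have r: "continuous_on S (\<lambda>p. rexp (kn p))" "continuous_on S (\<lambda>p. rexp (- kn p))"
    by (rule continuous_on_compose2[OF continuous_rexp[of UNIV]], intro continuous_intros continuous_kn, simp)+
  show ?thesis
    unfolding retr_def hact_def vinv_rexp
    by (intro continuous_on_Pair mult r continuous_on_fst continuous_on_snd continuous_on_id)
qed

lemma hact_orbit_eq:
  assumes "\<And>t. t \<in> T \<Longrightarrow> vinv t \<in> T" "\<And>s t. s \<in> T \<Longrightarrow> t \<in> T \<Longrightarrow> s * t \<in> T" "\<And>t i. t \<in> T \<Longrightarrow> t $ i \<noteq> 0"
    "1 \<in> T"
  shows "horbit T p = horbit T p' \<longleftrightarrow> (\<exists>t\<in>T. p' = hact t p)"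
proof
  assume "horbit T p = horbit T p'"
  moreover have "p' \<in> horbit T p'" unfolding horbit_hact using assms(4) hact_one[of p'] by force
  ultimately show "\<exists>t\<in>T. p' = hact t p" unfolding horbit_hact by auto
next
  assume "\<exists>t\<in>T. p' = hact t p"
  then obtain t where t: "t \<in> T" "p' = hact t p" by blast
  have tv: "t * vinv t = 1" using assms(3)[OF t(1)] by (simp add: vec_eq_iff)
  show "horbit T p = horbit T p'"
  proof (intro equalityI subsetI)
    fix x assume "x \<in> horbit T p"
    then obtain s where s: "s \<in> T" "x = hact s p" by (auto simp: horbit_hact)
    have "x = hact (vinv t * s) p'" using tv by (simp add: s(2) t(2) hact_hact mult.assoc[symmetric])
    then show "x \<in> horbit T p'" unfolding horbit_hact using assms(2)[OF assms(1)[OF t(1)] s(1)] by blast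
  next
    fix x assume "x \<in> horbit T p'"
    then obtain s where s: "s \<in> T" "x = hact s p'" by (auto simp: horbit_hact)
    have "x = hact (t * s) p" by (simp add: s(2) t(2) hact_hact)
    then show "x \<in> horbit T p" unfolding horbit_hact using assms(2)[OF t(1) s(1)] by blast
  qed
qed

lemma horbit_MC_eq_iff: "horbit MC p = horbit MC p' \<longleftrightarrow> (\<exists>t\<in>MC. p' = hact t p)"
  by (rule hact_orbit_eq)
     (auto intro: ctorus_vinv[OF subspace_lie] ctorus_mult[OF subspace_lie] ctorus_one[OF subspace_lie] dest: ctorus_nonzero)

lemma horbit_M_eq_iff: "horbit M p = horbit M p' \<longleftrightarrow> (\<exists>t\<in>M. p' = hact t p)"
  by (rule hact_orbit_eq)
     (use M_subset_MC ctorus_nonzero subtorusD[OF subtorus_M] in auto)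

lemma to_git_horbit: "to_git M (horbit M p) = horbit MC p"
proof -
  have "horbit MC p' = horbit MC p" if "p' \<in> horbit M p" for p'
    using that horbit_MC_eq_iff M_subset_MC unfolding horbit_hact[of M] by blast
  moreover have "p \<in> horbit M p" unfolding horbit_hact using subtorusD(2)[OF subtorus_M] hact_one[of p] by force
  ultimately show ?thesis unfolding to_git_def MC_eq by blast
qed

text \<open>Write the torus element that relates the two points as a unitary times a positive element. The
logarithm \<open>y\<close> of the positive part and \<open>0\<close> both solve the moment map equation at \<open>p\<close>, so \<open>y = 0\<close>.\<close>

lemma horbit_M_eqI:
  assumes p: "p \<in> F" "p' \<in> F" and eq: "horbit MC p = horbit MC p'"
  shows "horbit M p = horbit M p'"
proof -
  obtain t where t: "t \<in> MC" "p' = hact t p" using eq horbit_MC_eq_iff by blast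
  obtain x y where xy: "x \<in> lie M" "y \<in> lie M" "t = texp x * rexp y"
    using ctorus_polar[OF subspace_lie t(1)] by blast
  have "moment_eq p (y + 0)" using p(2) unfolding F_iff t(2) xy(3) moment_eq_hact by blast
  then have "moment_eq p y" by simp
  moreover have "moment_eq p 0" using p(1) F_iff by blast
  moreover have "p \<in> S" using p(1) F_subset_S by blast
  ultimately have "y = 0" using moment_eq_unique[OF _ xy(2) _ subspace_0[OF subspace_lie]] by blast
  then have "t = texp x" using xy(3) by (simp add: rexp_def vec_eq_iff)
  moreover have "texp x \<in> M" using M_eq xy(1) by blast
  ultimately show ?thesis using horbit_M_eq_iff t(2) by blast
qed

lemma topspace_Y: "topspace (Y_top M \<alpha>) = horbit M ` F"
proof -
  have "openin (Y_top M \<alpha>) (horbit M ` F)"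
  proof -
    have "{x \<in> F. horbit M x \<in> horbit M ` F} = F" by auto
    then show ?thesis unfolding Y_top_def openin_quotient_topology by simp
  qed
  moreover have "topspace (Y_top M \<alpha>) \<subseteq> horbit M ` F"
    using openin_topspace[of "Y_top M \<alpha>"] unfolding Y_top_def openin_quotient_topology by simp
  ultimately show ?thesis using openin_subset by blast
qed

definition toY :: "(complex^'d) \<times> (complex^'d) \<Rightarrow> ((complex^'d) \<times> (complex^'d)) set" where
  "toY p = horbit M (retr p)"

lemma toY_in_Y: "p \<in> S \<Longrightarrow> toY p \<in> topspace (Y_top M \<alpha>)"
  unfolding topspace_Y toY_def using retr_in_F by blast

lemma to_git_toY: assumes "p \<in> S" shows "to_git M (toY p) = horbit MC p"
  unfolding toY_def to_git_horbit horbit_MC_eq_iff[of _ p] eq_commute[of _ "horbit MC p"]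
  unfolding horbit_MC_eq_iff retr_def
  using rexp_ctorus[OF subspace_lie kn_in_lie[OF assms]] by blast

lemma inj_to_git: "inj_on (to_git M) (topspace (Y_top M \<alpha>))"
  unfolding topspace_Y
proof (rule inj_onI, elim imageE)
  fix x y p p' assume "to_git M x = to_git M y" "x = horbit M p" "p \<in> F" "y = horbit M p'" "p' \<in> F"
  then show "x = y" using horbit_M_eqI[of p p'] by (simp add: to_git_horbit)
qed

lemma toY_eq_iff:
  assumes "p \<in> S" "p' \<in> S"
  shows "toY p = toY p' \<longleftrightarrow> (\<exists>t\<in>MC. p' = hact t p)"
proof -
  have "toY p = toY p' \<longleftrightarrow> to_git M (toY p) = to_git M (toY p')"
    using inj_onD[OF inj_to_git _ toY_in_Y[OF assms(1)] toY_in_Y[OF assms(2)]] by metis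
  then show ?thesis unfolding to_git_toY[OF assms(1)] to_git_toY[OF assms(2)] horbit_MC_eq_iff .
qed

lemma toY_F: assumes "p \<in> F" shows "toY p = horbit M p"
proof -
  have "p \<in> S" "moment_eq p 0" using subsetD[OF F_subset_S assms] assms unfolding F_iff[of p] by auto
  then have "kn p = 0" using kn_eqI[OF _ subspace_0[OF subspace_lie]] by blast
  then have "retr p = p" by (simp add: retr_def rexp_def hact_def vec_eq_iff prod_eq_iff)
  then show ?thesis by (simp add: toY_def)
qed

lemma toY_onto: "toY ` S = topspace (Y_top M \<alpha>)"
proof
  show "toY ` S \<subseteq> topspace (Y_top M \<alpha>)" using toY_in_Y by blast
  show "topspace (Y_top M \<alpha>) \<subseteq> toY ` S"
  proof
    fix x assume "x \<in> topspace (Y_top M \<alpha>)"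
    then obtain p where p: "p \<in> F" "x = horbit M p" unfolding topspace_Y by (elim imageE)
    then show "x \<in> toY ` S" using toY_F[OF p(1)] subsetD[OF F_subset_S p(1)] by (intro image_eqI[of _ _ p]) simp_all
  qed
qed

text \<open>The retraction onto the fibre is continuous, and on the fibre itself \<open>toY\<close> is the given quotient
map.\<close>

lemma openin_Y_iff:
  assumes W: "W \<subseteq> topspace (Y_top M \<alpha>)"
  shows "openin (Y_top M \<alpha>) W \<longleftrightarrow> openin (top_of_set S) {p \<in> S. toY p \<in> W}"
proof
  assume "openin (Y_top M \<alpha>) W"
  then have "openin (top_of_set F) {x \<in> F. horbit M x \<in> W}"
    unfolding Y_top_def openin_quotient_topology by simp
  then have "openin (top_of_set S) (S \<inter> retr -` {x \<in> F. horbit M x \<in> W})"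
    using continuous_openin_preimage[OF continuous_retr] retr_in_F by blast
  moreover have "S \<inter> retr -` {x \<in> F. horbit M x \<in> W} = {p \<in> S. toY p \<in> W}"
    using retr_in_F by (auto simp: toY_def)
  ultimately show "openin (top_of_set S) {p \<in> S. toY p \<in> W}" by simp
next
  assume "openin (top_of_set S) {p \<in> S. toY p \<in> W}"
  then obtain O' where O': "open O'" "{p \<in> S. toY p \<in> W} = S \<inter> O'" unfolding openin_open by blast
  have "{x \<in> F. horbit M x \<in> W} = F \<inter> O'"
  proof -
    have "x \<in> O' \<longleftrightarrow> horbit M x \<in> W" if x: "x \<in> F" for x
    proof -
      have "x \<in> S" using x F_subset_S by blast
      have "x \<in> {p \<in> S. toY p \<in> W} \<longleftrightarrow> x \<in> S \<inter> O'" unfolding O'(2) ..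
      then show ?thesis using \<open>x \<in> S\<close> toY_F[OF x] by simp
    qed
    then show ?thesis by blast
  qed
  then have "openin (top_of_set F) {x \<in> F. horbit M x \<in> W}" using O'(1) by (simp add: openin_open_Int)
  then show "openin (Y_top M \<alpha>) W"
    using W unfolding topspace_Y unfolding Y_top_def openin_quotient_topology by simp
qed

lemma holo_Y_iff:
  assumes W: "W \<subseteq> topspace (Y_top M \<alpha>)"
  shows "snd (Y_cspace M \<alpha>) W f \<longleftrightarrow> holo_map csc2 (*) {p \<in> S. toY p \<in> W} (\<lambda>p. f (toY p))"
proof -
  have 1: "inv_into (topspace (Y_top M \<alpha>)) (to_git M) (horbit MC p) = toY p" if p: "p \<in> S" for p
    using inv_into_f_f[OF inj_to_git toY_in_Y[OF p]] to_git_toY[OF p] by simp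
  have "horbit MC p \<in> to_git M ` W \<longleftrightarrow> toY p \<in> W" if p: "p \<in> S" for p
    using inj_on_image_mem_iff[OF inj_to_git toY_in_Y[OF p] W] to_git_toY[OF p] by simp
  then have 2: "{p \<in> S. horbit MC p \<in> to_git M ` W} = {p \<in> S. toY p \<in> W}" by blast
  have "snd (Y_cspace M \<alpha>) W f \<longleftrightarrow> holo_map csc2 (*) {p \<in> S. toY p \<in> W}
     (\<lambda>p. f (inv_into (topspace (Y_top M \<alpha>)) (to_git M) (horbit MC p)))"
    unfolding Y_cspace_def snd_conv MC_eq 2 holo_on_iff ..
  also have "\<dots> \<longleftrightarrow> holo_map csc2 (*) {p \<in> S. toY p \<in> W} (\<lambda>p. f (toY p))"
    by (rule holo_map_cong) (simp add: 1)
  finally show ?thesis .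
qed

end

section \<open>Base and fibre coordinates of a sign vector\<close>

text \<open>The sign turns the product \<open>z\<^sub>i w\<^sub>i\<close> into \<open>\<epsilon>\<^sub>i\<close> times the product of the new coordinates, so that the
complex moment map becomes the condition that defines \<open>P\<close> for the twisted Lie algebra.\<close>

definition split_coords :: "('d \<Rightarrow> real) \<Rightarrow> (complex^'d) \<times> (complex^'d) \<Rightarrow> (complex^'d) \<times> (complex^'d)" where
  "split_coords \<epsilon> p = (\<chi> i. if \<epsilon> i = 1 then fst p $ i else snd p $ i, \<chi> i. if \<epsilon> i = 1 then snd p $ i else - fst p $ i)"

definition unsplit_coords :: "('d \<Rightarrow> real) \<Rightarrow> (complex^'d) \<times> (complex^'d) \<Rightarrow> (complex^'d) \<times> (complex^'d)" where
  "unsplit_coords \<epsilon> p = (\<chi> i. if \<epsilon> i = 1 then fst p $ i else - snd p $ i, \<chi> i. if \<epsilon> i = 1 then snd p $ i else fst p $ i)"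

lemma unsplit_split [simp]: "unsplit_coords \<epsilon> (split_coords \<epsilon> p) = p"
  by (auto simp: unsplit_coords_def split_coords_def prod_eq_iff vec_eq_iff)

lemma split_unsplit [simp]: "split_coords \<epsilon> (unsplit_coords \<epsilon> p) = p"
  by (auto simp: unsplit_coords_def split_coords_def prod_eq_iff vec_eq_iff)

lemma fst_split_coords: "fst (split_coords \<epsilon> p) = base_part \<epsilon> p"
  by (simp add: split_coords_def base_part_def split_beta)

lemma cdiff_map_at_minus:
  assumes "cdiff_map_at sc (*) f p" shows "cdiff_map_at sc (*) (\<lambda>x. - f x) p"
  by (rule cdiff_map_at_field_differentiable[OF assms]) (auto intro: derivative_intros)

lemma holo_split_coords: "holo_map csc2 csc2 A (split_coords \<epsilon>)"
proof (rule holo_map_subset[OF _ subset_UNIV], rule holo_mapI[OF _ open_UNIV])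
  fix p :: "(complex^'a) \<times> (complex^'a)"
  show "cdiff_map_at csc2 csc2 (split_coords \<epsilon>) p"
    unfolding split_coords_def
  proof (intro cdiff_map_at_Pair cdiff_map_at_vec; unfold vec_lambda_beta)
    fix i
    show "cdiff_map_at csc2 (*) (\<lambda>p. if \<epsilon> i = 1 then fst p $ i else snd p $ i) p"
      by (cases "\<epsilon> i = 1") (simp_all add: cdiff_map_at_fst_nth cdiff_map_at_snd_nth)
    show "cdiff_map_at csc2 (*) (\<lambda>p. if \<epsilon> i = 1 then snd p $ i else - fst p $ i) p"
      by (cases "\<epsilon> i = 1") (simp_all add: cdiff_map_at_fst_nth cdiff_map_at_snd_nth cdiff_map_at_minus)
  qed
qed

lemma holo_unsplit_coords: "holo_map csc2 csc2 A (unsplit_coords \<epsilon>)"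
proof (rule holo_map_subset[OF _ subset_UNIV], rule holo_mapI[OF _ open_UNIV])
  fix p :: "(complex^'a) \<times> (complex^'a)"
  show "cdiff_map_at csc2 csc2 (unsplit_coords \<epsilon>) p"
    unfolding unsplit_coords_def
  proof (intro cdiff_map_at_Pair cdiff_map_at_vec; unfold vec_lambda_beta)
    fix i
    show "cdiff_map_at csc2 (*) (\<lambda>p. if \<epsilon> i = 1 then fst p $ i else - snd p $ i) p"
      by (cases "\<epsilon> i = 1") (simp_all add: cdiff_map_at_fst_nth cdiff_map_at_snd_nth cdiff_map_at_minus)
    show "cdiff_map_at csc2 (*) (\<lambda>p. if \<epsilon> i = 1 then snd p $ i else fst p $ i) p"
      by (cases "\<epsilon> i = 1") (simp_all add: cdiff_map_at_fst_nth cdiff_map_at_snd_nth)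
  qed
qed

text \<open>The torus acts on base coordinates with \<open>\<epsilon> i = -1\<close> by the inverse.\<close>

definition etwist :: "('d \<Rightarrow> real) \<Rightarrow> complex^'d \<Rightarrow> complex^'d" where
  "etwist \<epsilon> t = (\<chi> i. if \<epsilon> i = 1 then t $ i else inverse (t $ i))"

lemma etwist_etwist: "etwist \<epsilon> (etwist \<epsilon> t) = t"
  by (simp add: etwist_def vec_eq_iff)

lemma ThetaD: "\<epsilon> \<in> Theta \<Longrightarrow> \<epsilon> i = 1 \<or> \<epsilon> i = -1"
  by (simp add: Theta_def)

lemma Theta_square: "\<epsilon> \<in> Theta \<Longrightarrow> \<epsilon> i * (\<epsilon> i * x) = x"
  using ThetaD[of \<epsilon> i] by auto

lemma twist_twist: "\<epsilon> \<in> Theta \<Longrightarrow> twist \<epsilon> (twist \<epsilon> m) = m"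
  by (simp add: twist_def Theta_square)

lemma twist_mem: "\<epsilon> \<in> Theta \<Longrightarrow> v \<in> m \<Longrightarrow> (\<chi> i. \<epsilon> i * v $ i) \<in> twist \<epsilon> m"
  by (simp add: twist_def Theta_square)

lemma etwist_in_ctorus:
  assumes \<epsilon>: "\<epsilon> \<in> Theta" and t: "t \<in> ctorus m"
  shows "etwist \<epsilon> t \<in> ctorus (twist \<epsilon> m)"
proof -
  obtain x y where xy: "x \<in> m" "y \<in> m" "\<forall>i. t $ i = exp (2 * pi * \<i> * Complex (x $ i) (y $ i))"
    using ctorusE[OF t] .
  have "etwist \<epsilon> t = (\<chi> i. exp (2 * pi * \<i> * Complex ((\<chi> i. \<epsilon> i * x $ i) $ i) ((\<chi> i. \<epsilon> i * y $ i) $ i)))"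
    unfolding vec_eq_iff
  proof
    fix i
    show "etwist \<epsilon> t $ i = (\<chi> i. exp (2 * pi * \<i> * Complex ((\<chi> i. \<epsilon> i * x $ i) $ i) ((\<chi> i. \<epsilon> i * y $ i) $ i))) $ i"
      using ThetaD[OF \<epsilon>, of i] xy(3) by (auto simp: etwist_def simp flip: exp_minus complex_minus)
  qed
  then show ?thesis unfolding ctorus_def using twist_mem[OF \<epsilon>] xy(1,2) by blast
qed

lemma etwist_image:
  assumes \<epsilon>: "\<epsilon> \<in> Theta"
  shows "etwist \<epsilon> ` ctorus m = ctorus (twist \<epsilon> m)"
proof (intro equalityI subsetI)
  fix t assume "t \<in> ctorus (twist \<epsilon> m)"
  then have "etwist \<epsilon> t \<in> ctorus m" using etwist_in_ctorus[OF \<epsilon>, of t "twist \<epsilon> m"] twist_twist[OF \<epsilon>] by simp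
  then show "t \<in> etwist \<epsilon> ` ctorus m" using etwist_etwist[of \<epsilon> t] by (metis imageI)
qed (use etwist_in_ctorus[OF \<epsilon>] in auto)

lemma eorbit_eq_corbit:
  assumes \<epsilon>: "\<epsilon> \<in> Theta"
  shows "eorbit (ctorus m) \<epsilon> = corbit (twist \<epsilon> m)"
proof
  fix \<zeta> :: "complex^'a"
  have "(\<chi> i. \<zeta> $ i * (if \<epsilon> i = 1 then t $ i else inverse (t $ i))) = \<zeta> * etwist \<epsilon> t" for t
    by (simp add: etwist_def vec_eq_iff)
  then have "eorbit (ctorus m) \<epsilon> \<zeta> = (\<lambda>t. \<zeta> * t) ` etwist \<epsilon> ` ctorus m"
    unfolding eorbit_def by auto
  then show "eorbit (ctorus m) \<epsilon> \<zeta> = corbit (twist \<epsilon> m) \<zeta>"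
    unfolding etwist_image[OF \<epsilon>] corbit_def by auto
qed

lemma split_coords_hact:
  "split_coords \<epsilon> (hact t p) = (fst (split_coords \<epsilon> p) * etwist \<epsilon> t, snd (split_coords \<epsilon> p) * vinv (etwist \<epsilon> t))"
  by (simp add: split_coords_def hact_def etwist_def vec_eq_iff)

text \<open>The functions \<open>i \<mapsto> normal proj i \<bullet> y\<close> annihilate the kernel of \<open>proj\<close>, and a point \<open>y\<close> outside
finitely many hyperplanes makes all entries nonzero.\<close>

lemma exists_generic_annihilator:
  fixes proj :: "real^'d \<Rightarrow> real^'n"
  assumes lin: "linear proj" and nz: "\<And>i. normal proj i \<noteq> 0"
  shows "\<exists>c :: 'd \<Rightarrow> real. (\<forall>i. c i \<noteq> 0) \<and> (\<forall>v. proj v = 0 \<longrightarrow> (\<Sum>i\<in>UNIV. c i * v $ i) = 0)"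
proof -
  have "negligible (\<Union>i. {x. normal proj i \<bullet> x = 0})"
    by (intro negligible_Union_nat negligible_Union finite_imageI) (use nz in \<open>auto intro: negligible_hyperplane\<close>)
  then have "(\<Union>i. {x. normal proj i \<bullet> x = 0}) \<noteq> UNIV" using non_negligible_UNIV by metis
  then obtain y where y: "\<And>i. normal proj i \<bullet> y \<noteq> 0" by auto
  have "(\<Sum>i\<in>UNIV. (normal proj i \<bullet> y) * v $ i) = proj v \<bullet> y" for v
    by (subst proj_sum[OF lin]) (simp add: inner_sum_left mult.commute)
  then show ?thesis using y by (intro exI[of _ "\<lambda>i. normal proj i \<bullet> y"]) simp
qed

context hyperkaehler_torus
begin

context
  fixes \<epsilon> :: "'d \<Rightarrow> real" assumes \<epsilon>: "\<epsilon> \<in> Theta"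
begin

abbreviation "S_eps \<equiv> semistable_eps M \<alpha> \<epsilon>"

lemma S_eps_iff: "\<zeta> \<in> S_eps \<longleftrightarrow> (\<exists>g. (\<forall>i. g i \<ge> 0 \<and> (g i \<noteq> 0 \<longrightarrow> \<zeta> $ i \<noteq> 0)) \<and>
    (\<forall>v\<in>lie M. \<alpha> v = (\<Sum>i\<in>UNIV. \<epsilon> i * g i * v $ i)))"
proof -
  have sum: "(\<Sum>i | \<epsilon> i = 1. a i * (norm (\<zeta> $ i))\<^sup>2 * v $ i) + (\<Sum>i | \<epsilon> i \<noteq> 1. a i * (norm (\<zeta> $ i))\<^sup>2 * (- (v $ i)))
      = (\<Sum>i\<in>UNIV. \<epsilon> i * (a i * (norm (\<zeta> $ i))\<^sup>2) * v $ i)" for a v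
  proof -
    have "(\<Sum>i\<in>UNIV. \<epsilon> i * (a i * (norm (\<zeta> $ i))\<^sup>2) * v $ i) =
       (\<Sum>i | \<epsilon> i = 1. \<epsilon> i * (a i * (norm (\<zeta> $ i))\<^sup>2) * v $ i) + (\<Sum>i | \<epsilon> i \<noteq> 1. \<epsilon> i * (a i * (norm (\<zeta> $ i))\<^sup>2) * v $ i)"
      by (subst sum.union_disjoint[symmetric]) (auto intro!: sum.cong)
    also have "(\<Sum>i | \<epsilon> i = 1. \<epsilon> i * (a i * (norm (\<zeta> $ i))\<^sup>2) * v $ i) = (\<Sum>i | \<epsilon> i = 1. a i * (norm (\<zeta> $ i))\<^sup>2 * v $ i)"
      by (rule sum.cong) auto
    also have "(\<Sum>i | \<epsilon> i \<noteq> 1. \<epsilon> i * (a i * (norm (\<zeta> $ i))\<^sup>2) * v $ i) = (\<Sum>i | \<epsilon> i \<noteq> 1. a i * (norm (\<zeta> $ i))\<^sup>2 * (- (v $ i)))"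
    proof (rule sum.cong[OF refl])
      fix i assume "i \<in> {i. \<epsilon> i \<noteq> 1}"
      then have "\<epsilon> i = -1" using ThetaD[OF \<epsilon>, of i] by simp
      then show "\<epsilon> i * (a i * (norm (\<zeta> $ i))\<^sup>2) * v $ i = a i * (norm (\<zeta> $ i))\<^sup>2 * (- (v $ i))" by simp
    qed
    finally show ?thesis by simp
  qed
  have *: "\<alpha> = (\<lambda>v\<in>lie M. (\<Sum>i | \<epsilon> i = 1. a i * (norm (\<zeta> $ i))\<^sup>2 * v $ i) + (\<Sum>i | \<epsilon> i \<noteq> 1. a i * (norm (\<zeta> $ i))\<^sup>2 * (- (v $ i))))
     \<longleftrightarrow> (\<forall>v\<in>lie M. \<alpha> v = (\<Sum>i\<in>UNIV. \<epsilon> i * (a i * (norm (\<zeta> $ i))\<^sup>2) * v $ i))" for a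
    unfolding \<alpha>_eq_iff sum ..
  show ?thesis
  proof
    assume "\<zeta> \<in> S_eps"
    then obtain a where a: "\<forall>i. a i \<ge> 0" "\<forall>v\<in>lie M. \<alpha> v = (\<Sum>i\<in>UNIV. \<epsilon> i * (a i * (norm (\<zeta> $ i))\<^sup>2) * v $ i)"
      unfolding semistable_eps_def mem_Collect_eq * by (elim exE conjE)
    then show "\<exists>g. (\<forall>i. g i \<ge> 0 \<and> (g i \<noteq> 0 \<longrightarrow> \<zeta> $ i \<noteq> 0)) \<and> (\<forall>v\<in>lie M. \<alpha> v = (\<Sum>i\<in>UNIV. \<epsilon> i * g i * v $ i))"
      by (intro exI[of _ "\<lambda>i. a i * (norm (\<zeta> $ i))\<^sup>2"]) auto
  next
    assume "\<exists>g. (\<forall>i. g i \<ge> 0 \<and> (g i \<noteq> 0 \<longrightarrow> \<zeta> $ i \<noteq> 0)) \<and> (\<forall>v\<in>lie M. \<alpha> v = (\<Sum>i\<in>UNIV. \<epsilon> i * g i * v $ i))"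
    then obtain g where g: "\<forall>i. g i \<ge> 0 \<and> (g i \<noteq> 0 \<longrightarrow> \<zeta> $ i \<noteq> 0)" "\<forall>v\<in>lie M. \<alpha> v = (\<Sum>i\<in>UNIV. \<epsilon> i * g i * v $ i)"
      by (elim exE conjE)
    define a where "a i = g i / (norm (\<zeta> $ i))\<^sup>2" for i
    have "a i * (norm (\<zeta> $ i))\<^sup>2 = g i" for i using g(1) by (auto simp: a_def)
    then have "\<forall>v\<in>lie M. \<alpha> v = (\<Sum>i\<in>UNIV. \<epsilon> i * (a i * (norm (\<zeta> $ i))\<^sup>2) * v $ i)" using g(2) by simp
    moreover have "\<forall>i. a i \<ge> 0" using g(1) by (simp add: a_def)
    ultimately show "\<zeta> \<in> S_eps" unfolding semistable_eps_def mem_Collect_eq * by (intro exI[of _ a] conjI)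
  qed
qed

lemma S_eps_mono:
  assumes "\<zeta> \<in> S_eps" "\<And>i. \<zeta> $ i \<noteq> 0 \<Longrightarrow> \<zeta>' $ i \<noteq> 0"
  shows "\<zeta>' \<in> S_eps"
proof -
  obtain g where g: "\<forall>i. g i \<ge> 0 \<and> (g i \<noteq> 0 \<longrightarrow> \<zeta> $ i \<noteq> 0)" "\<forall>v\<in>lie M. \<alpha> v = (\<Sum>i\<in>UNIV. \<epsilon> i * g i * v $ i)"
    using assms(1) unfolding S_eps_iff by (elim exE conjE)
  then have "\<forall>i. g i \<ge> 0 \<and> (g i \<noteq> 0 \<longrightarrow> \<zeta>' $ i \<noteq> 0)" using assms(2) by simp
  with g(2) show ?thesis unfolding S_eps_iff by (intro exI[of _ g] conjI)
qed

lemma open_S_eps: "open S_eps"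
proof (rule open_subopen[THEN iffD2], rule ballI)
  fix \<zeta> assume \<zeta>: "\<zeta> \<in> S_eps"
  let ?U = "\<Inter>i\<in>{i. \<zeta> $ i \<noteq> 0}. {\<zeta>'::complex^'d. \<zeta>' $ i \<noteq> 0}"
  have "open {\<zeta>'::complex^'d. \<zeta>' $ i \<noteq> 0}" for i by (intro open_Collect_neq continuous_intros)
  then have "open ?U" by (intro open_INT) auto
  moreover have "\<zeta> \<in> ?U" by auto
  moreover have "?U \<subseteq> S_eps" using S_eps_mono[OF \<zeta>] by auto
  ultimately show "\<exists>T. open T \<and> \<zeta> \<in> T \<and> T \<subseteq> S_eps" by (intro exI[of _ ?U] conjI)
qed

lemma S_eps_nondegenerate:
  assumes "\<zeta> \<in> S_eps" "v \<in> lie M" "\<And>i. \<zeta> $ i \<noteq> 0 \<Longrightarrow> v $ i = 0"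
  shows "v = 0"
proof -
  obtain g where g: "\<forall>i. g i \<ge> 0 \<and> (g i \<noteq> 0 \<longrightarrow> \<zeta> $ i \<noteq> 0)" "\<forall>v\<in>lie M. \<alpha> v = (\<Sum>i\<in>UNIV. \<epsilon> i * g i * v $ i)"
    using assms(1) unfolding S_eps_iff by (elim exE conjE)
  show ?thesis
    by (rule nondegenerate[of "\<lambda>i. \<epsilon> i * g i", OF _ assms(2)]) (use g assms(3) in \<open>auto simp: \<alpha>_eq_iff\<close>)
qed

definition P_eps :: "((complex^'d) \<times> (complex^'d)) set" where
  "P_eps = {p. complex_moment_zero p \<and> base_part \<epsilon> p \<in> S_eps}"

lemma P_eps_subset_S: "P_eps \<subseteq> S"
proof
  fix p assume "p \<in> P_eps"
  then have p: "complex_moment_zero p" "base_part \<epsilon> p \<in> S_eps" by (auto simp: P_eps_def)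
  obtain g where g: "\<forall>i. g i \<ge> 0 \<and> (g i \<noteq> 0 \<longrightarrow> base_part \<epsilon> p $ i \<noteq> 0)" "\<forall>v\<in>lie M. \<alpha> v = (\<Sum>i\<in>UNIV. \<epsilon> i * g i * v $ i)"
    using p(2) unfolding S_eps_iff by (elim exE conjE)
  let ?h = "\<lambda>i. if \<epsilon> i = 1 then g i else 0" and ?k = "\<lambda>i. if \<epsilon> i = 1 then 0 else g i"
  have "?h i - ?k i = \<epsilon> i * g i" for i using ThetaD[OF \<epsilon>, of i] by auto
  then have "\<forall>v\<in>lie M. \<alpha> v = (\<Sum>i\<in>UNIV. (?h i - ?k i) * v $ i)" using g(2) by simp
  moreover have "?h i \<ge> 0 \<and> ?k i \<ge> 0 \<and> (?h i \<noteq> 0 \<longrightarrow> fst p $ i \<noteq> 0) \<and> (?k i \<noteq> 0 \<longrightarrow> snd p $ i \<noteq> 0)" for i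
    using g(1)[rule_format, of i] by (auto simp: base_part_def split_beta)
  ultimately have "weights p ?h ?k" unfolding weights_def by blast
  then show "p \<in> S" using p(1) S_iff by blast
qed

lemma P_eps_eq: "P_eps = {p \<in> S. base_part \<epsilon> p \<in> S_eps}"
proof (intro equalityI subsetI)
  fix p assume "p \<in> P_eps"
  then show "p \<in> {p \<in> S. base_part \<epsilon> p \<in> S_eps}"
    using subsetD[OF P_eps_subset_S, of p] by (simp add: P_eps_def)
next
  fix p assume "p \<in> {p \<in> S. base_part \<epsilon> p \<in> S_eps}"
  then show "p \<in> P_eps" by (simp add: P_eps_def S_iff)
qed

lemma openin_P_eps: "openin (top_of_set S) P_eps"
proof -
  have "continuous_on UNIV (\<lambda>p. fst (split_coords \<epsilon> p))"
    by (intro continuous_on_fst holo_map_imp_continuous_on[OF holo_split_coords])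
  then have "open (base_part \<epsilon> -` S_eps)"
    unfolding fst_split_coords using open_vimage[OF open_S_eps] by blast
  moreover have "P_eps = S \<inter> base_part \<epsilon> -` S_eps" unfolding P_eps_eq by blast
  ultimately show ?thesis by (simp add: openin_open_Int)
qed

lemma base_part_hact: "base_part \<epsilon> (hact t p) = base_part \<epsilon> p * etwist \<epsilon> t"
  using split_coords_hact[of \<epsilon> t p] by (metis fst_conv fst_split_coords)

lemma P_eps_hact: assumes "t \<in> MC" "p \<in> P_eps" shows "hact t p \<in> P_eps"
proof -
  have "base_part \<epsilon> (hact t p) \<in> S_eps"
    by (rule S_eps_mono[of "base_part \<epsilon> p"])
       (use assms ctorus_nonzero[OF assms(1)] in \<open>auto simp: P_eps_def base_part_hact etwist_def\<close>)
  then show ?thesis using assms complex_moment_zero_hact[OF assms(1)] by (simp add: P_eps_def)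
qed

lemma toY_in_U_iff: assumes p: "p \<in> S" shows "toY p \<in> U_set M \<alpha> \<epsilon> \<longleftrightarrow> p \<in> P_eps"
proof -
  have "toY p \<in> U_set M \<alpha> \<epsilon> \<longleftrightarrow> horbit MC p \<in> horbit MC ` P_eps"
    using toY_in_Y[OF p] unfolding U_set_def U_git_def MC_eq P_eps_def mu_C_zero_iff
    by (simp add: to_git_toY[OF p])
  also have "\<dots> \<longleftrightarrow> p \<in> P_eps"
  proof
    assume "horbit MC p \<in> horbit MC ` P_eps"
    then obtain p' where p': "horbit MC p' = horbit MC p" "p' \<in> P_eps" by (metis imageE)
    then obtain t where "t \<in> MC" "p = hact t p'" using horbit_MC_eq_iff by blast
    then show "p \<in> P_eps" using P_eps_hact p' by blast
  qed blast
  finally show ?thesis .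
qed

lemma U_subset: "U_set M \<alpha> \<epsilon> \<subseteq> topspace (Y_top M \<alpha>)"
  by (auto simp: U_set_def)

lemma U_eq: "U_set M \<alpha> \<epsilon> = toY ` P_eps"
proof (intro equalityI subsetI)
  fix y assume y: "y \<in> U_set M \<alpha> \<epsilon>"
  then obtain p where "p \<in> S" "y = toY p" using toY_onto U_subset by (metis imageE subsetD)
  then show "y \<in> toY ` P_eps" using toY_in_U_iff y by blast
next
  fix y assume "y \<in> toY ` P_eps"
  then show "y \<in> U_set M \<alpha> \<epsilon>" using toY_in_U_iff P_eps_subset_S by blast
qed

lemma preimage_U: "{p \<in> S. toY p \<in> U_set M \<alpha> \<epsilon>} = P_eps"
  using toY_in_U_iff P_eps_subset_S by blast

lemma open_U: "openin (Y_top M \<alpha>) (U_set M \<alpha> \<epsilon>)"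
  unfolding openin_Y_iff[OF U_subset] preimage_U by (rule openin_P_eps)

text \<open>A semistable point is moved to the points \<open>P s\<close>, whose coordinate products are shifted by \<open>s c\<^sub>i\<close>.
If one of \<open>z\<^sub>i, w\<^sub>i\<close> is nonzero it is kept and the other one absorbs the shift; if both vanish, the
shift is distributed by means of \<open>sqrt s\<close>, so that both new coordinates tend to \<open>0\<close> as well.\<close>

lemma dense_U:
  assumes ne: "S_eps \<noteq> {}" and c: "\<And>i. c i \<noteq> 0" "\<And>v. v \<in> lie M \<Longrightarrow> (\<Sum>i\<in>UNIV. c i * v $ i) = 0"
  shows "Y_top M \<alpha> closure_of (U_set M \<alpha> \<epsilon>) = topspace (Y_top M \<alpha>)"
proof (rule equalityI[OF closure_of_subset_topspace], rule subsetI)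
  fix y assume y: "y \<in> topspace (Y_top M \<alpha>)"
  show "y \<in> Y_top M \<alpha> closure_of (U_set M \<alpha> \<epsilon>)"
    unfolding in_closure_of
  proof (intro conjI allI impI y)
    fix T assume T: "y \<in> T \<and> openin (Y_top M \<alpha>) T"
    obtain p where p: "p \<in> S" "y = toY p" using y toY_onto by (metis imageE)
    have "T \<subseteq> topspace (Y_top M \<alpha>)" using T openin_subset by blast
    then have "openin (top_of_set S) {p \<in> S. toY p \<in> T}" using T openin_Y_iff by blast
    then obtain O' where O': "open O'" "{p \<in> S. toY p \<in> T} = S \<inter> O'" unfolding openin_open by blast
    have pO: "p \<in> O'" using O'(2) p T by blast
    define z where "z i s = (if fst p $ i \<noteq> 0 then fst p $ i
        else if snd p $ i \<noteq> 0 then of_real (s * c i) / snd p $ i else complex_of_real (sqrt s))" for i and s :: real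
    define w where "w i s = (if fst p $ i \<noteq> 0 then snd p $ i + of_real (s * c i) / fst p $ i
        else if snd p $ i \<noteq> 0 then snd p $ i else complex_of_real (sqrt s) * of_real (c i))" for i and s :: real
    define P where "P s = ((\<chi> i. z i s), (\<chi> i. w i s))" for s
    have prod: "z i s * w i s = fst p $ i * snd p $ i + of_real (s * c i)" if "s > 0" for i s
      using that by (auto simp: z_def w_def field_simps simp flip: of_real_mult)
    have zlim: "(z i \<longlongrightarrow> fst p $ i) (at_right 0)" for i
    proof -
      have "((\<lambda>s. of_real (s * c i) / snd p $ i) \<longlongrightarrow> of_real (0 * c i) / snd p $ i) (at_right 0)"
        if "snd p $ i \<noteq> 0" using that by (intro tendsto_intros)
      moreover have "((\<lambda>s. complex_of_real (sqrt s)) \<longlongrightarrow> of_real (sqrt 0)) (at_right 0)" by (intro tendsto_intros)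
      ultimately show ?thesis
        unfolding z_def by (cases "fst p $ i = 0"; cases "snd p $ i = 0") simp_all
    qed
    have wlim: "(w i \<longlongrightarrow> snd p $ i) (at_right 0)" for i
    proof -
      have "((\<lambda>s. snd p $ i + of_real (s * c i) / fst p $ i) \<longlongrightarrow> snd p $ i + of_real (0 * c i) / fst p $ i) (at_right 0)"
        if "fst p $ i \<noteq> 0" using that by (intro tendsto_intros)
      moreover have "((\<lambda>s. complex_of_real (sqrt s) * of_real (c i)) \<longlongrightarrow> of_real (sqrt 0) * of_real (c i)) (at_right 0)"
        by (intro tendsto_intros)
      ultimately show ?thesis
        unfolding w_def by (cases "fst p $ i = 0"; cases "snd p $ i = 0") simp_all
    qed
    have "(P \<longlongrightarrow> ((\<chi> i. fst p $ i), (\<chi> i. snd p $ i))) (at_right 0)"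
      unfolding P_def by (intro tendsto_Pair tendsto_vec_lambda zlim wlim)
    then have "(P \<longlongrightarrow> p) (at_right 0)" by simp
    then have ev1: "\<forall>\<^sub>F s in at_right 0. P s \<in> O'" using topological_tendstoD O'(1) pO by blast
    have pos: "\<forall>\<^sub>F s :: real in at_right 0. 0 < s" by (rule eventually_at_right_less)
    have ev2: "\<forall>\<^sub>F s in at_right 0. \<forall>i. w i s \<noteq> 0"
    proof (rule eventually_all_finite)
      fix i
      show "\<forall>\<^sub>F s in at_right 0. w i s \<noteq> 0"
      proof (cases "snd p $ i = 0")
        case True
        show ?thesis using pos by eventually_elim (use True c(1)[of i] in \<open>auto simp: w_def\<close>)
      next
        case False
        show ?thesis by (rule tendsto_imp_eventually_ne[OF wlim False])
      qed
    qed
    have "\<forall>\<^sub>F s in at_right 0. P s \<in> O' \<and> (\<forall>i. w i s \<noteq> 0) \<and> 0 < s"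
      using ev1 ev2 pos by eventually_elim blast
    then obtain s where s: "P s \<in> O'" "\<And>i. w i s \<noteq> 0" "0 < s"
      using eventually_happens'[OF trivial_limit_at_right_real] by blast
    have zs: "z i s \<noteq> 0" for i using s(3) c(1)[of i] by (auto simp: z_def)
    have "complex_moment_zero (P s)"
      unfolding complex_moment_zero_def
    proof
      fix v assume v: "v \<in> lie M"
      have "(\<Sum>i\<in>UNIV. fst (P s) $ i * snd (P s) $ i * of_real (v $ i)) =
          (\<Sum>i\<in>UNIV. fst p $ i * snd p $ i * of_real (v $ i)) + of_real (s * (\<Sum>i\<in>UNIV. c i * v $ i))"
        by (simp add: P_def prod[OF s(3)] distrib_right sum.distrib sum_distrib_left mult.assoc)
      also have "\<dots> = 0" using c(2)[OF v] p(1) v unfolding S_iff complex_moment_zero_def by simp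
      finally show "(\<Sum>i\<in>UNIV. fst (P s) $ i * snd (P s) $ i * of_real (v $ i)) = 0" .
    qed
    moreover have "base_part \<epsilon> (P s) \<in> S_eps"
    proof -
      obtain \<zeta> where "\<zeta> \<in> S_eps" using ne by blast
      then show ?thesis by (rule S_eps_mono) (simp add: base_part_def P_def zs s(2))
    qed
    ultimately have Ps: "P s \<in> P_eps" by (simp add: P_eps_def)
    then have "P s \<in> {p \<in> S. toY p \<in> T}" using P_eps_subset_S s(1) O'(2) by blast
    then show "\<exists>y. y \<in> U_set M \<alpha> \<epsilon> \<and> y \<in> T" using U_eq Ps by blast
  qed
qed

lemma split_mem_iff:
  "split_coords \<epsilon> p \<in> {(\<zeta>, \<eta>). \<zeta> \<in> S_eps \<and> (\<forall>v\<in>twist \<epsilon> (lie M). (\<Sum>i\<in>UNIV. \<zeta> $ i * \<eta> $ i * of_real (v $ i)) = 0)}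
     \<longleftrightarrow> p \<in> P_eps"
proof -
  let ?\<zeta> = "fst (split_coords \<epsilon> p)" and ?\<eta> = "snd (split_coords \<epsilon> p)"
  have prod: "?\<zeta> $ i * ?\<eta> $ i = of_real (\<epsilon> i) * (fst p $ i * snd p $ i)" for i
    using ThetaD[OF \<epsilon>, of i] by (auto simp: split_coords_def)
  have sum: "(\<Sum>i\<in>UNIV. ?\<zeta> $ i * ?\<eta> $ i * of_real (v $ i)) = (\<Sum>i\<in>UNIV. fst p $ i * snd p $ i * of_real ((\<chi> i. \<epsilon> i * v $ i) $ i))" for v
    unfolding prod by (simp add: mult_ac)
  have "(\<forall>v\<in>twist \<epsilon> (lie M). (\<Sum>i\<in>UNIV. ?\<zeta> $ i * ?\<eta> $ i * of_real (v $ i)) = 0) \<longleftrightarrow> complex_moment_zero p"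
    unfolding sum complex_moment_zero_def
  proof
    assume *: "\<forall>v\<in>twist \<epsilon> (lie M). (\<Sum>i\<in>UNIV. fst p $ i * snd p $ i * of_real ((\<chi> i. \<epsilon> i * v $ i) $ i)) = 0"
    show "\<forall>v\<in>lie M. (\<Sum>i\<in>UNIV. fst p $ i * snd p $ i * of_real (v $ i)) = 0"
    proof
      fix v assume "v \<in> lie M"
      from *[rule_format, OF twist_mem[OF \<epsilon> this]]
      show "(\<Sum>i\<in>UNIV. fst p $ i * snd p $ i * of_real (v $ i)) = 0" by (simp add: Theta_square[OF \<epsilon>])
    qed
  next
    assume *: "\<forall>v\<in>lie M. (\<Sum>i\<in>UNIV. fst p $ i * snd p $ i * of_real (v $ i)) = 0"
    show "\<forall>v\<in>twist \<epsilon> (lie M). (\<Sum>i\<in>UNIV. fst p $ i * snd p $ i * of_real ((\<chi> i. \<epsilon> i * v $ i) $ i)) = 0"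
    proof
      fix v assume "v \<in> twist \<epsilon> (lie M)"
      then have "(\<chi> i. \<epsilon> i * v $ i) \<in> lie M" by (simp add: twist_def)
      from *[rule_format, OF this]
      show "(\<Sum>i\<in>UNIV. fst p $ i * snd p $ i * of_real ((\<chi> i. \<epsilon> i * v $ i) $ i)) = 0" .
    qed
  qed
  then show ?thesis unfolding mem_Collect_eq split_beta P_eps_def fst_split_coords by blast
qed

lemma X_cspace_eq: "X_cspace M \<alpha> \<epsilon> = torus_quotient_cspace (twist \<epsilon> (lie M)) S_eps"
  unfolding X_cspace_def torus_quotient_cspace_def MC_eq eorbit_eq_corbit[OF \<epsilon>] ..

lemma torus_quotient_eps:
  fixes proj :: "real^'d \<Rightarrow> real^'n"
  assumes "linear proj" "surj proj" "{v. proj v = 0} = lie M" "regular_normals proj"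
  shows "torus_quotient (twist \<epsilon> (lie M)) S_eps
     {(k :: 'n \<Rightarrow> 'd, N). chart_datum (twist \<epsilon> (lie M)) k N}"
proof
  show "subspace (twist \<epsilon> (lie M))" by (rule subspace_twist[OF subspace_lie])
  show "open S_eps" by (rule open_S_eps)
  show "\<zeta> * t \<in> S_eps" if "\<zeta> \<in> S_eps" "t \<in> ctorus (twist \<epsilon> (lie M))" for \<zeta> t
    by (rule S_eps_mono[OF that(1)]) (simp add: ctorus_nonzero[OF that(2)])
  show "chart_datum (twist \<epsilon> (lie M)) k N" if "(k, N) \<in> {(k :: 'n \<Rightarrow> 'd, N). chart_datum (twist \<epsilon> (lie M)) k N}" for k N
    using that by simp
  show "\<exists>k N. (k, N) \<in> {(k :: 'n \<Rightarrow> 'd, N). chart_datum (twist \<epsilon> (lie M)) k N} \<and> (\<forall>i. i \<notin> range k \<longrightarrow> \<zeta> $ i \<noteq> 0)"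
    if \<zeta>: "\<zeta> \<in> S_eps" for \<zeta>
    using exists_chart_datum[OF assms \<epsilon>, of "{i. \<zeta> $ i \<noteq> 0}"] S_eps_nondegenerate[OF \<zeta>] by simp
qed

text \<open>On the semistable points over \<open>U\<close>, the maps \<open>Q\<close> to the cotangent bundle and \<open>toY\<close> to \<open>U\<close> are both
quotient maps for topology and complex structure, and both have the orbits of the complex torus
as fibres. So they induce an isomorphism between their targets.\<close>

lemma cotangent_bundle_biholomorphic_U:
  fixes proj :: "real^'d \<Rightarrow> real^'n"
  assumes "linear proj" "surj proj" "{v. proj v = 0} = lie M" "regular_normals proj"
  shows "\<exists>\<Phi> :: (complex^'d) set \<times> ((complex^'d) set, 'n) covector \<Rightarrow> ((complex^'d) \<times> (complex^'d)) set.
     biholomorphic_map (cotangent_bundle (X_cspace M \<alpha> \<epsilon>)) (open_subspace (Y_cspace M \<alpha>) (U_set M \<alpha> \<epsilon>)) \<Phi>"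
proof -
  interpret tq: torus_quotient "twist \<epsilon> (lie M)" S_eps "{(k :: 'n \<Rightarrow> 'd, N). chart_datum (twist \<epsilon> (lie M)) k N}"
    by (rule torus_quotient_eps[OF assms])
  have X: "X_cspace M \<alpha> \<epsilon> = tq.X" unfolding X_cspace_eq tq.X_def ..
  have PP: "split_coords \<epsilon> p \<in> tq.P \<longleftrightarrow> p \<in> P_eps" for p
    unfolding tq.P_def by (rule split_mem_iff)
  define Q where "Q p = tq.psi (split_coords \<epsilon> p)" for p
  have Q_image: "Q ` P_eps = cotangent_points tq.X"
  proof -
    have "split_coords \<epsilon> ` P_eps = tq.P"
    proof (intro equalityI subsetI)
      fix x assume "x \<in> tq.P"
      then have "unsplit_coords \<epsilon> x \<in> P_eps" using PP[of "unsplit_coords \<epsilon> x"] by simp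
      then show "x \<in> split_coords \<epsilon> ` P_eps" by (metis imageI split_unsplit)
    qed (use PP in auto)
    then show ?thesis using tq.psi_image unfolding Q_def by (metis image_image)
  qed
  have Q_eq: "Q p = Q p' \<longleftrightarrow> toY p = toY p'" if p: "p \<in> P_eps" "p' \<in> P_eps" for p p'
  proof -
    have S: "p \<in> S" "p' \<in> S" using p P_eps_subset_S by auto
    have eq: "p' = hact t p \<longleftrightarrow> fst (split_coords \<epsilon> p') = fst (split_coords \<epsilon> p) * etwist \<epsilon> t \<and>
        snd (split_coords \<epsilon> p') = snd (split_coords \<epsilon> p) * vinv (etwist \<epsilon> t)" for t
    proof -
      have "p' = hact t p \<longleftrightarrow> split_coords \<epsilon> p' = split_coords \<epsilon> (hact t p)" by (metis unsplit_split)
      then show ?thesis by (simp add: split_coords_hact prod_eq_iff)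
    qed
    have "Q p = Q p' \<longleftrightarrow> (\<exists>t\<in>ctorus (twist \<epsilon> (lie M)). fst (split_coords \<epsilon> p') = fst (split_coords \<epsilon> p) * t \<and>
        snd (split_coords \<epsilon> p') = snd (split_coords \<epsilon> p) * vinv t)"
      unfolding Q_def by (rule tq.psi_eq_iff) (use p PP in auto)
    also have "\<dots> \<longleftrightarrow> (\<exists>t\<in>MC. p' = hact t p)"
      unfolding etwist_image[OF \<epsilon>, symmetric] eq by blast
    finally show ?thesis unfolding toY_eq_iff[OF S] .
  qed
  define \<Phi> where "\<Phi> x = toY (SOME p. p \<in> P_eps \<and> Q p = x)" for x
  have \<Phi>Q: "\<Phi> (Q p) = toY p" if p: "p \<in> P_eps" for p
  proof -
    have "(SOME p'. p' \<in> P_eps \<and> Q p' = Q p) \<in> P_eps \<and> Q (SOME p'. p' \<in> P_eps \<and> Q p' = Q p) = Q p"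
      by (rule someI[of "\<lambda>p'. p' \<in> P_eps \<and> Q p' = Q p" p]) (simp add: p)
    then show ?thesis unfolding \<Phi>_def using Q_eq[OF _ p] by blast
  qed
  have ts: "topspace (cotangent_topology tq.X) = Q ` P_eps"
    unfolding Q_image by (rule tq.topspace_cotangent)
  have tU: "topspace (subtopology (Y_top M \<alpha>) (U_set M \<alpha> \<epsilon>)) = U_set M \<alpha> \<epsilon>"
    using U_subset by (auto simp: topspace_subtopology)
  have pre: "{p \<in> P_eps. Q p \<in> {x \<in> Q ` P_eps. \<Phi> x \<in> W}} = {p \<in> P_eps. toY p \<in> W}" for W
  proof -
    have "Q p \<in> {x \<in> Q ` P_eps. \<Phi> x \<in> W} \<longleftrightarrow> toY p \<in> W" if "p \<in> P_eps" for p
      using that \<Phi>Q[OF that] by simp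
    then show ?thesis by blast
  qed
  have preU: "{p \<in> S. toY p \<in> W} = {p \<in> P_eps. toY p \<in> W}" if "W \<subseteq> U_set M \<alpha> \<epsilon>" for W
    using that toY_in_U_iff P_eps_subset_S by blast
  have openQ: "openin (cotangent_topology tq.X) G \<longleftrightarrow> openin (top_of_set P_eps) {p \<in> P_eps. Q p \<in> G}"
    if G: "G \<subseteq> cotangent_points tq.X" for G :: "((complex^'d) set \<times> ((complex^'d) set, 'n) covector) set"
  proof -
    have "openin (top_of_set tq.P) {x \<in> tq.P. tq.psi x \<in> G} \<longleftrightarrow> openin (top_of_set P_eps) {p \<in> P_eps. Q p \<in> G}"
    proof
      assume "openin (top_of_set tq.P) {x \<in> tq.P. tq.psi x \<in> G}"
      from continuous_openin_preimage[OF holo_map_imp_continuous_on[OF holo_split_coords[of P_eps \<epsilon>]] _ this]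
      have "openin (top_of_set P_eps) (P_eps \<inter> split_coords \<epsilon> -` {x \<in> tq.P. tq.psi x \<in> G})" using PP by auto
      moreover have "P_eps \<inter> split_coords \<epsilon> -` {x \<in> tq.P. tq.psi x \<in> G} = {p \<in> P_eps. Q p \<in> G}"
        using PP by (auto simp: Q_def)
      ultimately show "openin (top_of_set P_eps) {p \<in> P_eps. Q p \<in> G}" by simp
    next
      assume o: "openin (top_of_set P_eps) {p \<in> P_eps. Q p \<in> G}"
      have PP': "unsplit_coords \<epsilon> x \<in> P_eps \<longleftrightarrow> x \<in> tq.P" for x using PP[of "unsplit_coords \<epsilon> x"] by simp
      from continuous_openin_preimage[OF holo_map_imp_continuous_on[OF holo_unsplit_coords[of tq.P \<epsilon>]] _ o]
      have "openin (top_of_set tq.P) (tq.P \<inter> unsplit_coords \<epsilon> -` {p \<in> P_eps. Q p \<in> G})" using PP' by auto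
      moreover have "tq.P \<inter> unsplit_coords \<epsilon> -` {p \<in> P_eps. Q p \<in> G} = {x \<in> tq.P. tq.psi x \<in> G}"
        using PP' by (auto simp: Q_def)
      ultimately show "openin (top_of_set tq.P) {x \<in> tq.P. tq.psi x \<in> G}" by simp
    qed
    then show ?thesis using tq.openin_cotangent_iff[OF G] by simp
  qed
  have hom: "homeomorphic_map (cotangent_topology tq.X) (subtopology (Y_top M \<alpha>) (U_set M \<alpha> \<epsilon>)) \<Phi>"
    unfolding homeomorphic_map_def quotient_map_def ts tU
  proof (intro conjI allI impI)
    show "\<Phi> ` Q ` P_eps = U_set M \<alpha> \<epsilon>"
      unfolding U_eq image_image by (rule image_cong[OF refl \<Phi>Q])
    show "inj_on \<Phi> (Q ` P_eps)"
    proof (rule inj_onI, elim imageE)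
      fix x y p p' assume "\<Phi> x = \<Phi> y" "x = Q p" "p \<in> P_eps" "y = Q p'" "p' \<in> P_eps"
      then show "x = y" using \<Phi>Q Q_eq by simp
    qed
    fix W assume W: "W \<subseteq> U_set M \<alpha> \<epsilon>"
    have "{x \<in> Q ` P_eps. \<Phi> x \<in> W} \<subseteq> cotangent_points tq.X" unfolding Q_image by auto
    then have "openin (cotangent_topology tq.X) {x \<in> Q ` P_eps. \<Phi> x \<in> W} \<longleftrightarrow> openin (top_of_set P_eps) {p \<in> P_eps. toY p \<in> W}"
      using openQ pre by simp
    also have "\<dots> \<longleftrightarrow> openin (top_of_set S) {p \<in> P_eps. toY p \<in> W}"
    proof
      assume "openin (top_of_set P_eps) {p \<in> P_eps. toY p \<in> W}"
      then show "openin (top_of_set S) {p \<in> P_eps. toY p \<in> W}" using openin_P_eps openin_trans by blast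
    next
      assume "openin (top_of_set S) {p \<in> P_eps. toY p \<in> W}"
      then show "openin (top_of_set P_eps) {p \<in> P_eps. toY p \<in> W}"
        by (rule openin_subset_trans) (use P_eps_subset_S in auto)
    qed
    also have "\<dots> \<longleftrightarrow> openin (Y_top M \<alpha>) W"
      using openin_Y_iff[of W] W U_subset preU[OF W] by auto
    also have "\<dots> \<longleftrightarrow> openin (subtopology (Y_top M \<alpha>) (U_set M \<alpha> \<epsilon>)) W"
      using W openin_open_subtopology[OF open_U] by blast
    finally show "openin (cotangent_topology tq.X) {x \<in> Q ` P_eps. \<Phi> x \<in> W} \<longleftrightarrow> openin (subtopology (Y_top M \<alpha>) (U_set M \<alpha> \<epsilon>)) W" .
  qed
  have sheaf: "snd (Y_cspace M \<alpha>) V f \<longleftrightarrow> snd (cotangent_bundle tq.X) {x \<in> Q ` P_eps. \<Phi> x \<in> V} (f \<circ> \<Phi>)"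
    if V: "openin (subtopology (Y_top M \<alpha>) (U_set M \<alpha> \<epsilon>)) V" for V f
  proof -
    have VU: "V \<subseteq> U_set M \<alpha> \<epsilon>" using openin_subset[OF V] unfolding tU .
    let ?G = "{x \<in> Q ` P_eps. \<Phi> x \<in> V}"
    have "snd (Y_cspace M \<alpha>) V f \<longleftrightarrow> holo_map csc2 (*) {p \<in> P_eps. toY p \<in> V} (\<lambda>p. f (toY p))"
      using holo_Y_iff[of V f] VU U_subset preU[OF VU] by auto
    also have "\<dots> \<longleftrightarrow> holo_map csc2 (*) {p \<in> P_eps. Q p \<in> ?G} (\<lambda>p. f (\<Phi> (Q p)))"
      unfolding pre by (rule holo_map_cong) (simp add: \<Phi>Q)
    also have "\<dots> \<longleftrightarrow> holo_map csc2 (*) {x \<in> tq.P. tq.psi x \<in> ?G} (\<lambda>x. f (\<Phi> (tq.psi x)))"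
    proof
      assume h: "holo_map csc2 (*) {p \<in> P_eps. Q p \<in> ?G} (\<lambda>p. f (\<Phi> (Q p)))"
      have "holo_map csc2 (*) {x \<in> tq.P. tq.psi x \<in> ?G} (\<lambda>x. f (\<Phi> (Q (unsplit_coords \<epsilon> x))))"
      proof (rule holo_map_compose[OF holo_unsplit_coords _ h])
        fix x assume "x \<in> {x \<in> tq.P. tq.psi x \<in> ?G}"
        then show "unsplit_coords \<epsilon> x \<in> {p \<in> P_eps. Q p \<in> ?G}"
          using PP[of "unsplit_coords \<epsilon> x"] by (simp add: Q_def)
      qed
      then show "holo_map csc2 (*) {x \<in> tq.P. tq.psi x \<in> ?G} (\<lambda>x. f (\<Phi> (tq.psi x)))" by (simp add: Q_def)
    next
      assume h: "holo_map csc2 (*) {x \<in> tq.P. tq.psi x \<in> ?G} (\<lambda>x. f (\<Phi> (tq.psi x)))"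
      have "holo_map csc2 (*) {p \<in> P_eps. Q p \<in> ?G} (\<lambda>p. f (\<Phi> (tq.psi (split_coords \<epsilon> p))))"
      proof (rule holo_map_compose[OF holo_split_coords _ h])
        fix p assume "p \<in> {p \<in> P_eps. Q p \<in> ?G}"
        then show "split_coords \<epsilon> p \<in> {x \<in> tq.P. tq.psi x \<in> ?G}"
          using PP[of p] by (simp add: Q_def)
      qed
      then show "holo_map csc2 (*) {p \<in> P_eps. Q p \<in> ?G} (\<lambda>p. f (\<Phi> (Q p)))" by (simp add: Q_def)
    qed
    also have "\<dots> \<longleftrightarrow> snd (cotangent_bundle tq.X) ?G (f \<circ> \<Phi>)"
      unfolding tq.cotangent_holo_iff comp_def ..
    finally show ?thesis .
  qed
  have "biholomorphic_map (cotangent_bundle tq.X) (open_subspace (Y_cspace M \<alpha>) (U_set M \<alpha> \<epsilon>)) \<Phi>"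
    unfolding biholomorphic_map_def open_subspace_def
  proof (intro conjI allI impI)
    show "homeomorphic_map (fst (cotangent_bundle tq.X)) (fst (subtopology (fst (Y_cspace M \<alpha>)) (U_set M \<alpha> \<epsilon>), snd (Y_cspace M \<alpha>))) \<Phi>"
      using hom by (simp add: cotangent_bundle_def Y_cspace_def)
    fix V f assume "openin (fst (subtopology (fst (Y_cspace M \<alpha>)) (U_set M \<alpha> \<epsilon>), snd (Y_cspace M \<alpha>))) V"
    then have V: "openin (subtopology (Y_top M \<alpha>) (U_set M \<alpha> \<epsilon>)) V" by (simp add: Y_cspace_def)
    have "topspace (fst (cotangent_bundle tq.X)) = Q ` P_eps" using ts by (simp add: cotangent_bundle_def)
    then show "snd (subtopology (fst (Y_cspace M \<alpha>)) (U_set M \<alpha> \<epsilon>), snd (Y_cspace M \<alpha>)) V f \<longleftrightarrow>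
       snd (cotangent_bundle tq.X) {x \<in> topspace (fst (cotangent_bundle tq.X)). \<Phi> x \<in> V} (f \<circ> \<Phi>)"
      using sheaf[OF V, of f] by simp
  qed
  then show ?thesis unfolding X by blast
qed

end

end

theorem corollary4p3:
  fixes M :: "(complex^'d) set"
    and proj :: "real^'d \<Rightarrow> real^'n"
    and \<alpha> :: "real^'d \<Rightarrow> real"
    and l :: "real^'d"
    and \<epsilon> :: "'d \<Rightarrow> real"
  assumes "subtorus M"
    and "linear proj" and "surj proj" and "{v. proj v = 0} = lie M"
    and "\<And>i. primitive_in (proj ` int_lattice) (normal proj i)"
    and "\<alpha> \<in> dual_of (lie M)"
    and "\<alpha> = lift_to M l"
    and "smooth M proj \<alpha>"
    and "core M proj \<alpha> l \<noteq> {}"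
    and "\<epsilon> \<in> Theta"
    and "topspace (fst (X_cspace M \<alpha> \<epsilon>)) \<noteq> {}"
  shows "(\<exists>\<Phi> :: (complex^'d) set \<times> ((complex^'d) set, 'n) covector
                 \<Rightarrow> ((complex^'d) \<times> (complex^'d)) set.
            biholomorphic_map (cotangent_bundle (X_cspace M \<alpha> \<epsilon>))
              (open_subspace (Y_cspace M \<alpha>) (U_set M \<alpha> \<epsilon>)) \<Phi>)
       \<and> openin (Y_top M \<alpha>) (U_set M \<alpha> \<epsilon>)
       \<and> Y_top M \<alpha> closure_of (U_set M \<alpha> \<epsilon>) = topspace (Y_top M \<alpha>)"
proof -
  have reg: "regular_normals proj" "regular_value M \<alpha>" using \<open>smooth M proj \<alpha>\<close> by (auto simp: smooth_def)
  have sub: "subspace (lie M)"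
    unfolding \<open>{v. proj v = 0} = lie M\<close>[symmetric] using \<open>linear proj\<close>
    by (simp add: subspace_def linear_0 linear_add linear_scale)
  interpret hyperkaehler_torus M \<alpha>
  proof
    show "\<alpha> = restrict \<alpha> (lie M)" unfolding \<open>\<alpha> = lift_to M l\<close> lift_to_def by (simp add: fun_eq_iff)
    show "v = 0" if "\<alpha> = (\<lambda>v\<in>lie M. \<Sum>i\<in>UNIV. c i * v $ i)" "v \<in> lie M" "\<And>i. c i \<noteq> 0 \<Longrightarrow> v $ i = 0" for c v
      by (rule regular_value_nondegenerate[OF reg(2) that])
  qed (fact \<open>subtorus M\<close> sub)+
  have "semistable_eps M \<alpha> \<epsilon> \<noteq> {}"
  proof
    assume e: "semistable_eps M \<alpha> \<epsilon> = {}"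
    have "openin (fst (X_cspace M \<alpha> \<epsilon>)) (topspace (fst (X_cspace M \<alpha> \<epsilon>)))" by (rule openin_topspace)
    then have "topspace (fst (X_cspace M \<alpha> \<epsilon>)) \<subseteq> {}"
      unfolding X_cspace_def fst_conv openin_quotient_topology[of _ _ "topspace _"] e by simp
    then show False using \<open>topspace (fst (X_cspace M \<alpha> \<epsilon>)) \<noteq> {}\<close> by simp
  qed
  moreover have "normal proj i \<noteq> 0" for i using assms(5)[of i] by (simp add: primitive_in_def)
  then obtain c :: "'d \<Rightarrow> real" where "\<And>i. c i \<noteq> 0" "\<And>v. proj v = 0 \<Longrightarrow> (\<Sum>i\<in>UNIV. c i * v $ i) = 0"
    using exists_generic_annihilator[OF \<open>linear proj\<close>] by metis
  ultimately have "Y_top M \<alpha> closure_of (U_set M \<alpha> \<epsilon>) = topspace (Y_top M \<alpha>)"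
    using dense_U[OF \<open>\<epsilon> \<in> Theta\<close>, of c] \<open>{v. proj v = 0} = lie M\<close> by blast
  then show ?thesis
    using cotangent_bundle_biholomorphic_U[OF \<open>\<epsilon> \<in> Theta\<close> assms(2-4) reg(1)] open_U[OF \<open>\<epsilon> \<in> Theta\<close>] by blast
qed

end
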